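(* Let $X$ be a Polish space and let $P$ be a point process on $X$ of first order. Then $P$ is a Poisson point process if and only if its splitting law factorizes into its marginals, that is, $$S_q(P) = \Gamma_q(P) \otimes \Gamma_{1-q}(P)$$ for some $q\in(0,1)$.
   Context: $X$ is a Polish space, with bounded sets understood with respect to a fixed complete metric generating its topology; $\mathcal{B}(X)$ denotes its Borel sets. $\mathcal{M}(X)$ is the space of locally finite (Radon) measures on $X$, i.e. Borel measures finite on bounded Borel sets, equipped with the vague topology, for which it is Polish. $\mathcal{M}^{\cdot\cdot}(X)\subset\mathcal{M}(X)$ is the closed (hence measurable) subspace of Radon point measures (integer-valued locally finite measures; multiple points are allowed). A point process on $X$ is a probability law $P$ on $\mathcal{M}^{\cdot\cdot}(X)$. Its first moment measure is $\nu_P(B)=\int_{\mathcal{M}^{\cdot\cdot}(X)} \mu(B)\,P(d\mu)$, $B\in\mathcal{B}(X)$. $P$ is of first order if $\nu_P\in\mathcal{M}(X)$. For $\varrho\in\mathcal{M}(X)$ (atoms allowed), $\Pi_\varrho$ denotes the Poisson point process with first moment measure (intensity) $\varrho$, i.e. the point process with Laplace transform $\int e^{-\mu(f)}\,\Pi_\varrho(d\mu)=\exp\left(-\int_X (1-e^{-f})\,d\varrho\right)$ for all non-negative bounded measurable $f$ on $X$ with support contained in a bounded set. A point process $P$ is a Poisson point process if $P=\Pi_\varrho$ for some $\varrho\in\mathcal{M}(X)$. For $q\in(0,1)$ and $\mu\in\mathcal{M}^{\cdot\cdot}(X)$, the independent $q$-thinning of $\mu$ is the point process $$T^\mu_q =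 \mathop{\ast}_{x\in\mu}\left((1-q)\,\delta_{\mathbf{0}}+q\,\delta_{\delta_x}\right)^{\ast\mu(\{x\})},$$ where $\ast$ is convolution of point processes (law of the sum of independent point processes), $\mathbf{0}$ is the zero measure on $X$, and "$x\in\mu$" means that the convolution is over the set $\{y\in X : \mu(\{y\})>0\}$. That is, each point of $\mu$, counted with multiplicity, is independently kept with probability $q$ and deleted with probability $1-q$. The independent $q$-thinning of a point process $P$ is $\Gamma_q(P)=\int_{\mathcal{M}^{\cdot\cdot}(X)} P(d\mu)\,T^\mu_q$. The splitting law $S_q(P)$ is the law on $\mathcal{M}^{\cdot\cdot}(X)\times\mathcal{M}^{\cdot\cdot}(X)$ given by $$S_q(P)(h)=\int_{\mathcal{M}^{\cdot\cdot}(X)}\int_{\mathcal{M}^{\cdot\cdot}(X)} h(\nu,\mu-\nu)\,T^\mu_q(d\nu)\,P(d\mu)$$ for all non-negative measurable $h$ on $\mathcal{M}^{\cdot\cdot}(X)\times\mathcal{M}^{\cdot\cdot}(X)$ (note that $\mu-\nu\in\mathcal{M}^{\cdot\cdot}(X)$ for $T^\mu_q$-almost every $\nu$). Its marginals are $\Gamma_q(P)$ and $\Gamma_{1-q}(P)$. *)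

theory Defs
  imports "HOL-Probability.Probability"
begin

text \<open>The Polish space is the carrier of a type of class \<open>polish_space\<close>; the metric of the type
  is the fixed complete metric, so boundedness is \<open>bounded\<close>.\<close>

definition locally_finite_measures :: "'a::polish_space measure set" where
  "locally_finite_measures =
     {\<mu>. sets \<mu> = sets borel \<and> (\<forall>B\<in>sets borel. bounded B \<longrightarrow> emeasure \<mu> B < \<infinity>)}"

definition vague_test_functions :: "('a::polish_space \<Rightarrow> real) set" where
  "vague_test_functions =
     {f. continuous_on UNIV f \<and> bounded (range f) \<and> bounded {x. f x \<noteq> 0}}"

text \<open>The coarsest topology on the locally finite measures that makes \<open>\<mu> \<mapsto> \<integral>f d\<mu>\<close>
  continuous for every test function \<open>f\<close>.\<close>

definition vague_topology :: "'a::polish_space measure topology" where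
  "vague_topology = topology_generated_by
     {{\<mu> \<in> locally_finite_measures. (\<integral>x. f x \<partial>\<mu>) \<in> U} | f U.
        f \<in> vague_test_functions \<and> open U}"

definition point_measures :: "'a::polish_space measure set" where
  "point_measures = {\<mu> \<in> locally_finite_measures.
     \<forall>B\<in>sets borel. bounded B \<longrightarrow> (\<exists>n::nat. emeasure \<mu> B = of_nat n)}"

definition borel_of_topology :: "'b topology \<Rightarrow> 'b measure" where
  "borel_of_topology T = sigma (topspace T) {U. openin T U}"

definition PM :: "'a::polish_space measure measure" where
  "PM = borel_of_topology (subtopology vague_topology point_measures)"

lemma topspace_vague_topology: "topspace vague_topology = locally_finite_measures"
proof -
  have "(\<lambda>_. 0) \<in> vague_test_functions"
    by (simp add: vague_test_functions_def)
  then have "locally_finite_measures \<in> {{\<mu> \<in> locally_finite_measures. (\<integral>x. f x \<partial>\<mu>) \<in> U} | f U.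
      f \<in> vague_test_functions \<and> open U}"
    by (intro CollectI exI[of _ "\<lambda>_. 0"] exI[of _ UNIV]) auto
  then show ?thesis
    unfolding vague_topology_def topology_generated_by_topspace by blast
qed

lemma space_PM: "space PM = point_measures"
  by (auto simp: PM_def borel_of_topology_def topspace_vague_topology point_measures_def
      space_measure_of_conv)

definition point_process :: "'a::polish_space measure measure \<Rightarrow> bool" where
  "point_process P \<longleftrightarrow> prob_space P \<and> sets P = sets PM"

definition first_moment_measure :: "'a::polish_space measure measure \<Rightarrow> 'a measure" where
  "first_moment_measure P =
     measure_of UNIV (sets borel) (\<lambda>B. \<integral>\<^sup>+\<mu>. emeasure \<mu> B \<partial>P)"

definition first_order :: "'a::polish_space measure measure \<Rightarrow> bool" where
  "first_order P \<longleftrightarrow> first_moment_measure P \<in> locally_finite_measures"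

text \<open>\<open>poisson_with_intensity \<rho> P\<close> expresses that \<open>P\<close> is the Poisson point process with
  intensity \<open>\<rho>\<close>; a point process is determined by its Laplace transform.\<close>

definition poisson_with_intensity ::
    "'a::polish_space measure \<Rightarrow> 'a measure measure \<Rightarrow> bool" where
  "poisson_with_intensity \<rho> P \<longleftrightarrow> point_process P \<and>
     (\<forall>f::'a \<Rightarrow> real. f \<in> borel_measurable borel \<and> (\<forall>x. 0 \<le> f x) \<and> bounded (range f) \<and>
          bounded {x. f x \<noteq> 0} \<longrightarrow>
        (\<integral>\<mu>. exp (- (\<integral>x. f x \<partial>\<mu>)) \<partial>P) = exp (- (\<integral>x. 1 - exp (- f x) \<partial>\<rho>)))"

definition poisson_process :: "'a::polish_space measure measure \<Rightarrow> bool" where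
  "poisson_process P \<longleftrightarrow> (\<exists>\<rho>\<in>locally_finite_measures. poisson_with_intensity \<rho> P)"

definition sum_measures :: "'i set \<Rightarrow> ('i \<Rightarrow> 'a::polish_space measure) \<Rightarrow> 'a measure" where
  "sum_measures I \<mu> =
     measure_of UNIV (sets borel) (\<lambda>B. \<integral>\<^sup>+i. emeasure (\<mu> i) B \<partial>count_space I)"

text \<open>An infinite sum of point measures need not be locally finite. The value \<open>0\<close> chosen in that
  case is irrelevant whenever the sum is almost surely locally finite, which holds for all
  convolutions used below. Here \<open>I\<close> is meant to be countable.\<close>

definition superposition :: "'i set \<Rightarrow> ('i \<Rightarrow> 'a::polish_space measure) \<Rightarrow> 'a measure" where
  "superposition I \<mu> =
     (if sum_measures I \<mu> \<in> point_measures then sum_measures I \<mu> else null_measure borel)"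

definition convolution ::
    "'i set \<Rightarrow> ('i \<Rightarrow> 'a::polish_space measure measure) \<Rightarrow> 'a measure measure" where
  "convolution I Q = distr (PiM I Q) PM (superposition I)"

definition thinned_point :: "real \<Rightarrow> 'a::polish_space \<Rightarrow> 'a measure measure" where
  "thinned_point q x =
     distr (bernoulli_pmf q) PM (\<lambda>keep. if keep then return borel x else null_measure borel)"

definition multiplicity_at :: "'a::polish_space measure \<Rightarrow> 'a \<Rightarrow> nat" where
  "multiplicity_at \<mu> x = nat \<lfloor>measure \<mu> {x}\<rfloor>"

definition thinning_kernel :: "real \<Rightarrow> 'a::polish_space measure \<Rightarrow> 'a measure measure" where
  "thinning_kernel q \<mu> =
     convolution {x. emeasure \<mu> {x} > 0}
       (\<lambda>x. convolution {..<multiplicity_at \<mu> x} (\<lambda>_. thinned_point q x))"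

definition thinning ::
    "real \<Rightarrow> 'a::polish_space measure measure \<Rightarrow> 'a measure measure" where
  "thinning q P = P \<bind> thinning_kernel q"

text \<open>The difference of point measures: the library's subtraction of measures is unsuitable,
  since \<open>emeasure \<mu> B - emeasure \<nu> B\<close> is not additive in \<open>B\<close> when both terms may be infinite.
  If \<open>\<nu> \<le> \<mu>\<close> fails, the value is the zero measure; this is a null event for the splitting law.\<close>

definition point_measure_diff ::
    "'a::polish_space measure \<Rightarrow> 'a measure \<Rightarrow> 'a measure" where
  "point_measure_diff \<mu> \<nu> =
     (let is_diff = (\<lambda>\<kappa>. \<kappa> \<in> point_measures \<and>
            (\<forall>B\<in>sets borel. emeasure \<mu> B = emeasure \<nu> B + emeasure \<kappa> B))
      in if \<exists>\<kappa>. is_diff \<kappa> then (THE \<kappa>. is_diff \<kappa>) else null_measure borel)"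

definition splitting_law ::
    "real \<Rightarrow> 'a::polish_space measure measure \<Rightarrow> ('a measure \<times> 'a measure) measure" where
  "splitting_law q P =
     P \<bind> (\<lambda>\<mu>. distr (thinning_kernel q \<mu>) (PM \<Otimes>\<^sub>M PM) (\<lambda>\<nu>. (\<nu>, point_measure_diff \<mu> \<nu>)))"

end

(*
A point process is determined by its Laplace functional, and that of the splitting law is explicit:
the point at x of a configuration goes to the first component with probability q and to the second
with probability 1 - q, so the joint Laplace functional at (f, g) is the Laplace functional of P at
-log (q exp(-f) + (1 - q) exp(-g)). In terms of the generating functional G(u) = E prod_x (1 - u(x)),
the factorization reads G(q u + (1 - q) v) = G(q u) G((1 - q) v), which holds if
G(u) = exp(-rho(u)). Conversely, with u = v = t w it shows that phi(t) = -log G(t w) satisfies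
phi(t) = phi(q t) + phi((1 - q) t). Since P is of first order, phi has the right derivative
nu_P(w) at 0, and iterating the identity forces phi(t) = t nu_P(w).
*)

theory Submission
  imports Defs
begin

section \<open>Point measures are purely atomic\<close>

text \<open>Most of the work lies in measurability. \<open>splitting_law\<close> and
  \<open>thinning\<close> are defined by \<open>bind\<close>, so they can be computed with only once
  their kernels are known to be measurable into \<open>subprob_algebra\<close>; and the
  sigma-algebra of \<open>PM\<close> is the Borel one of the vague topology, where at the outset
  only integrals of continuous test functions are visibly measurable. Two facts bridge the gap. A
  countable network shows that counts of bounded Borel sets generate the vague Borel sets, so maps
  into \<open>PM\<close> can be tested on counts. And since counts are integers, indicators of count
  events are bounded limits of linear combinations of Laplace functionals; this one argument gives
  both the uniqueness of a law on pairs and the measurability of a kernel whose Laplace functionals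
  are measurable. In the analytic part the functions w are of the form 1 - exp(-f) with f bounded,
  so that sup w < 1: this keeps log(1 - t w) bounded up to t = 1, where f is recovered.\<close>

abbreviation atoms :: "'a::polish_space measure \<Rightarrow> 'a set" where
  "atoms \<mu> \<equiv> {x. emeasure \<mu> {x} > 0}"

lemma point_measures_sets: "\<mu> \<in> point_measures \<Longrightarrow> sets \<mu> = sets borel"
  by (simp add: point_measures_def locally_finite_measures_def)

lemma point_measures_space: "\<mu> \<in> point_measures \<Longrightarrow> space \<mu> = UNIV"
  using sets_eq_imp_space_eq[OF point_measures_sets] by auto

lemma measurable_point_measure:
  assumes "\<mu> \<in> point_measures" "f \<in> measurable borel N"
  shows "f \<in> measurable \<mu> N"
  using assms(2) by (simp only: measurable_cong_sets[OF point_measures_sets[OF assms(1)] refl])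

lemma point_measures_nat:
  assumes "\<mu> \<in> point_measures" "B \<in> sets borel" "bounded B"
  obtains n :: nat where "emeasure \<mu> B = of_nat n"
  using assms by (auto simp: point_measures_def)

lemma point_measures_finite:
  assumes "\<mu> \<in> point_measures" "B \<in> sets borel" "bounded B"
  shows "emeasure \<mu> B < \<infinity>"
  using assms by (auto simp: point_measures_def locally_finite_measures_def)

lemma point_measuresI:
  assumes "sets \<mu> = sets borel"
    and "\<And>B. B \<in> sets borel \<Longrightarrow> bounded B \<Longrightarrow> \<exists>n::nat. emeasure \<mu> B = of_nat n"
  shows "\<mu> \<in> point_measures"
  using assms
  by (fastforce simp: point_measures_def locally_finite_measures_def of_nat_less_top)

lemma emeasure_count:
  assumes \<mu>: "\<mu> \<in> point_measures" and B: "B \<in> sets borel" "bounded B"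
  shows "emeasure \<mu> B = of_nat (nat \<lfloor>measure \<mu> B\<rfloor>)" and "measure \<mu> B = real (nat \<lfloor>measure \<mu> B\<rfloor>)"
proof -
  obtain n :: nat where n: "emeasure \<mu> B = of_nat n"
    using point_measures_nat[OF \<mu> B] by auto
  then have "measure \<mu> B = real n"
    by (simp add: measure_def flip: ennreal_of_nat_eq_real_of_nat)
  then show "emeasure \<mu> B = of_nat (nat \<lfloor>measure \<mu> B\<rfloor>)" "measure \<mu> B = real (nat \<lfloor>measure \<mu> B\<rfloor>)"
    using n by auto
qed

lemma multiplicity_at:
  assumes "\<mu> \<in> point_measures"
  shows "emeasure \<mu> {x} = of_nat (multiplicity_at \<mu> x)"
    and "measure \<mu> {x} = real (multiplicity_at \<mu> x)"
proof -
  have "{x} \<in> sets borel" "bounded {x}" by simp_all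
  from emeasure_count[OF assms this]
  show "emeasure \<mu> {x} = of_nat (multiplicity_at \<mu> x)"
    and "measure \<mu> {x} = real (multiplicity_at \<mu> x)"
    unfolding multiplicity_at_def .
qed

text \<open>The masses of shrinking balls decrease to the mass of \<open>{x}\<close>, which is 0,
  and they are integers: once below 1, they vanish.\<close>

lemma null_neighbourhood:
  assumes \<mu>: "\<mu> \<in> point_measures" and x: "emeasure \<mu> {x} = 0"
  obtains e where "e > 0" "emeasure \<mu> (ball x e) = 0"
proof -
  define A where "A n = ball x (inverse (real (Suc n)))" for n
  have "(\<lambda>n. emeasure \<mu> (A n)) \<longlonglongrightarrow> emeasure \<mu> (\<Inter>n. A n)"
  proof (rule Lim_emeasure_decseq)
    show "range A \<subseteq> sets \<mu>" by (auto simp: A_def point_measures_sets[OF \<mu>])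
    show "decseq A" unfolding A_def decseq_def
      by (intro allI impI subset_ball le_imp_inverse_le) auto
    show "emeasure \<mu> (A n) \<noteq> \<infinity>" for n
      using point_measures_finite[OF \<mu>, of "A n"] by (auto simp: A_def)
  qed
  moreover have "(\<Inter>n. A n) = {x}"
  proof -
    have "y = x" if "\<And>n. y \<in> A n" for y
    proof (rule ccontr)
      assume "y \<noteq> x"
      then obtain n where "inverse (real (Suc n)) < dist x y"
        using reals_Archimedean[of "dist x y"] by auto
      with that[of n] show False by (simp add: A_def)
    qed
    then show ?thesis by (auto simp: A_def)
  qed
  ultimately have "(\<lambda>n. emeasure \<mu> (A n)) \<longlonglongrightarrow> 0" using x by simp
  then have "\<forall>\<^sub>F n in sequentially. emeasure \<mu> (A n) < 1"
    by (rule order_tendstoD) simp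
  then obtain n where n: "emeasure \<mu> (A n) < 1"
    by (auto simp: eventually_sequentially)
  obtain k :: nat where k: "emeasure \<mu> (A n) = of_nat k"
    using point_measures_nat[OF \<mu>, of "A n"] by (auto simp: A_def)
  with n have "k = 0"
    by (cases k) (auto simp: ennreal_of_nat_eq_real_of_nat simp flip: ennreal_1)
  with k have "emeasure \<mu> (A n) = 0" by simp
  then show ?thesis
    using that[of "inverse (real (Suc n))"] by (auto simp: A_def)
qed

text \<open>Every point that is not an atom has a null neighbourhood from a countable basis.\<close>

lemma null_compl_atoms:
  assumes \<mu>: "\<mu> \<in> point_measures"
  shows "- atoms \<mu> \<in> null_sets \<mu>"
proof -
  obtain \<B> :: "'a set set" where \<B>: "countable \<B>" "topological_basis \<B>"
    using ex_countable_basis by auto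
  have B_borel: "C \<in> sets \<mu>" if "C \<in> \<B>" for C
    using topological_basis_open[OF \<B>(2) that] by (simp add: point_measures_sets[OF \<mu>])
  have "- atoms \<mu> = \<Union>{C \<in> \<B>. emeasure \<mu> C = 0}"
  proof (intro equalityI subsetI)
    fix x assume "x \<in> - atoms \<mu>"
    then obtain e where e: "e > 0" "emeasure \<mu> (ball x e) = 0"
      using null_neighbourhood[OF \<mu>, of x] by (auto simp: not_less)
    from e obtain C where C: "C \<in> \<B>" "x \<in> C" "C \<subseteq> ball x e"
      using topological_basisE[OF \<B>(2) open_ball, of x x e] by auto
    have "emeasure \<mu> C \<le> emeasure \<mu> (ball x e)"
      using C by (intro emeasure_mono) (auto simp: point_measures_sets[OF \<mu>])
    with e C show "x \<in> \<Union>{C \<in> \<B>. emeasure \<mu> C = 0}" by auto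
  next
    fix x assume "x \<in> \<Union>{C \<in> \<B>. emeasure \<mu> C = 0}"
    then obtain C where C: "C \<in> \<B>" "x \<in> C" "emeasure \<mu> C = 0" by auto
    have "emeasure \<mu> {x} \<le> emeasure \<mu> C"
      using C B_borel by (intro emeasure_mono) auto
    with C show "x \<in> - atoms \<mu>" by auto
  qed
  moreover have "(\<Union>C\<in>{C \<in> \<B>. emeasure \<mu> C = 0}. C) \<in> null_sets \<mu>"
    using B_borel \<B> by (intro null_sets_UN') auto
  ultimately show ?thesis by simp
qed

lemma atoms_borel:
  assumes "\<mu> \<in> point_measures" shows "atoms \<mu> \<in> sets borel"
proof -
  have "- atoms \<mu> \<in> sets borel"
    using null_compl_atoms[OF assms] point_measures_sets[OF assms] by (simp only: null_sets_def) blast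
  from borel_comp[OF this] show ?thesis by simp
qed

text \<open>Each atom has integer mass, hence mass at least 1, so a ball of mass \<open>n\<close>
  cannot contain \<open>n + 1\<close> atoms.\<close>

lemma finite_atoms_bounded:
  assumes \<mu>: "\<mu> \<in> point_measures" and S: "bounded S"
  shows "finite (atoms \<mu> \<inter> S)"
proof (rule ccontr)
  assume inf: "infinite (atoms \<mu> \<inter> S)"
  from S obtain x e where xe: "S \<subseteq> cball x e"
    using bounded_subset_cball by blast
  obtain n :: nat where n: "emeasure \<mu> (cball x e) = of_nat n"
    using point_measures_nat[OF \<mu>, of "cball x e"] by auto
  obtain F where F: "finite F" "card F = Suc n" "F \<subseteq> atoms \<mu> \<inter> S"
    using infinite_arbitrarily_large[OF inf] by metis
  have "of_nat (Suc n) = (\<Sum>x\<in>F. 1::ennreal)" using F by simp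
  also have "\<dots> \<le> (\<Sum>x\<in>F. emeasure \<mu> {x})"
  proof (rule sum_mono)
    fix x assume "x \<in> F"
    with F have "multiplicity_at \<mu> x \<noteq> 0"
      using multiplicity_at(1)[OF \<mu>, of x] by (auto intro!: notI)
    then show "1 \<le> emeasure \<mu> {x}"
      by (metis multiplicity_at(1)[OF \<mu>] less_one not_less of_nat_1 of_nat_le_iff)
  qed
  also have "\<dots> = emeasure \<mu> F"
    using F by (intro emeasure_eq_sum_singleton[symmetric]) (auto simp: point_measures_sets[OF \<mu>])
  also have "\<dots> \<le> emeasure \<mu> (cball x e)"
    using F xe by (intro emeasure_mono) (auto simp: point_measures_sets[OF \<mu>])
  finally show False by (simp add: n del: of_nat_Suc)
qed

lemma countable_atoms:
  assumes \<mu>: "\<mu> \<in> point_measures"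
  shows "countable (atoms \<mu>)"
proof -
  have "atoms \<mu> = (\<Union>n::nat. atoms \<mu> \<inter> cball undefined (real n))"
    using real_arch_simple by auto
  moreover have "countable (\<Union>n::nat. atoms \<mu> \<inter> cball undefined (real n))"
    by (intro countable_UN countableI_type countable_finite finite_atoms_bounded[OF \<mu>]) auto
  ultimately show ?thesis by simp
qed

lemma emeasure_atoms_Int:
  assumes \<mu>: "\<mu> \<in> point_measures" and B: "B \<in> sets borel"
  shows "emeasure \<mu> B = emeasure \<mu> (B \<inter> atoms \<mu>)"
proof -
  have "emeasure \<mu> (B - (- atoms \<mu>)) = emeasure \<mu> B"
    using null_compl_atoms[OF \<mu>] B by (intro emeasure_Diff_null_set)
      (auto simp: point_measures_sets[OF \<mu>])
  moreover have "B - (- atoms \<mu>) = B \<inter> atoms \<mu>" by auto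
  ultimately show ?thesis by simp
qed

text \<open>The atoms are countable and their complement is null. Unbounded \<open>B\<close> is
  included, with both sides possibly infinite, so that comparing point measures on all Borel sets
  reduces to comparing them on singletons.\<close>

lemma emeasure_point_measure:
  assumes \<mu>: "\<mu> \<in> point_measures" and B: "B \<in> sets borel"
  shows "emeasure \<mu> B = (\<integral>\<^sup>+x. emeasure \<mu> {x} * indicator B x \<partial>count_space UNIV)"
proof -
  have "emeasure \<mu> (B \<inter> atoms \<mu>) = (\<integral>\<^sup>+x. emeasure \<mu> {x} \<partial>count_space (B \<inter> atoms \<mu>))"
    using countable_atoms[OF \<mu>]
    by (intro emeasure_countable_singleton) (auto simp: point_measures_sets[OF \<mu>])
  also have "\<dots> = (\<integral>\<^sup>+x. emeasure \<mu> {x} * indicator (B \<inter> atoms \<mu>) x \<partial>count_space UNIV)"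
    by (rule nn_integral_count_space_indicator) simp
  also have "\<dots> = (\<integral>\<^sup>+x. emeasure \<mu> {x} * indicator B x \<partial>count_space UNIV)"
    by (intro nn_integral_cong) (auto split: split_indicator)
  finally show ?thesis using emeasure_atoms_Int[OF assms] by simp
qed

lemma point_measures_eqI:
  assumes "\<mu> \<in> point_measures" "\<nu> \<in> point_measures" "\<And>x. emeasure \<mu> {x} = emeasure \<nu> {x}"
  shows "\<mu> = \<nu>"
proof (rule measure_eqI)
  fix B assume "B \<in> sets \<mu>"
  then have B: "B \<in> sets borel" using point_measures_sets[OF assms(1)] by simp
  show "emeasure \<mu> B = emeasure \<nu> B"
    unfolding emeasure_point_measure[OF assms(1) B] emeasure_point_measure[OF assms(2) B] assms(3) ..
qed (use assms in \<open>simp add: point_measures_sets\<close>)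

text \<open>Signs are allowed because the Laplace functional of a splitting leads to the test
  function \<open>f x - g x\<close>.\<close>

definition bounded_support_functions :: "('a::polish_space \<Rightarrow> real) set" where
  "bounded_support_functions =
    {h. h \<in> borel_measurable borel \<and> bounded (range h) \<and> bounded {x. h x \<noteq> 0}}"

lemma bounded_support_bound:
  assumes "h \<in> bounded_support_functions"
  obtains c where "0 \<le> c" "\<forall>x. \<bar>h x\<bar> \<le> c"
proof -
  obtain c where c: "\<And>x. norm (h x) \<le> c"
    using assms by (auto simp: bounded_support_functions_def bounded_iff)
  have "0 \<le> c" by (rule order_trans[OF norm_ge_zero c])
  then show ?thesis using c by (intro that[of c]) auto
qed

lemma bounded_support_functionsI:
  assumes "h \<in> borel_measurable borel" "\<And>x. \<bar>h x\<bar> \<le> c" "bounded S" "\<And>x. x \<notin> S \<Longrightarrow> h x = 0"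
  shows "h \<in> bounded_support_functions"
proof -
  have "bounded {x. h x \<noteq> 0}" using assms(4) by (intro bounded_subset[OF assms(3)]) auto
  with assms(1,2) show ?thesis
    by (auto simp: bounded_support_functions_def bounded_iff)
qed

lemma bounded_support_integrable:
  assumes h: "h \<in> bounded_support_functions" and \<mu>: "\<mu> \<in> locally_finite_measures"
  shows "integrable \<mu> h"
proof -
  obtain c where c: "0 \<le> c" "\<forall>x. \<bar>h x\<bar> \<le> c" by (rule bounded_support_bound[OF h])
  have sets: "sets \<mu> = sets borel" using \<mu> by (simp add: locally_finite_measures_def)
  obtain a e where S: "{x. h x \<noteq> 0} \<subseteq> cball a e"
    using h bounded_subset_cball[of "{x. h x \<noteq> 0}"]
    unfolding bounded_support_functions_def by blast
  have [measurable]: "h \<in> borel_measurable \<mu>"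
    using h measurable_cong_sets[OF sets refl] by (auto simp: bounded_support_functions_def)
  have "integrable \<mu> (\<lambda>x. c * indicator (cball a e) x :: real)"
    using \<mu> by (intro integrable_mult_right integrable_real_indicator)
       (auto simp: locally_finite_measures_def)
  then show ?thesis
  proof (rule Bochner_Integration.integrable_bound)
    show "AE x in \<mu>. norm (h x) \<le> norm (c * indicator (cball a e) x :: real)"
    proof (intro AE_I2)
      fix x show "norm (h x) \<le> norm (c * indicator (cball a e) x :: real)"
        using c(2)[rule_format, of x] S by (cases "h x = 0") (auto split: split_indicator)
    qed
  qed simp
qed

text \<open>\<open>A\<close> may exceed the atoms in the support, so that integrals against several
  measures can be written as sums over one common set.\<close>

lemma integral_point_measure:
  assumes h: "h \<in> bounded_support_functions" and \<mu>: "\<mu> \<in> point_measures"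
    and A: "finite A" "atoms \<mu> \<inter> {x. h x \<noteq> 0} \<subseteq> A"
  shows "(\<integral>x. h x \<partial>\<mu>) = (\<Sum>x\<in>A. measure \<mu> {x} * h x)"
proof -
  have [measurable]: "h \<in> borel_measurable \<mu>"
    using h measurable_cong_sets[OF point_measures_sets[OF \<mu>] refl]
    by (auto simp: bounded_support_functions_def)
  have [measurable]: "{x} \<in> sets \<mu>" for x by (simp add: point_measures_sets[OF \<mu>])
  have fin: "emeasure \<mu> {x} < \<infinity>" for x using point_measures_finite[OF \<mu>] by simp
  have "(\<integral>x. h x \<partial>\<mu>) = (\<integral>x. (\<Sum>a\<in>A. indicator {a} x * h a) \<partial>\<mu>)"
  proof (rule integral_cong_AE)
    have "AE x in \<mu>. x \<notin> - atoms \<mu>"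
      by (rule AE_not_in[OF null_compl_atoms[OF \<mu>]])
    then show "AE x in \<mu>. h x = (\<Sum>a\<in>A. indicator {a} x * h a)"
    proof eventually_elim
      fix x assume "x \<notin> - atoms \<mu>"
      moreover have "(\<Sum>a\<in>A. indicator {a} x * h a) = (\<Sum>a\<in>A. if a = x then h a else 0)"
        by (intro sum.cong) (auto split: split_indicator)
      ultimately show "h x = (\<Sum>a\<in>A. indicator {a} x * h a)"
        using A by (cases "h x = 0") (auto simp: zero_less_iff_neq_zero)
    qed
  qed auto
  also have "\<dots> = (\<Sum>a\<in>A. measure \<mu> {a} * h a)"
    using fin by (subst Bochner_Integration.integral_sum)
      (auto intro!: integrable_mult_left integrable_real_indicator sum.cong simp: point_measures_space[OF \<mu>])
  finally show ?thesis .
qed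

section \<open>The Borel sets of the vague topology\<close>

lemma PM_eq_sigma:
  "(PM :: 'a::polish_space measure measure) =
    sigma point_measures {U. openin (subtopology vague_topology point_measures) U}"
proof -
  have "topspace (subtopology vague_topology point_measures) = (point_measures :: 'a measure set)"
    by (auto simp: topspace_vague_topology point_measures_def)
  then show ?thesis unfolding PM_def borel_of_topology_def by (simp only:)
qed

lemma sets_PM:
  "sets PM = sigma_sets point_measures {U. openin (subtopology vague_topology point_measures) U}"
  unfolding PM_eq_sigma by (rule sets_measure_of) (auto simp: openin_subtopology)

lemma borel_measurable_PM_vague:
  assumes "f \<in> vague_test_functions"
  shows "(\<lambda>\<nu>. \<integral>x. f x \<partial>\<nu>) \<in> borel_measurable PM"
proof (rule borel_measurableI)
  fix S :: "real set" assume "open S"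
  with assms have "openin vague_topology {\<mu> \<in> locally_finite_measures. (\<integral>x. f x \<partial>\<mu>) \<in> S}"
    unfolding vague_topology_def by (intro topology_generated_by_Basis) auto
  then have "openin (subtopology vague_topology point_measures)
      ({\<mu> \<in> locally_finite_measures. (\<integral>x. f x \<partial>\<mu>) \<in> S} \<inter> point_measures)"
    by (auto simp: openin_subtopology)
  moreover have "{\<mu> \<in> locally_finite_measures. (\<integral>x. f x \<partial>\<mu>) \<in> S} \<inter> point_measures =
      (\<lambda>\<nu>. \<integral>x. f x \<partial>\<nu>) -` S \<inter> space PM"
    by (auto simp: space_PM point_measures_def)
  ultimately show "(\<lambda>\<nu>. \<integral>x. f x \<partial>\<nu>) -` S \<inter> space PM \<in> sets PM"
    by (auto simp: sets_PM)
qed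

text \<open>The indicator of \<open>F\<close> is a pointwise limit of continuous bumps with bounded
  support, and dominated convergence carries measurability from their integrals to the mass of
  \<open>F\<close>.\<close>

lemma emeasure_PM_closed:
  assumes F: "closed F" "bounded F"
  shows "(\<lambda>\<nu>. emeasure \<nu> F) \<in> borel_measurable PM"
\<comment> \<open>\<open>infdist\<close> to the empty set is 0 by convention, so the bumps below
  would be constantly 1.\<close>
proof (cases "F = {}")
  case False
  \<comment> \<open>The slope \<open>Suc n\<close> is at least 1, so all bumps vanish at distance 1
    from \<open>F\<close> and \<open>f 0\<close> dominates the others.\<close>
  define f where "f n x = max 0 (1 - real (Suc n) * infdist x F)" for n x
  have supp: "bounded {x. f n x \<noteq> 0}" for n
  proof -
    obtain a e where e: "F \<subseteq> cball a e" using F(2) bounded_subset_cball by blast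
    have "x \<in> cball a (e + 1)" if "f n x \<noteq> 0" for x
    proof -
      have "real (Suc n) * infdist x F < 1"
        using that by (auto simp: f_def max_def split: if_splits)
      moreover have "infdist x F \<le> real (Suc n) * infdist x F"
        using infdist_nonneg[of x F] by (simp add: algebra_simps)
      ultimately have "infdist x F < 1" by simp
      then have "(INF y\<in>F. dist x y) < 1" using False by (simp add: infdist_def)
      then obtain y where "y \<in> F" "dist x y < 1"
        using False by (subst (asm) cINF_less_iff) auto
      then show ?thesis
        using e dist_triangle[of a x y] by (fastforce simp: dist_commute)
    qed
    then show ?thesis by (intro bounded_subset[OF bounded_cball[of a "e + 1"]]) auto
  qed
  have f_le: "\<bar>f n x\<bar> \<le> 1" for n x
    using infdist_nonneg[of x F] by (auto simp: f_def max_def)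
  have cont: "continuous_on UNIV (f n)" for n
    unfolding f_def by (intro continuous_intros)
  have test: "f n \<in> vague_test_functions" for n
    using cont supp f_le by (auto simp: vague_test_functions_def bounded_iff intro!: exI[of _ 1])
  have bs: "f n \<in> bounded_support_functions" for n
    using supp f_le borel_measurable_continuous_onI[OF cont]
    by (auto simp: bounded_support_functions_def bounded_iff intro!: exI[of _ 1])
  have lim: "(\<lambda>n. f n x) \<longlonglongrightarrow> indicator F x" for x
  proof (cases "x \<in> F")
    case True
    then show ?thesis by (simp add: f_def)
  next
    case x: False
    then have pos: "infdist x F > 0"
      using infdist_pos_not_in_closed[OF F(1) False] by simp
    then obtain m where m: "1 < real m * infdist x F" using reals_Archimedean3 by blast
    have "\<forall>\<^sub>F n in sequentially. f n x = 0"
      unfolding eventually_sequentially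
    proof (intro exI allI impI)
      fix n assume "m \<le> n"
      then have "real m * infdist x F \<le> real (Suc n) * infdist x F"
        using pos by (intro mult_right_mono) auto
      with m show "f n x = 0" by (simp add: f_def)
    qed
    with x show ?thesis by (simp add: tendsto_eventually)
  qed
  have "(\<lambda>\<nu>. measure \<nu> F) \<in> borel_measurable PM"
  proof (rule borel_measurable_LIMSEQ_real)
    fix \<nu> :: "'a measure" assume "\<nu> \<in> space PM"
    then have \<nu>: "\<nu> \<in> point_measures" "\<nu> \<in> locally_finite_measures"
      by (auto simp: space_PM point_measures_def)
    note [measurable_cong] = point_measures_sets[OF \<nu>(1)]
    have [measurable]: "f n \<in> borel_measurable borel" for n
      using bs by (simp add: bounded_support_functions_def)
    have [measurable]: "F \<in> sets \<nu>"
      using F by (simp add: point_measures_sets[OF \<nu>(1)])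
    have "(\<lambda>n. \<integral>x. f n x \<partial>\<nu>) \<longlonglongrightarrow> (\<integral>x. indicator F x \<partial>\<nu>)"
    proof (rule integral_dominated_convergence[where w="f 0"])
      show "AE x in \<nu>. norm (f n x) \<le> f 0 x" for n
      proof (intro AE_I2)
        fix x have "1 * infdist x F \<le> real (Suc n) * infdist x F"
          by (intro mult_right_mono infdist_nonneg) auto
        then show "norm (f n x) \<le> f 0 x" by (auto simp: f_def max_def)
      qed
    qed (use lim bounded_support_integrable[OF bs \<nu>(2)] in auto)
    then show "(\<lambda>n. \<integral>x. f n x \<partial>\<nu>) \<longlonglongrightarrow> measure \<nu> F"
      by (simp add: point_measures_space[OF \<nu>(1)])
  qed (rule borel_measurable_PM_vague[OF test])
  moreover have "emeasure \<nu> F = ennreal (measure \<nu> F)" if "\<nu> \<in> space PM" for \<nu>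
    using point_measures_finite[of \<nu> F] that F
    by (intro emeasure_eq_ennreal_measure) (auto simp: space_PM)
  ultimately show ?thesis
    by (subst measurable_cong[where g="\<lambda>\<nu>. ennreal (measure \<nu> F)"]) auto
qed simp

text \<open>Closed sets form an intersection-stable generator of the Borel sets, but the complement
  step needs finite masses in order to subtract. Hence the induction runs on intersections with a
  ball, and the balls exhaust the space at the end.\<close>

lemma borel_measurable_PM_emeasure [measurable]:
  assumes B: "B \<in> sets borel"
  shows "(\<lambda>\<nu>. emeasure \<nu> B) \<in> borel_measurable PM"
proof -
  have K: "(\<lambda>\<nu>. emeasure \<nu> (B \<inter> cball a r)) \<in> borel_measurable PM" for a :: 'a and r
  proof -
    have "Int_stable (Collect closed :: 'a set set)" "Collect closed \<subseteq> Pow (UNIV :: 'a set)"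
      "B \<in> sigma_sets UNIV (Collect closed)"
      using B by (auto simp: Int_stable_def borel_eq_closed)
    then show ?thesis
    proof (induction rule: sigma_sets_induct_disjoint)
      case (basic A)
      then show ?case by (intro emeasure_PM_closed) auto
    next
      case (compl A)
      then have [measurable]: "(\<lambda>\<nu>. emeasure \<nu> (A \<inter> cball a r)) \<in> borel_measurable PM"
        "(\<lambda>\<nu>. emeasure \<nu> (cball a r)) \<in> borel_measurable PM"
        by (auto intro!: emeasure_PM_closed)
      have A: "A \<in> sets borel" using compl by (simp add: borel_eq_closed)
      have "emeasure \<nu> ((UNIV - A) \<inter> cball a r) = emeasure \<nu> (cball a r) - emeasure \<nu> (A \<inter> cball a r)"
        if "\<nu> \<in> space PM" for \<nu> :: "'a measure"
      proof -
        have \<nu>: "\<nu> \<in> point_measures" using that by (simp add: space_PM)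
        have "(UNIV - A) \<inter> cball a r = cball a r - (A \<inter> cball a r)" by auto
        moreover have "emeasure \<nu> (A \<inter> cball a r) \<noteq> \<infinity>"
          using point_measures_finite[OF \<nu>, of "A \<inter> cball a r"] A
          by (auto simp: bounded_Int)
        ultimately show ?thesis
          using A by (simp add: emeasure_Diff point_measures_sets[OF \<nu>])
      qed
      then show ?case
        by (subst measurable_cong[where
              g="\<lambda>\<nu>. emeasure \<nu> (cball a r) - emeasure \<nu> (A \<inter> cball a r)"]) auto
    next
      case (union A)
      then have [measurable]: "\<And>i. (\<lambda>\<nu>. emeasure \<nu> (A i \<inter> cball a r)) \<in> borel_measurable PM"
        by auto
      have A: "A i \<in> sets borel" for i using union by (simp add: borel_eq_closed image_subset_iff)
      have "emeasure \<nu> ((\<Union>i. A i) \<inter> cball a r) = (\<Sum>i. emeasure \<nu> (A i \<inter> cball a r))"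
        if "\<nu> \<in> space PM" for \<nu> :: "'a measure"
      proof -
        have \<nu>: "\<nu> \<in> point_measures" using that by (simp add: space_PM)
        have "(\<Sum>i. emeasure \<nu> (A i \<inter> cball a r)) = emeasure \<nu> (\<Union>i. A i \<inter> cball a r)"
          using union(1) A
          by (intro suminf_emeasure) (auto simp: point_measures_sets[OF \<nu>] disjoint_family_on_def)
        then show ?thesis by simp
      qed
      then show ?case
        by (subst measurable_cong[where g="\<lambda>\<nu>. \<Sum>i. emeasure \<nu> (A i \<inter> cball a r)"]) auto
    qed simp
  qed
  have "emeasure \<nu> B = (SUP n. emeasure \<nu> (B \<inter> cball undefined (real n)))"
    if "\<nu> \<in> space PM" for \<nu> :: "'a measure"
  proof -
    have \<nu>: "\<nu> \<in> point_measures" using that by (simp add: space_PM)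
    have "(SUP n. emeasure \<nu> (B \<inter> cball undefined (real n))) =
        emeasure \<nu> (\<Union>n. B \<inter> cball undefined (real n))"
      using B by (intro SUP_emeasure_incseq) (auto simp: point_measures_sets[OF \<nu>] incseq_def)
    also have "(\<Union>n. B \<inter> cball undefined (real n)) = B"
      using real_arch_simple by auto
    finally show ?thesis by simp
  qed
  moreover have "(\<lambda>\<nu>. SUP n. emeasure \<nu> (B \<inter> cball undefined (real n))) \<in> borel_measurable PM"
    using K by (intro borel_measurable_SUP) auto
  ultimately show ?thesis by (subst measurable_cong) auto
qed

lemma borel_measurable_PM_nn_integral:
  fixes u :: "'a::polish_space \<Rightarrow> ennreal"
  assumes "u \<in> borel_measurable borel"
  shows "(\<lambda>\<nu>. \<integral>\<^sup>+x. u x \<partial>\<nu>) \<in> borel_measurable PM"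
  using assms
proof (induction rule: borel_measurable_induct)
  case (cong f g)
  then have "f = g" by auto
  with cong show ?case by simp
next
  case (set A)
  have "(\<integral>\<^sup>+x. indicator A x \<partial>\<nu>) = emeasure \<nu> A" if "\<nu> \<in> space PM" for \<nu> :: "'a measure"
    using that set by (intro nn_integral_indicator) (auto simp: space_PM point_measures_sets)
  with set show ?case by (subst measurable_cong) auto
next
  case (mult u c)
  have "(\<integral>\<^sup>+x. c * u x \<partial>\<nu>) = c * (\<integral>\<^sup>+x. u x \<partial>\<nu>)" if "\<nu> \<in> space PM" for \<nu> :: "'a measure"
    using that mult measurable_point_measure[of \<nu>]
    by (intro nn_integral_cmult) (auto simp: space_PM)
  with mult show ?case
    by (subst measurable_cong[where g="\<lambda>\<nu>. c * (\<integral>\<^sup>+x. u x \<partial>\<nu>)"]) auto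
next
  case (add u v)
  have "(\<integral>\<^sup>+x. v x + u x \<partial>\<nu>) = (\<integral>\<^sup>+x. v x \<partial>\<nu>) + (\<integral>\<^sup>+x. u x \<partial>\<nu>)" if "\<nu> \<in> space PM"
    for \<nu> :: "'a measure"
    using that add measurable_point_measure[of \<nu>]
    by (intro nn_integral_add) (auto simp: space_PM)
  with add show ?case
    by (subst measurable_cong[where g="\<lambda>\<nu>. (\<integral>\<^sup>+x. v x \<partial>\<nu>) + (\<integral>\<^sup>+x. u x \<partial>\<nu>)"]) auto
next
  case (seq U)
  have "(\<integral>\<^sup>+x. (SUP i. U i) x \<partial>\<nu>) = (SUP i. \<integral>\<^sup>+x. U i x \<partial>\<nu>)" if "\<nu> \<in> space PM"
    for \<nu> :: "'a measure"
    using that seq unfolding SUP_apply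
    by (intro nn_integral_monotone_convergence_SUP) (auto simp: space_PM intro: measurable_point_measure)
  moreover have "(\<lambda>\<nu>. SUP i. \<integral>\<^sup>+x. U i x \<partial>\<nu>) \<in> borel_measurable PM"
    using seq by (intro borel_measurable_SUP) auto
  ultimately show ?case unfolding seq(4) by (subst measurable_cong)
qed

lemma borel_measurable_PM_integral [measurable]:
  fixes h :: "'a::polish_space \<Rightarrow> real"
  assumes h: "h \<in> bounded_support_functions"
  shows "(\<lambda>\<nu>. \<integral>x. h x \<partial>\<nu>) \<in> borel_measurable PM"
proof -
  have [measurable]: "h \<in> borel_measurable borel"
    using h by (simp add: bounded_support_functions_def)
  have "(\<integral>x. h x \<partial>\<nu>) = enn2real (\<integral>\<^sup>+x. ennreal (h x) \<partial>\<nu>) - enn2real (\<integral>\<^sup>+x. ennreal (- h x) \<partial>\<nu>)"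
    if "\<nu> \<in> space PM" for \<nu>
    using that h
    by (intro real_lebesgue_integral_def bounded_support_integrable)
       (auto simp: space_PM point_measures_def)
  moreover have "(\<lambda>\<nu>. enn2real (\<integral>\<^sup>+x. ennreal (h x) \<partial>\<nu>) - enn2real (\<integral>\<^sup>+x. ennreal (- h x) \<partial>\<nu>))
      \<in> borel_measurable PM"
    by (intro borel_measurable_diff measurable_compose[OF borel_measurable_PM_nn_integral]
        borel_measurable_enn2real) auto
  ultimately show ?thesis by (subst measurable_cong) auto
qed

lemma borel_measurable_PM_laplace:
  assumes "h \<in> bounded_support_functions"
  shows "(\<lambda>\<nu>. ennreal (exp (- (\<integral>x. h x \<partial>\<nu>)))) \<in> borel_measurable PM"
proof -
  note [measurable] = borel_measurable_PM_integral[OF assms]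
  show ?thesis by measurable
qed

section \<open>A countable network for the vague topology on point measures\<close>

lemma finite_set_separated:
  fixes A :: "'a::metric_space set"
  assumes "finite A"
  obtains r where "r > 0" "\<forall>x\<in>A. \<forall>y\<in>A. x \<noteq> y \<longrightarrow> r \<le> dist x y"
proof -
  \<comment> \<open>The 1 keeps \<open>D\<close> nonempty when \<open>A\<close> has fewer than two
    points.\<close>
  define D where "D = insert 1 ((\<lambda>(x, y). dist x y) ` {p \<in> A \<times> A. fst p \<noteq> snd p})"
  have "finite D" "D \<noteq> {}" using assms by (auto simp: D_def)
  moreover have "\<forall>d\<in>D. d > 0" by (auto simp: D_def)
  ultimately have "Min D > 0" by simp
  moreover have "Min D \<le> dist x y" if "x \<in> A" "y \<in> A" "x \<noteq> y" for x y
    using that \<open>finite D\<close> by (intro Min_le) (auto simp: D_def)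
  ultimately show ?thesis by (intro that[of "Min D"]) auto
qed

text \<open>The vague topology has a countable network on the point measures, because a point measure
  is determined up to a small vague error by its counts on finitely many basic sets, one around
  each atom, and on what they leave of a large ball.\<close>

lemma integral_point_measure_close:
  assumes f: "f \<in> vague_test_functions" and \<mu>: "\<mu> \<in> point_measures" and e: "e > 0"
    and supp: "{x. f x \<noteq> 0} \<subseteq> ball a s"
    and \<B>: "topological_basis \<B>"
  obtains \<F> where "finite \<F>" "\<F> \<subseteq> \<B>" "\<forall>C\<in>\<F>. C \<subseteq> ball a s"
    "\<forall>\<nu>\<in>point_measures. (\<forall>C\<in>insert (ball a s - \<Union>\<F>) \<F>. emeasure \<nu> C = emeasure \<mu> C)
       \<longrightarrow> \<bar>(\<integral>x. f x \<partial>\<nu>) - (\<integral>x. f x \<partial>\<mu>)\<bar> < e"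
proof -
  have cont: "continuous_on UNIV f" using f by (simp add: vague_test_functions_def)
  then have bs: "f \<in> bounded_support_functions"
    using f borel_measurable_continuous_onI[OF cont]
    by (auto simp: vague_test_functions_def bounded_support_functions_def)
  define A where "A = atoms \<mu> \<inter> ball a s"
  have A: "finite A" unfolding A_def by (intro finite_atoms_bounded \<mu>) auto
  define M where "M = (\<Sum>x\<in>A. measure \<mu> {x})"
  have M: "M \<ge> 0" unfolding M_def by (intro sum_nonneg) auto
  \<comment> \<open>An oscillation of at most \<open>d\<close> on sets of total mass
    \<open>M\<close> costs at most \<open>d * M\<close>, which is below \<open>e\<close>; the
    summand 1 covers \<open>M = 0\<close>.\<close>
  define d where "d = e / (M + 1)"
  have d: "d > 0" "d * M < e" using M e by (auto simp: d_def field_simps)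
  obtain r where r: "r > 0" "\<forall>x\<in>A. \<forall>y\<in>A. x \<noteq> y \<longrightarrow> r \<le> dist x y"
    by (rule finite_set_separated[OF A])
  \<comment> \<open>Radius \<open>r / 2\<close> makes the chosen sets pairwise disjoint, and staying
    inside \<open>ball a s\<close> leaves each of them with exactly one atom of
    \<open>\<mu>\<close>.\<close>
  have "\<exists>C. C \<in> \<B> \<and> x \<in> C \<and> C \<subseteq> ball x (r / 2) \<inter> ball a s \<inter> {y. \<bar>f y - f x\<bar> < d}"
    if "x \<in> A" for x
  proof -
    have "open (ball x (r / 2) \<inter> ball a s \<inter> {y. \<bar>f y - f x\<bar> < d})"
      by (intro open_Int open_ball open_Collect_less continuous_intros cont)
    moreover have "x \<in> ball x (r / 2) \<inter> ball a s \<inter> {y. \<bar>f y - f x\<bar> < d}"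
      using that r d by (auto simp: A_def)
    ultimately show ?thesis
      using topological_basisE[OF \<B>] by metis
  qed
  then obtain C where C: "\<And>x. x \<in> A \<Longrightarrow> C x \<in> \<B>" "\<And>x. x \<in> A \<Longrightarrow> x \<in> C x"
     "\<And>x. x \<in> A \<Longrightarrow> C x \<subseteq> ball x (r / 2) \<inter> ball a s \<inter> {y. \<bar>f y - f x\<bar> < d}"
    by metis
  have C_borel: "C x \<in> sets borel" if "x \<in> A" for x
    using topological_basis_open[OF \<B> C(1)[OF that]] by simp
  have C_bounded: "bounded (C x)" if "x \<in> A" for x
    using C(3)[OF that] by (intro bounded_subset[OF bounded_ball[of a s]]) auto
  have disj: "x = y" if "x \<in> A" "y \<in> A" "z \<in> C x" "z \<in> C y" for x y z
  proof (rule ccontr)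
    assume "x \<noteq> y"
    moreover have "dist x z < r / 2" "dist y z < r / 2" using C(3) that by (auto simp: subset_eq)
    moreover have "dist x y \<le> dist x z + dist y z" by (metis dist_commute dist_triangle)
    ultimately show False using r that by fastforce
  qed
  have C_atom: "emeasure \<mu> (C x) = emeasure \<mu> {x}" if "x \<in> A" for x
  proof -
    have "C x \<inter> atoms \<mu> = {x}"
    proof (intro equalityI subsetI)
      fix y assume y: "y \<in> C x \<inter> atoms \<mu>"
      then have "y \<in> A" using C(3)[OF that] by (auto simp: A_def)
      with disj[OF that _ _ C(2)] y show "y \<in> {x}" by auto
    qed (use that C(2) in \<open>auto simp: A_def\<close>)
    then show ?thesis using emeasure_atoms_Int[OF \<mu> C_borel[OF that]] by simp
  qed
  define R where "R = ball a s - \<Union>(C ` A)"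
  have R: "R \<in> sets borel" unfolding R_def using A C_borel by (intro sets.Diff sets.finite_UN) auto
  have R_null: "emeasure \<mu> R = 0"
  proof -
    have "R \<inter> atoms \<mu> = {}" using C(2) by (auto simp: R_def A_def)
    then show ?thesis using emeasure_atoms_Int[OF \<mu> R] by simp
  qed
  have "\<bar>(\<integral>x. f x \<partial>\<nu>) - (\<integral>x. f x \<partial>\<mu>)\<bar> < e"
    if \<nu>: "\<nu> \<in> point_measures" and eq: "\<forall>D\<in>insert R (C ` A). emeasure \<nu> D = emeasure \<mu> D" for \<nu>
  proof -
    have lf: "\<nu> \<in> locally_finite_measures" using \<nu> by (simp add: point_measures_def)
    \<comment> \<open>\<open>g\<close> is \<open>f\<close> with its value on each \<open>C x\<close>
      frozen at \<open>f x\<close>. Equal counts give \<open>g\<close> the same integral against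
      \<open>\<nu>\<close> that \<open>f\<close> has against \<open>\<mu>\<close>, and
      \<open>u\<close> bounds the error of freezing.\<close>
    define g where "g y = (\<Sum>x\<in>A. f x * indicator (C x) y)" for y
    define u where "u y = (\<Sum>x\<in>A. d * indicator (C x) y)" for y
    have int_C: "integrable \<nu> (indicator (C x) :: 'a \<Rightarrow> real)" if "x \<in> A" for x
      using that C_borel C_bounded point_measures_finite[OF \<nu>]
      by (intro integrable_real_indicator) (auto simp: point_measures_sets[OF \<nu>])
    have int: "integrable \<nu> f" "integrable \<nu> g" "integrable \<nu> u"
      using bounded_support_integrable[OF bs lf] int_C
      unfolding g_def u_def by (auto intro!: integrable_sum integrable_mult_right)
    have m: "measure \<nu> (C x) = measure \<mu> {x}" if "x \<in> A" for x
      using eq C_atom[OF that] that by (simp add: measure_def)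
    have "(\<integral>y. g y \<partial>\<nu>) = (\<Sum>x\<in>A. f x * measure \<mu> {x})"
      unfolding g_def using int_C m
      by (subst Bochner_Integration.integral_sum) (auto simp: point_measures_space[OF \<nu>] intro!: sum.cong)
    also have "\<dots> = (\<integral>x. f x \<partial>\<mu>)"
      using A supp by (subst integral_point_measure[OF bs \<mu> A]) (auto simp: A_def mult.commute)
    finally have g: "(\<integral>y. g y \<partial>\<nu>) = (\<integral>x. f x \<partial>\<mu>)" .
    have u: "(\<integral>y. u y \<partial>\<nu>) = d * M"
      unfolding u_def M_def using int_C m
      by (subst Bochner_Integration.integral_sum)
         (auto simp: point_measures_space[OF \<nu>] sum_distrib_left intro!: sum.cong)
    have "AE y in \<nu>. \<bar>f y - g y\<bar> \<le> u y"
    proof -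
      have "R \<in> null_sets \<nu>" using eq R R_null by (auto simp: null_sets_def point_measures_sets[OF \<nu>])
      then have "AE y in \<nu>. y \<notin> R" by (rule AE_not_in)
      then show ?thesis
      proof eventually_elim
        fix y assume "y \<notin> R"
        show "\<bar>f y - g y\<bar> \<le> u y"
        proof (cases "\<exists>x\<in>A. y \<in> C x")
          case True
          then obtain x where x: "x \<in> A" "y \<in> C x" by auto
          have "(\<Sum>z\<in>A. k z * indicator (C z) y) = k x" for k :: "'a \<Rightarrow> real"
          proof -
            have "(\<Sum>z\<in>A. k z * indicator (C z) y) = (\<Sum>z\<in>A. if z = x then k z else 0)"
            proof (intro sum.cong)
              fix z assume z: "z \<in> A"
              then have "z \<noteq> x \<Longrightarrow> y \<notin> C z" using disj[OF x(1) z x(2)] by blast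
              then show "k z * indicator (C z) y = (if z = x then k z else 0)" using x by auto
            qed simp
            then show ?thesis using A x by simp
          qed
          then have "g y = f x" "u y = d" by (auto simp: g_def u_def)
          then show ?thesis using C(3)[OF x(1)] x(2) by (auto simp: subset_eq)
        next
          case False
          then have "y \<notin> ball a s" using \<open>y \<notin> R\<close> by (auto simp: R_def)
          then have "f y = 0" using supp by auto
          with False show ?thesis by (simp add: g_def u_def)
        qed
      qed
    qed
    then have "(\<integral>y. \<bar>f y - g y\<bar> \<partial>\<nu>) \<le> (\<integral>y. u y \<partial>\<nu>)"
      using int by (intro integral_mono_AE) auto
    moreover have "\<bar>\<integral>y. f y - g y \<partial>\<nu>\<bar> \<le> (\<integral>y. \<bar>f y - g y\<bar> \<partial>\<nu>)"
      by (rule integral_abs_bound)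
    ultimately show ?thesis using int g u d by simp
  qed
  then show ?thesis
    using A C by (intro that[of "C ` A"]) (auto simp: R_def)
qed

text \<open>For a subbasic set, finitely many counts of \<open>\<mu>\<close> suffice by
  \<open>integral_point_measure_close\<close>; an intersection takes the union of the two finite
  families, and a union passes to one member containing \<open>\<mu>\<close>.\<close>

lemma vague_network:
  obtains \<A> :: "'a::polish_space set set" where "countable \<A>"
    "\<forall>A\<in>\<A>. A \<in> sets borel \<and> bounded A"
    "\<And>U \<mu>. openin vague_topology U \<Longrightarrow> \<mu> \<in> U \<Longrightarrow> \<mu> \<in> point_measures \<Longrightarrow>
       \<exists>\<J>. finite \<J> \<and> \<J> \<subseteq> \<A> \<and>
         (\<forall>\<nu>\<in>point_measures. (\<forall>A\<in>\<J>. emeasure \<nu> A = emeasure \<mu> A) \<longrightarrow> \<nu> \<in> U)"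
proof -
  obtain \<B> :: "'a set set" where \<B>: "countable \<B>" "topological_basis \<B>"
    using ex_countable_basis by auto
  \<comment> \<open>One arbitrary fixed center and integer radii keep the family of remainders
    countable.\<close>
  define rest where "rest = (\<lambda>(n, \<F>). ball undefined (real n) - \<Union>\<F> :: 'a set)"
  define \<A> where "\<A> = {C \<in> \<B>. bounded C} \<union> rest ` (UNIV \<times> {\<F>. finite \<F> \<and> \<F> \<subseteq> \<B>})"
  have open_B: "open C" if "C \<in> \<B>" for C using topological_basis_open[OF \<B>(2) that] .
  show ?thesis
  proof
    show "countable \<A>"
      unfolding \<A>_def using \<B>(1)
      by (intro countable_Un countable_image countable_SIGMA countable_Collect_finite_subset)
         (auto intro: countable_subset)
    show "\<forall>A\<in>\<A>. A \<in> sets borel \<and> bounded A"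
    proof
      fix A assume "A \<in> \<A>"
      then consider "A \<in> \<B>" "bounded A"
        | n \<F> where "\<F> \<subseteq> \<B>" "A = ball undefined (real n) - \<Union>\<F>"
        by (auto simp: \<A>_def rest_def)
      then show "A \<in> sets borel \<and> bounded A"
      proof cases
        case 1
        then show ?thesis using open_B by auto
      next
        case 2
        have "open (\<Union>\<F>)" using 2 open_B by (intro open_Union) auto
        then show ?thesis
          using 2(2) by (auto intro: bounded_subset[OF bounded_ball])
      qed
    qed
  next
    fix U and \<mu> :: "'a measure"
    assume U: "openin vague_topology U" and \<mu>: "\<mu> \<in> U" "\<mu> \<in> point_measures"
    have "generate_topology_on {{\<mu> \<in> locally_finite_measures. (\<integral>x. f x \<partial>\<mu>) \<in> W} | f W.
        f \<in> vague_test_functions \<and> open W} U"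
      using U by (simp add: vague_topology_def openin_topology_generated_by_iff)
    then show "\<exists>\<J>. finite \<J> \<and> \<J> \<subseteq> \<A> \<and>
         (\<forall>\<nu>\<in>point_measures. (\<forall>A\<in>\<J>. emeasure \<nu> A = emeasure \<mu> A) \<longrightarrow> \<nu> \<in> U)"
      using \<mu>(1)
    proof (induction rule: generate_topology_on.induct)
      case (Int V W)
      then obtain \<J> \<J>' where "finite \<J> \<and> \<J> \<subseteq> \<A> \<and>
         (\<forall>\<nu>\<in>point_measures. (\<forall>A\<in>\<J>. emeasure \<nu> A = emeasure \<mu> A) \<longrightarrow> \<nu> \<in> V)"
        "finite \<J>' \<and> \<J>' \<subseteq> \<A> \<and>
         (\<forall>\<nu>\<in>point_measures. (\<forall>A\<in>\<J>'. emeasure \<nu> A = emeasure \<mu> A) \<longrightarrow> \<nu> \<in> W)"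
        by auto
      then show ?case by (intro exI[of _ "\<J> \<union> \<J>'"]) auto
    next
      case (UN K)
      then obtain k where "k \<in> K" "\<mu> \<in> k" by auto
      with UN.IH[of k] show ?case by (meson UnionI)
    next
      case (Basis V)
      then obtain f W where V: "V = {\<mu> \<in> locally_finite_measures. (\<integral>x. f x \<partial>\<mu>) \<in> W}"
        and f: "f \<in> vague_test_functions" and W: "open W" by auto
      obtain e where e: "e > 0" "ball (\<integral>x. f x \<partial>\<mu>) e \<subseteq> W"
        using W Basis openE[of W "\<integral>x. f x \<partial>\<mu>"] V by auto
      have "bounded {x. f x \<noteq> 0}" using f by (simp add: vague_test_functions_def)
      then obtain s where "{x. f x \<noteq> 0} \<subseteq> ball undefined s"
        using bounded_subset_ballD by blast
      moreover obtain n where "s \<le> real n" using real_arch_simple by auto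
      ultimately have n: "{x. f x \<noteq> 0} \<subseteq> ball undefined (real n)" by fastforce
      obtain \<F> where \<F>: "finite \<F>" "\<F> \<subseteq> \<B>" "\<forall>C\<in>\<F>. C \<subseteq> ball undefined (real n)"
        "\<forall>\<nu>\<in>point_measures. (\<forall>C\<in>insert (ball undefined (real n) - \<Union>\<F>) \<F>.
          emeasure \<nu> C = emeasure \<mu> C) \<longrightarrow> \<bar>(\<integral>x. f x \<partial>\<nu>) - (\<integral>x. f x \<partial>\<mu>)\<bar> < e"
        by (rule integral_point_measure_close[OF f \<mu>(2) e(1) n \<B>(2)])
      have "\<F> \<subseteq> \<A>" using \<F> by (auto simp: \<A>_def intro: bounded_subset[OF bounded_ball])
      moreover have "ball undefined (real n) - \<Union>\<F> \<in> rest ` (UNIV \<times> {\<F>. finite \<F> \<and> \<F> \<subseteq> \<B>})"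
        using \<F> by (intro image_eqI[of _ _ "(n, \<F>)"]) (auto simp: rest_def)
      moreover have "\<nu> \<in> V" if "\<nu> \<in> point_measures"
        "\<forall>C\<in>insert (ball undefined (real n) - \<Union>\<F>) \<F>. emeasure \<nu> C = emeasure \<mu> C" for \<nu>
      proof -
        have "\<bar>(\<integral>x. f x \<partial>\<nu>) - (\<integral>x. f x \<partial>\<mu>)\<bar> < e" using \<F>(4) that by blast
        then have "(\<integral>x. f x \<partial>\<nu>) \<in> ball (\<integral>x. f x \<partial>\<mu>) e"
          by (simp add: dist_real_def abs_minus_commute)
        then show ?thesis using e that V by (auto simp: point_measures_def)
      qed
      ultimately show ?case
        using \<F>(1)
        by (intro exI[of _ "insert (ball undefined (real n) - \<Union>\<F>) \<F>"]) (auto simp: \<A>_def)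
    qed simp
  qed
qed

text \<open>Every relatively open set is a union of sets \<open>N J\<close> given by finitely many
  prescribed counts, and only countably many such \<open>J\<close> occur. Preimages are therefore
  governed by counts alone, although \<open>PM\<close> is defined through the topology.\<close>

lemma measurable_PMI:
  fixes f :: "'b \<Rightarrow> 'a::polish_space measure"
  assumes f: "\<And>\<omega>. \<omega> \<in> space M \<Longrightarrow> f \<omega> \<in> point_measures"
    and meas: "\<And>B. B \<in> sets borel \<Longrightarrow> bounded B \<Longrightarrow> (\<lambda>\<omega>. emeasure (f \<omega>) B) \<in> borel_measurable M"
  shows "f \<in> measurable M PM"
proof -
  obtain \<A> :: "'a set set" where \<A>: "countable \<A>" "\<forall>A\<in>\<A>. A \<in> sets borel \<and> bounded A"
    "\<And>U \<mu>. openin vague_topology U \<Longrightarrow> \<mu> \<in> U \<Longrightarrow> \<mu> \<in> point_measures \<Longrightarrow>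
       \<exists>\<J>. finite \<J> \<and> \<J> \<subseteq> \<A> \<and>
         (\<forall>\<nu>\<in>point_measures. (\<forall>A\<in>\<J>. emeasure \<nu> A = emeasure \<mu> A) \<longrightarrow> \<nu> \<in> U)"
    by (rule vague_network) blast
  define N where "N J = {\<nu> \<in> point_measures. \<forall>(A, n)\<in>J. emeasure \<nu> A = of_nat n}"
    for J :: "('a set \<times> nat) set"
  define \<N> where "\<N> = {J. finite J \<and> J \<subseteq> \<A> \<times> (UNIV :: nat set)}"
  have \<N>: "countable \<N>"
    unfolding \<N>_def using \<A>(1)
    by (intro countable_Collect_finite_subset countable_SIGMA) (auto intro: countableI_type)
  have N_meas: "f -` N J \<inter> space M \<in> sets M" if "J \<in> \<N>" for J
  proof -
    have "{\<omega> \<in> space M. \<forall>p\<in>J. emeasure (f \<omega>) (fst p) = of_nat (snd p)} \<in> sets M"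
    proof (rule sets.sets_Collect_finite_All)
      fix p assume "p \<in> J"
      with that \<A>(2) have [measurable]: "(\<lambda>\<omega>. emeasure (f \<omega>) (fst p)) \<in> borel_measurable M"
        by (intro meas) (auto simp: \<N>_def)
      show "{\<omega> \<in> space M. emeasure (f \<omega>) (fst p) = of_nat (snd p)} \<in> sets M" by measurable
    qed (use that in \<open>auto simp: \<N>_def\<close>)
    moreover have "f -` N J \<inter> space M =
        {\<omega> \<in> space M. \<forall>p\<in>J. emeasure (f \<omega>) (fst p) = of_nat (snd p)}"
      using f by (fastforce simp: N_def)
    ultimately show ?thesis by simp
  qed
  have "f \<in> measurable M (sigma point_measures {U. openin (subtopology vague_topology point_measures) U})"
  proof (rule measurable_measure_of)
    fix U :: "'a measure set" assume "U \<in> {U. openin (subtopology vague_topology point_measures) U}"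
    then obtain V where V: "openin vague_topology V" "U = V \<inter> point_measures"
      by (auto simp: openin_subtopology)
    have "U = (\<Union>J\<in>{J \<in> \<N>. N J \<subseteq> U}. N J)"
    proof (intro equalityI subsetI)
      fix \<mu> assume "\<mu> \<in> U"
      then have \<mu>: "\<mu> \<in> V" "\<mu> \<in> point_measures" using V by auto
      obtain \<J> where \<J>: "finite \<J>" "\<J> \<subseteq> \<A>"
        "\<forall>\<nu>\<in>point_measures. (\<forall>A\<in>\<J>. emeasure \<nu> A = emeasure \<mu> A) \<longrightarrow> \<nu> \<in> V"
        using \<A>(3)[OF V(1) \<mu>] by blast
      have "\<exists>n::nat. emeasure \<mu> A = of_nat n" if "A \<in> \<J>" for A
        using that \<J>(2) \<A>(2) point_measures_nat[OF \<mu>(2)] by blast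
      then obtain n :: "'a set \<Rightarrow> nat" where n: "\<And>A. A \<in> \<J> \<Longrightarrow> emeasure \<mu> A = of_nat (n A)"
        by metis
      \<comment> \<open>The prescribed values are the counts of \<open>\<mu>\<close> itself, so
        \<open>\<mu>\<close> lies in \<open>N J\<close> and every member of \<open>N J\<close>
        agrees with it on \<open>\<J>\<close>.\<close>
      define J where "J = (\<lambda>A. (A, n A)) ` \<J>"
      have "J \<in> \<N>" using \<J> by (auto simp: J_def \<N>_def)
      moreover have "\<mu> \<in> N J" using n \<mu> by (auto simp: N_def J_def)
      moreover have "N J \<subseteq> U"
        using \<J>(3) V n by (auto simp: N_def J_def)
      ultimately show "\<mu> \<in> (\<Union>J\<in>{J \<in> \<N>. N J \<subseteq> U}. N J)" by auto
    qed auto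
    then have "f -` U \<inter> space M = (\<Union>J\<in>{J \<in> \<N>. N J \<subseteq> U}. f -` N J \<inter> space M)"
      by blast
    also have "\<dots> \<in> sets M"
      using N_meas by (intro sets.countable_UN'' countable_subset[OF _ \<N>]) auto
    finally show "f -` U \<inter> space M \<in> sets M" .
  qed (use f in \<open>auto simp: openin_subtopology\<close>)
  then show ?thesis by (simp only: PM_eq_sigma)
qed

section \<open>Convolutions of dominated point processes\<close>

definition dominated :: "'a::polish_space measure \<Rightarrow> 'a measure set" where
  "dominated \<kappa> = {\<nu> \<in> point_measures. \<forall>B\<in>sets borel. emeasure \<nu> B \<le> emeasure \<kappa> B}"

text \<open>Trades an inequality over all Borel sets for countably many conditions, one on the
  complement of the atoms of \<open>\<kappa>\<close> and one for each atom; this makes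
  \<open>dominated \<kappa>\<close> measurable.\<close>

lemma dominated_iff_atoms:
  assumes \<kappa>: "\<kappa> \<in> point_measures"
  shows "\<nu> \<in> dominated \<kappa> \<longleftrightarrow> \<nu> \<in> point_measures \<and> emeasure \<nu> (- atoms \<kappa>) = 0 \<and>
    (\<forall>x\<in>atoms \<kappa>. emeasure \<nu> {x} \<le> emeasure \<kappa> {x})"
proof (intro iffI conjI ballI)
  assume \<nu>: "\<nu> \<in> dominated \<kappa>"
  then show "\<nu> \<in> point_measures" by (simp add: dominated_def)
  have "emeasure \<nu> (- atoms \<kappa>) \<le> emeasure \<kappa> (- atoms \<kappa>)"
    using \<nu> atoms_borel[OF \<kappa>] borel_comp unfolding dominated_def by blast
  then show "emeasure \<nu> (- atoms \<kappa>) = 0" using null_compl_atoms[OF \<kappa>] by (simp add: null_sets_def)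
  show "emeasure \<nu> {x} \<le> emeasure \<kappa> {x}" for x
    using \<nu> by (simp add: dominated_def)
next
  assume \<nu>: "\<nu> \<in> point_measures \<and> emeasure \<nu> (- atoms \<kappa>) = 0 \<and>
    (\<forall>x\<in>atoms \<kappa>. emeasure \<nu> {x} \<le> emeasure \<kappa> {x})"
  have "emeasure \<nu> {x} \<le> emeasure \<kappa> {x}" for x
  proof (cases "x \<in> atoms \<kappa>")
    case False
    then have "emeasure \<nu> {x} \<le> emeasure \<nu> (- atoms \<kappa>)"
      using borel_comp[OF atoms_borel[OF \<kappa>]] \<nu> point_measures_sets[of \<nu>]
      by (intro emeasure_mono) auto
    then show ?thesis using \<nu> by simp
  qed (use \<nu> in auto)
  then have "emeasure \<nu> B \<le> emeasure \<kappa> B" if "B \<in> sets borel" for B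
    using \<nu> \<kappa> that by (subst (1 2) emeasure_point_measure) (auto intro!: nn_integral_mono mult_right_mono)
  then show "\<nu> \<in> dominated \<kappa>" using \<nu> by (simp add: dominated_def)
qed

lemma dominated_sets [measurable]:
  assumes \<kappa>: "\<kappa> \<in> point_measures"
  shows "dominated \<kappa> \<in> sets PM"
proof -
  have [measurable]: "- atoms \<kappa> \<in> sets borel" by (intro borel_comp atoms_borel \<kappa>)
  have "dominated \<kappa> = {\<nu> \<in> space PM. emeasure \<nu> (- atoms \<kappa>) = 0} \<inter>
      {\<nu> \<in> space PM. \<forall>x\<in>atoms \<kappa>. emeasure \<nu> {x} \<le> emeasure \<kappa> {x}}"
    using dominated_iff_atoms[OF \<kappa>] by (auto simp: space_PM)
  also have "\<dots> \<in> sets PM"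
    using countable_atoms[OF \<kappa>]
    by (intro sets.Int sets.sets_Collect_countable_Ball) measurable
  finally show ?thesis .
qed

text \<open>Nonzero terms are at least 1, so a finite total leaves only finitely many of
  them.\<close>

lemma nn_integral_count_space_nat_valued:
  fixes f :: "'i \<Rightarrow> ennreal"
  assumes nat: "\<And>i. i \<in> I \<Longrightarrow> \<exists>n::nat. f i = of_nat n"
    and fin: "(\<integral>\<^sup>+i. f i \<partial>count_space I) < \<infinity>"
  shows "\<exists>n::nat. (\<integral>\<^sup>+i. f i \<partial>count_space I) = of_nat n"
proof -
  obtain n :: "'i \<Rightarrow> nat" where n: "\<And>i. i \<in> I \<Longrightarrow> f i = of_nat (n i)"
    using nat by metis
  define S where "S = {i \<in> I. n i \<noteq> 0}"
  have "finite S"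
  proof (rule ccontr)
    assume "infinite S"
    then have "emeasure (count_space I) S = \<infinity>" by (auto simp: S_def)
    moreover have "emeasure (count_space I) S = (\<integral>\<^sup>+i. indicator S i \<partial>count_space I)"
      by (auto simp: S_def)
    moreover have "\<dots> \<le> (\<integral>\<^sup>+i. f i \<partial>count_space I)"
    proof (rule nn_integral_mono)
      fix i assume "i \<in> space (count_space I)"
      then show "indicator S i \<le> f i"
        using n[of i] by (cases "n i") (auto simp: S_def split: split_indicator)
    qed
    ultimately show False using fin by simp
  qed
  then have "(\<integral>\<^sup>+i. f i \<partial>count_space I) = (\<Sum>i\<in>S. f i)"
    using n by (intro nn_integral_count_space') (auto simp: S_def)
  also have "\<dots> = of_nat (\<Sum>i\<in>S. n i)" using n by (auto simp: S_def)
  finally show ?thesis by blast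
qed

lemma sets_sum_measures: "sets (sum_measures I \<mu>) = sets borel"
  using sets.sets_measure_of_eq[of borel] by (simp add: sum_measures_def)

lemma emeasure_sum_measures:
  fixes \<mu> :: "'i \<Rightarrow> 'a::polish_space measure"
  assumes "\<And>i. i \<in> I \<Longrightarrow> sets (\<mu> i) = sets borel" and B: "B \<in> sets borel"
  shows "emeasure (sum_measures I \<mu>) B = (\<integral>\<^sup>+i. emeasure (\<mu> i) B \<partial>count_space I)"
  unfolding sum_measures_def
proof (rule emeasure_measure_of_sigma)
  show "sigma_algebra UNIV (sets borel)"
    using sets.sigma_algebra_axioms[of borel] by simp
  show "countably_additive (sets borel) (\<lambda>B. \<integral>\<^sup>+i. emeasure (\<mu> i) B \<partial>count_space I)"
  proof (rule countably_additiveI)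
    fix A :: "nat \<Rightarrow> 'a set" assume "range A \<subseteq> sets borel" "disjoint_family A"
    then show "(\<Sum>n. \<integral>\<^sup>+i. emeasure (\<mu> i) (A n) \<partial>count_space I) =
        (\<integral>\<^sup>+i. emeasure (\<mu> i) (\<Union>n. A n) \<partial>count_space I)"
      using assms(1)
      by (subst nn_integral_suminf[symmetric]) (auto intro!: nn_integral_cong suminf_emeasure)
  qed
qed (auto simp: positive_def B)

lemma sum_measures_point_measures:
  fixes \<mu> :: "'i \<Rightarrow> 'a::polish_space measure"
  assumes \<mu>: "\<And>i. i \<in> I \<Longrightarrow> \<mu> i \<in> point_measures"
    and fin: "\<And>B. B \<in> sets borel \<Longrightarrow> bounded B \<Longrightarrow> (\<integral>\<^sup>+i. emeasure (\<mu> i) B \<partial>count_space I) < \<infinity>"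
  shows "sum_measures I \<mu> \<in> point_measures"
proof (rule point_measuresI)
  fix B :: "'a set" assume B: "B \<in> sets borel" "bounded B"
  then have "\<exists>n::nat. emeasure (\<mu> i) B = of_nat n" if "i \<in> I" for i
    using point_measures_nat[OF \<mu>[OF that]] by metis
  then show "\<exists>n::nat. emeasure (sum_measures I \<mu>) B = of_nat n"
    using B fin point_measures_sets[OF \<mu>]
    by (subst emeasure_sum_measures) (auto intro!: nn_integral_count_space_nat_valued)
qed (rule sets_sum_measures)

lemma null_measure_point_measures: "null_measure borel \<in> point_measures"
  by (auto intro!: point_measuresI exI[of _ 0])

lemma superposition_measurable:
  assumes I: "countable I" and Q: "\<And>i. i \<in> I \<Longrightarrow> sets (Q i) = sets PM"
  shows "superposition I \<in> measurable (PiM I Q) (PM :: 'a::polish_space measure measure)"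
proof (rule measurable_PMI)
  show "superposition I \<omega> \<in> point_measures" for \<omega> :: "'b \<Rightarrow> 'a measure"
    by (simp add: superposition_def null_measure_point_measures)
next
  have \<omega>_pm: "\<omega> i \<in> point_measures" if "\<omega> \<in> space (PiM I Q)" "i \<in> I" for \<omega> i
    using that sets_eq_imp_space_eq[OF Q[OF that(2)]] by (auto simp: space_PiM space_PM PiE_iff)
  define s where "s \<omega> B = (\<integral>\<^sup>+i. emeasure (\<omega> i) B \<partial>count_space I)"
    for \<omega> :: "'b \<Rightarrow> 'a measure" and B
  have s_meas: "(\<lambda>\<omega>. s \<omega> B) \<in> borel_measurable (PiM I Q)" if B: "B \<in> sets borel" for B
  proof -
    \<comment> \<open>Countability of \<open>I\<close> makes the counting measure sigma-finite, so
      that the sum is measurable in \<open>\<omega>\<close> as an integral depending on a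
      parameter.\<close>
    interpret sigma_finite_measure "count_space I"
      by (rule sigma_finite_measure_count_space_countable[OF I])
    have "(\<lambda>p. emeasure (fst p (snd p)) B) \<in> borel_measurable (PiM I Q \<Otimes>\<^sub>M count_space I)"
    proof (rule measurable_compose_countable'[where f="\<lambda>i p. emeasure (fst p i) B" and g=snd, OF _ _ I])
      fix i assume i: "i \<in> I"
      have "(\<lambda>\<omega>. \<omega> i) \<in> measurable (PiM I Q) PM"
        using measurable_component_singleton[OF i, of Q]
        by (simp only: measurable_cong_sets[OF refl Q[OF i]])
      from measurable_compose[OF measurable_fst measurable_compose[OF this borel_measurable_PM_emeasure[OF B]]]
      show "(\<lambda>p. emeasure (fst p i) B) \<in> borel_measurable (PiM I Q \<Otimes>\<^sub>M count_space I)" .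
    qed simp
    then show ?thesis
      unfolding s_def by (intro borel_measurable_nn_integral) (simp add: case_prod_unfold)
  qed
  have s_eq: "emeasure (sum_measures I \<omega>) B = s \<omega> B"
    if "\<omega> \<in> space (PiM I Q)" "B \<in> sets borel" for \<omega> B
    unfolding s_def using point_measures_sets[OF \<omega>_pm[OF that(1)]] that
    by (intro emeasure_sum_measures) auto
  \<comment> \<open>The default branch of \<open>superposition\<close> is decided by countably many
    balls, so the case distinction is measurable.\<close>
  have sum_pm: "sum_measures I \<omega> \<in> point_measures \<longleftrightarrow> (\<forall>n. s \<omega> (cball undefined (real n)) < \<infinity>)"
    if \<omega>: "\<omega> \<in> space (PiM I Q)" for \<omega>
  proof
    assume "sum_measures I \<omega> \<in> point_measures"
    then show "\<forall>n. s \<omega> (cball undefined (real n)) < \<infinity>"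
      using point_measures_finite s_eq[OF \<omega>] by (metis bounded_cball borel_closed closed_cball)
  next
    assume fin: "\<forall>n. s \<omega> (cball undefined (real n)) < \<infinity>"
    show "sum_measures I \<omega> \<in> point_measures"
    proof (rule sum_measures_point_measures)
      fix B :: "'a set" assume B: "B \<in> sets borel" "bounded B"
      obtain r where "B \<subseteq> ball undefined r"
        using B bounded_subset_ballD by blast
      moreover obtain n where "r \<le> real n" using real_arch_simple by auto
      ultimately have "B \<subseteq> cball undefined (real n)" by fastforce
      then have "s \<omega> B \<le> s \<omega> (cball undefined (real n))"
        unfolding s_def using point_measures_sets[OF \<omega>_pm[OF \<omega>]]
        by (intro nn_integral_mono emeasure_mono) auto
      then show "(\<integral>\<^sup>+i. emeasure (\<omega> i) B \<partial>count_space I) < \<infinity>"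
        using fin[rule_format, of n] by (simp add: s_def)
    qed (use \<omega>_pm[OF \<omega>] in auto)
  qed
  fix B :: "'a set" assume B: "B \<in> sets borel" "bounded B"
  have [measurable]: "(\<lambda>\<omega>. s \<omega> B) \<in> borel_measurable (PiM I Q)"
    "\<And>n. (\<lambda>\<omega>. s \<omega> (cball undefined (real n))) \<in> borel_measurable (PiM I Q)"
    using s_meas B by auto
  have "emeasure (superposition I \<omega>) B =
      (if \<forall>n. s \<omega> (cball undefined (real n)) < \<infinity> then s \<omega> B else 0)"
    if "\<omega> \<in> space (PiM I Q)" for \<omega>
    using sum_pm[OF that] s_eq[OF that B(1)] by (simp add: superposition_def)
  moreover have "(\<lambda>\<omega>. if \<forall>n. s \<omega> (cball undefined (real n)) < \<infinity> then s \<omega> B else 0)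
      \<in> borel_measurable (PiM I Q)" by measurable
  ultimately show "(\<lambda>\<omega>. emeasure (superposition I \<omega>) B) \<in> borel_measurable (PiM I Q)"
    by (subst measurable_cong)
qed

lemma sets_convolution: "sets (convolution I Q) = sets PM"
  by (simp add: convolution_def)

lemma prob_space_convolution:
  assumes "countable I" "\<And>i. i \<in> I \<Longrightarrow> prob_space (Q i)" "\<And>i. i \<in> I \<Longrightarrow> sets (Q i) = sets PM"
  shows "prob_space (convolution I Q)"
  unfolding convolution_def using assms
  by (intro prob_space.prob_space_distr prob_space_PiM superposition_measurable)

text \<open>The majorants \<open>\<kappa> i\<close> make the superposition locally finite, so that the junk value of
  \<open>superposition\<close> is almost surely not taken.\<close>

locale dominated_convolution =
  fixes I :: "'i set" and Q :: "'i \<Rightarrow> 'a::polish_space measure measure" and \<kappa> :: "'i \<Rightarrow> 'a measure"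
  assumes countable: "countable I"
    and prob: "\<And>i. prob_space (Q i)"
    and sets_Q: "\<And>i. sets (Q i) = sets PM"
    and majorant: "\<And>i. i \<in> I \<Longrightarrow> \<kappa> i \<in> point_measures"
    and AE_Q: "\<And>i. i \<in> I \<Longrightarrow> AE \<nu> in Q i. \<nu> \<in> dominated (\<kappa> i)"
    and majorant_sum: "sum_measures I \<kappa> \<in> point_measures"
begin

lemma AE_PiM: "AE \<omega> in PiM I Q. \<forall>i\<in>I. \<omega> i \<in> dominated (\<kappa> i)"
  using prob AE_Q by (intro AE_ball_countable' AE_PiM_component countable)

lemma sum_dominated:
  assumes \<omega>: "\<forall>i\<in>I. \<omega> i \<in> dominated (\<kappa> i)"
  shows "sum_measures I \<omega> \<in> dominated (sum_measures I \<kappa>)"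
proof -
  have pm: "\<omega> i \<in> point_measures" if "i \<in> I" for i using \<omega> that by (auto simp: dominated_def)
  have le: "(\<integral>\<^sup>+i. emeasure (\<omega> i) B \<partial>count_space I) \<le> emeasure (sum_measures I \<kappa>) B"
    if "B \<in> sets borel" for B
    using that \<omega> point_measures_sets[OF majorant]
    by (subst emeasure_sum_measures) (auto intro!: nn_integral_mono simp: dominated_def)
  then have "sum_measures I \<omega> \<in> point_measures"
    using point_measures_finite[OF majorant_sum] pm
    by (intro sum_measures_point_measures) (auto intro: le_less_trans)
  with le show ?thesis
    using point_measures_sets[OF pm] by (simp add: dominated_def emeasure_sum_measures)
qed

lemma AE_superposition:
  "AE \<omega> in PiM I Q. superposition I \<omega> \<in> dominated (sum_measures I \<kappa>)"
  using AE_PiM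
proof eventually_elim
  fix \<omega> assume "\<forall>i\<in>I. \<omega> i \<in> dominated (\<kappa> i)"
  from sum_dominated[OF this]
  show "superposition I \<omega> \<in> dominated (sum_measures I \<kappa>)"
    by (simp add: superposition_def dominated_def)
qed

lemma AE_convolution: "AE \<nu> in convolution I Q. \<nu> \<in> dominated (sum_measures I \<kappa>)"
proof -
  have "{\<nu> \<in> space PM. \<nu> \<in> dominated (sum_measures I \<kappa>)} = dominated (sum_measures I \<kappa>)"
    by (auto simp: dominated_def space_PM)
  then show ?thesis
    unfolding convolution_def using dominated_sets[OF majorant_sum] AE_superposition sets_Q
    by (subst AE_distr_iff) (auto intro!: superposition_measurable countable)
qed

text \<open>By \<open>null\<close>, only the components in the finite set \<open>A\<close> can have
  atoms where \<open>h\<close> is nonzero; the rest of the possibly infinite superposition is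
  invisible to \<open>h\<close>.\<close>

lemma integral_sum_measures:
  assumes h: "h \<in> bounded_support_functions" and A: "finite A" "A \<subseteq> I"
    and null: "\<And>i x. i \<in> I - A \<Longrightarrow> h x \<noteq> 0 \<Longrightarrow> emeasure (\<kappa> i) {x} = 0"
    and \<omega>: "\<forall>i\<in>I. \<omega> i \<in> dominated (\<kappa> i)"
  shows "(\<integral>x. h x \<partial>sum_measures I \<omega>) = (\<Sum>i\<in>A. \<integral>x. h x \<partial>\<omega> i)"
proof -
  let ?s = "sum_measures I \<omega>"
  have pm: "\<omega> i \<in> point_measures" if "i \<in> I" for i using \<omega> that by (auto simp: dominated_def)
  have s: "?s \<in> point_measures" using sum_dominated[OF \<omega>] by (simp add: dominated_def)
  have point: "emeasure ?s {x} = (\<Sum>i\<in>A. emeasure (\<omega> i) {x})" if "h x \<noteq> 0" for x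
  proof -
    have "emeasure (\<omega> i) {x} = 0" if "i \<in> I - A" for i
    proof -
      have "emeasure (\<omega> i) {x} \<le> emeasure (\<kappa> i) {x}" using \<omega> that by (auto simp: dominated_def)
      then show ?thesis using null[OF that \<open>h x \<noteq> 0\<close>] by simp
    qed
    then show ?thesis
      using A point_measures_sets[OF pm]
      by (subst emeasure_sum_measures) (auto intro!: nn_integral_count_space')
  qed
  define F where "F = atoms ?s \<inter> {x. h x \<noteq> 0}"
  have F: "finite F" unfolding F_def
    using h by (intro finite_atoms_bounded s) (simp add: bounded_support_functions_def)
  have atoms: "atoms (\<omega> i) \<inter> {x. h x \<noteq> 0} \<subseteq> F" if "i \<in> A" for i
  proof
    fix x assume x: "x \<in> atoms (\<omega> i) \<inter> {x. h x \<noteq> 0}"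
    then have "emeasure (\<omega> i) {x} \<le> (\<Sum>i\<in>A. emeasure (\<omega> i) {x})"
      using A that by (intro member_le_sum) auto
    with x point[of x] show "x \<in> F" by (auto simp: F_def)
  qed
  have meas: "measure ?s {x} = (\<Sum>i\<in>A. measure (\<omega> i) {x})" if "x \<in> F" for x
  proof -
    have "emeasure (\<omega> i) {x} = ennreal (measure (\<omega> i) {x})" if "i \<in> A" for i
      using point_measures_finite[OF pm, of i "{x}"] A that
      by (intro emeasure_eq_ennreal_measure) auto
    then have "emeasure ?s {x} = ennreal (\<Sum>i\<in>A. measure (\<omega> i) {x})"
      using point[of x] that by (simp add: F_def)
    then show ?thesis by (simp add: measure_def[of ?s] sum_nonneg)
  qed
  have "(\<integral>x. h x \<partial>?s) = (\<Sum>x\<in>F. (\<Sum>i\<in>A. measure (\<omega> i) {x}) * h x)"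
    using meas by (subst integral_point_measure[OF h s F]) (auto simp: F_def)
  also have "\<dots> = (\<Sum>i\<in>A. \<Sum>x\<in>F. measure (\<omega> i) {x} * h x)"
    by (simp add: sum_distrib_right) (rule sum.swap)
  also have "\<dots> = (\<Sum>i\<in>A. \<integral>x. h x \<partial>\<omega> i)"
    using A atoms pm by (intro sum.cong integral_point_measure[symmetric] h F) auto
  finally show ?thesis .
qed

text \<open>Almost surely the functional depends only on the coordinates in \<open>A\<close>, so the
  product measure may be projected to the finite product over \<open>A\<close>, where independence
  turns the exponential of a sum into a product of integrals.\<close>

lemma laplace_convolution:
  assumes h: "h \<in> bounded_support_functions" and A: "finite A" "A \<subseteq> I"
    and null: "\<And>i x. i \<in> I - A \<Longrightarrow> h x \<noteq> 0 \<Longrightarrow> emeasure (\<kappa> i) {x} = 0"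
  shows "(\<integral>\<^sup>+\<nu>. ennreal (exp (- (\<integral>x. h x \<partial>\<nu>))) \<partial>convolution I Q) =
    (\<Prod>i\<in>A. \<integral>\<^sup>+\<nu>. ennreal (exp (- (\<integral>x. h x \<partial>\<nu>))) \<partial>Q i)"
proof -
  let ?e = "\<lambda>\<nu>. ennreal (exp (- (\<integral>x. h x \<partial>\<nu>)))"
  interpret product_sigma_finite Q
    using prob by (intro product_sigma_finite.intro prob_space_imp_sigma_finite)
  interpret product_prob_space Q I
    by (intro product_prob_space.intro product_sigma_finite_axioms product_prob_space_axioms.intro prob)
  note [measurable_cong] = sets_Q
  have [measurable]: "?e \<in> borel_measurable PM"
    by (rule borel_measurable_PM_laplace[OF h])
  have "(\<integral>\<^sup>+\<nu>. ?e \<nu> \<partial>convolution I Q) = (\<integral>\<^sup>+\<omega>. ?e (superposition I \<omega>) \<partial>PiM I Q)"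
    unfolding convolution_def
    by (intro nn_integral_distr superposition_measurable countable sets_Q)
      (simp only: measurable_distr_eq1 borel_measurable_PM_laplace[OF h])
  also have "\<dots> = (\<integral>\<^sup>+\<omega>. (\<Prod>i\<in>A. ?e (\<omega> i)) \<partial>PiM I Q)"
  proof (rule nn_integral_cong_AE)
    show "AE \<omega> in PiM I Q. ?e (superposition I \<omega>) = (\<Prod>i\<in>A. ?e (\<omega> i))"
      using AE_PiM
    proof eventually_elim
      fix \<omega> assume \<omega>: "\<forall>i\<in>I. \<omega> i \<in> dominated (\<kappa> i)"
      then have "superposition I \<omega> = sum_measures I \<omega>"
        using sum_dominated[OF \<omega>] by (simp add: superposition_def dominated_def)
      then show "?e (superposition I \<omega>) = (\<Prod>i\<in>A. ?e (\<omega> i))"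
        using integral_sum_measures[OF h A null \<omega>] A
        by (simp add: prod_ennreal exp_sum[symmetric] sum_negf)
    qed
  qed
  also have "\<dots> = (\<integral>\<^sup>+\<omega>. (\<Prod>i\<in>A. ?e (restrict \<omega> A i)) \<partial>PiM I Q)" by simp
  also have "\<dots> = (\<integral>\<^sup>+\<omega>. (\<Prod>i\<in>A. ?e (\<omega> i)) \<partial>distr (PiM I Q) (PiM A Q) (\<lambda>\<omega>. restrict \<omega> A))"
    using A by (intro nn_integral_distr[symmetric] measurable_restrict_subset) measurable
  also have "\<dots> = (\<integral>\<^sup>+\<omega>. (\<Prod>i\<in>A. ?e (\<omega> i)) \<partial>PiM A Q)"
    by (simp add: distr_PiM_restrict_finite[OF A])
  also have "\<dots> = (\<Prod>i\<in>A. \<integral>\<^sup>+\<nu>. ?e \<nu> \<partial>Q i)"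
    using A by (intro product_nn_integral_prod) measurable
  finally show ?thesis .
qed

end

section \<open>Thinning and splitting kernels\<close>

lemma return_point_measures: "return borel (x :: 'a::polish_space) \<in> point_measures"
proof (rule point_measuresI)
  fix B :: "'a set" assume "B \<in> sets borel"
  then have "emeasure (return borel x) B = of_nat (if x \<in> B then 1 else 0)"
    by simp
  then show "\<exists>n::nat. emeasure (return borel x) B = of_nat n" ..
qed simp

lemma sets_thinned_point: "sets (thinned_point q x) = sets PM"
  by (simp add: thinned_point_def)

lemma measurable_thinned_point:
  "(\<lambda>keep. if keep then return borel (x :: 'a::polish_space) else null_measure borel)
     \<in> measurable (measure_pmf (bernoulli_pmf q)) PM"
  by (simp add: space_PM Pi_iff return_point_measures null_measure_point_measures)

lemma prob_space_thinned_point: "prob_space (thinned_point q x)"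
  unfolding thinned_point_def
  by (intro prob_space.prob_space_distr measurable_thinned_point prob_space_measure_pmf)

lemma AE_thinned_point: "AE \<nu> in thinned_point q x. \<nu> \<in> dominated (return borel x)"
proof -
  have "{\<nu> \<in> space PM. \<nu> \<in> dominated (return borel x)} = dominated (return borel x)"
    by (auto simp: dominated_def space_PM)
  moreover have "(if keep then return borel x else null_measure borel) \<in> dominated (return borel x)" for keep
    using return_point_measures[of x] null_measure_point_measures by (auto simp: dominated_def)
  ultimately show ?thesis
    unfolding thinned_point_def using dominated_sets[OF return_point_measures[of x]]
    by (subst AE_distr_iff[OF measurable_thinned_point]) auto
qed

lemma laplace_thinned_point:
  assumes h: "h \<in> bounded_support_functions" and q: "0 \<le> q" "q \<le> 1"
  shows "(\<integral>\<^sup>+\<nu>. ennreal (exp (- (\<integral>y. h y \<partial>\<nu>))) \<partial>thinned_point q x) =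
    ennreal (q * exp (- h x) + (1 - q))"
proof -
  have [measurable]: "h \<in> borel_measurable borel"
    using h by (simp add: bounded_support_functions_def)
  have "(\<integral>\<^sup>+\<nu>. ennreal (exp (- (\<integral>y. h y \<partial>\<nu>))) \<partial>thinned_point q x) =
     (\<integral>\<^sup>+keep. ennreal (exp (- (\<integral>y. h y \<partial>(if keep then return borel x else null_measure borel))))
        \<partial>bernoulli_pmf q)"
    unfolding thinned_point_def
    by (intro nn_integral_distr measurable_thinned_point)
      (simp only: measurable_distr_eq1 borel_measurable_PM_laplace[OF h])
  also have "\<dots> = ennreal (exp (- (\<integral>y. h y \<partial>return borel x))) * ennreal q +
      ennreal (exp (- (\<integral>y. h y \<partial>null_measure borel))) * ennreal (1 - q)"
    using q by (subst nn_integral_bernoulli_pmf) auto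
  also have "\<dots> = ennreal (q * exp (- h x) + (1 - q))"
    using q by (simp add: integral_return mult.commute flip: ennreal_mult ennreal_plus)
  finally show ?thesis .
qed

lemma emeasure_sum_return:
  fixes n :: "'a::polish_space \<Rightarrow> nat"
  assumes B: "B \<in> sets borel"
  shows "emeasure (sum_measures {..<k} (\<lambda>_. return borel x)) B = of_nat k * indicator B x"
    and "emeasure (sum_measures I (\<lambda>x. sum_measures {..<n x} (\<lambda>_. return borel x))) B =
      (\<integral>\<^sup>+x. of_nat (n x) * indicator B x \<partial>count_space I)"
proof -
  have *: "emeasure (sum_measures {..<k} (\<lambda>_. return borel x)) B = of_nat k * indicator B x" for k and x :: 'a
    using B by (subst emeasure_sum_measures) (auto simp: nn_integral_count_space_finite mult.commute)
  then show "emeasure (sum_measures {..<k} (\<lambda>_. return borel x)) B = of_nat k * indicator B x" .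
  show "emeasure (sum_measures I (\<lambda>x. sum_measures {..<n x} (\<lambda>_. return borel x))) B =
      (\<integral>\<^sup>+x. of_nat (n x) * indicator B x \<partial>count_space I)"
    using B by (subst emeasure_sum_measures) (auto simp: sets_sum_measures *)
qed

lemma sum_return_point_measures:
  "sum_measures {..<k::nat} (\<lambda>_. return borel (x :: 'a::polish_space)) \<in> point_measures"
proof (rule point_measuresI)
  fix B :: "'a set" assume "B \<in> sets borel"
  then have "emeasure (sum_measures {..<k} (\<lambda>_. return borel x)) B = of_nat (if x \<in> B then k else 0)"
    by (simp add: emeasure_sum_return)
  then show "\<exists>n::nat. emeasure (sum_measures {..<k} (\<lambda>_. return borel x)) B = of_nat n" ..
qed (rule sets_sum_measures)

text \<open>Says that the majorants of the thinning kernel add up to \<open>\<mu>\<close>, which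
  makes its infinite convolution locally finite and the thinned measure dominated by
  \<open>\<mu>\<close>.\<close>

lemma sum_atoms_eq:
  assumes \<mu>: "\<mu> \<in> point_measures"
  shows "sum_measures (atoms \<mu>) (\<lambda>x. sum_measures {..<multiplicity_at \<mu> x} (\<lambda>_. return borel x)) = \<mu>"
proof (rule measure_eqI)
  fix B assume "B \<in> sets (sum_measures (atoms \<mu>)
    (\<lambda>x. sum_measures {..<multiplicity_at \<mu> x} (\<lambda>_. return borel x)))"
  then have B: "B \<in> sets borel" by (simp add: sets_sum_measures)
  have "(\<integral>\<^sup>+x. of_nat (multiplicity_at \<mu> x) * indicator B x \<partial>count_space (atoms \<mu>)) =
      (\<integral>\<^sup>+x. emeasure \<mu> {x} * indicator B x \<partial>count_space UNIV)"
    unfolding multiplicity_at(1)[OF \<mu>, symmetric]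
    by (rule nn_integral_count_space_eq) auto
  then show "emeasure (sum_measures (atoms \<mu>)
      (\<lambda>x. sum_measures {..<multiplicity_at \<mu> x} (\<lambda>_. return borel x))) B = emeasure \<mu> B"
    using B by (simp add: emeasure_sum_return(2) emeasure_point_measure[OF \<mu> B])
qed (simp add: sets_sum_measures point_measures_sets[OF \<mu>])

text \<open>For \<open>q\<close> in [0, 1] this is the law of a binomial number of copies of the
  point mass at \<open>x\<close>, with parameters \<open>n\<close> and \<open>q\<close>. The name
  separates the two nested convolutions of \<open>thinning_kernel\<close>.\<close>

definition thinned_atom :: "real \<Rightarrow> 'a::polish_space \<Rightarrow> nat \<Rightarrow> 'a measure measure" where
  "thinned_atom q x n = convolution {..<n} (\<lambda>_. thinned_point q x)"

lemma dominated_convolution_thinned_atom: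
  "dominated_convolution {..<n::nat} (\<lambda>_. thinned_point q x) (\<lambda>_. return borel x)"
  by (intro dominated_convolution.intro countableI_type countable_finite finite_lessThan
      sets_thinned_point prob_space_thinned_point AE_thinned_point return_point_measures
      sum_return_point_measures)

lemma laplace_thinned_atom:
  assumes h: "h \<in> bounded_support_functions" and q: "0 \<le> q" "q \<le> 1"
  shows "(\<integral>\<^sup>+\<nu>. ennreal (exp (- (\<integral>y. h y \<partial>\<nu>))) \<partial>thinned_atom q x n) =
    ennreal ((q * exp (- h x) + (1 - q)) ^ n)"
proof -
  interpret dominated_convolution "{..<n}" "\<lambda>_. thinned_point q x" "\<lambda>_. return borel x"
    by (rule dominated_convolution_thinned_atom)
  show ?thesis
    unfolding thinned_atom_def using q
    by (subst laplace_convolution[OF h, of "{..<n}"])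
       (auto simp: laplace_thinned_point[OF h q] ennreal_power simp del: ennreal_plus)
qed

lemma dominated_convolution_thinning_kernel:
  assumes \<mu>: "\<mu> \<in> point_measures"
  shows "dominated_convolution (atoms \<mu>) (\<lambda>x. thinned_atom q x (multiplicity_at \<mu> x))
    (\<lambda>x. sum_measures {..<multiplicity_at \<mu> x} (\<lambda>_. return borel x))"
proof (rule dominated_convolution.intro)
  fix x :: 'a
  interpret A: dominated_convolution "{..<multiplicity_at \<mu> x}" "\<lambda>_. thinned_point q x" "\<lambda>_. return borel x"
    by (rule dominated_convolution_thinned_atom)
  show "prob_space (thinned_atom q x (multiplicity_at \<mu> x))"
    unfolding thinned_atom_def by (intro prob_space_convolution A.prob A.sets_Q) auto
  show "sets (thinned_atom q x (multiplicity_at \<mu> x)) = sets PM"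
    by (simp add: thinned_atom_def sets_convolution)
  show "sum_measures {..<multiplicity_at \<mu> x} (\<lambda>_. return borel x) \<in> point_measures"
    by (rule sum_return_point_measures)
  show "AE \<nu> in thinned_atom q x (multiplicity_at \<mu> x).
      \<nu> \<in> dominated (sum_measures {..<multiplicity_at \<mu> x} (\<lambda>_. return borel x))"
    unfolding thinned_atom_def by (rule A.AE_convolution)
qed (simp_all add: countable_atoms[OF \<mu>] sum_atoms_eq[OF \<mu>] \<mu>)

lemma thinning_kernel_eq:
  "thinning_kernel q \<mu> = convolution (atoms \<mu>) (\<lambda>x. thinned_atom q x (multiplicity_at \<mu> x))"
  by (simp add: thinning_kernel_def thinned_atom_def)

lemma sets_thinning_kernel: "sets (thinning_kernel q \<mu>) = sets PM"
  by (simp add: thinning_kernel_eq sets_convolution)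

lemma prob_space_thinning_kernel:
  assumes \<mu>: "\<mu> \<in> point_measures"
  shows "prob_space (thinning_kernel q \<mu>)"
proof -
  interpret dominated_convolution "atoms \<mu>" "\<lambda>x. thinned_atom q x (multiplicity_at \<mu> x)"
      "\<lambda>x. sum_measures {..<multiplicity_at \<mu> x} (\<lambda>_. return borel x)"
    by (rule dominated_convolution_thinning_kernel[OF \<mu>])
  show ?thesis
    unfolding thinning_kernel_eq by (intro prob_space_convolution countable prob sets_Q)
qed

lemma AE_thinning_kernel:
  assumes \<mu>: "\<mu> \<in> point_measures"
  shows "AE \<nu> in thinning_kernel q \<mu>. \<nu> \<in> dominated \<mu>"
  using dominated_convolution.AE_convolution[OF dominated_convolution_thinning_kernel[OF \<mu>, of q]]
  unfolding thinning_kernel_eq sum_atoms_eq[OF \<mu>] .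

lemma laplace_thinning_kernel:
  assumes \<mu>: "\<mu> \<in> point_measures" and h: "h \<in> bounded_support_functions" and q: "0 \<le> q" "q \<le> 1"
    and A: "finite A" "A \<subseteq> atoms \<mu>" "atoms \<mu> \<inter> {x. h x \<noteq> 0} \<subseteq> A"
  shows "(\<integral>\<^sup>+\<nu>. ennreal (exp (- (\<integral>x. h x \<partial>\<nu>))) \<partial>thinning_kernel q \<mu>) =
    ennreal (\<Prod>x\<in>A. (q * exp (- h x) + (1 - q)) ^ multiplicity_at \<mu> x)"
proof -
  interpret dominated_convolution "atoms \<mu>" "\<lambda>x. thinned_atom q x (multiplicity_at \<mu> x)"
      "\<lambda>x. sum_measures {..<multiplicity_at \<mu> x} (\<lambda>_. return borel x)"
    by (rule dominated_convolution_thinning_kernel[OF \<mu>])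
  have "(\<integral>\<^sup>+\<nu>. ennreal (exp (- (\<integral>x. h x \<partial>\<nu>))) \<partial>thinning_kernel q \<mu>) =
    (\<Prod>x\<in>A. \<integral>\<^sup>+\<nu>. ennreal (exp (- (\<integral>x. h x \<partial>\<nu>))) \<partial>thinned_atom q x (multiplicity_at \<mu> x))"
    unfolding thinning_kernel_eq
  proof (rule laplace_convolution[OF h A(1,2)])
    fix i x assume "i \<in> atoms \<mu> - A" "h x \<noteq> 0"
    then have "i \<noteq> x" using A(3) by auto
    then show "emeasure (sum_measures {..<multiplicity_at \<mu> i} (\<lambda>_. return borel i)) {x} = 0"
      by (simp add: emeasure_sum_return)
  qed
  then show ?thesis
    using q by (simp add: laplace_thinned_atom[OF h q] prod_ennreal)
qed

text \<open>The difference is rebuilt from multiplicities: they are finite at each point, and the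
  truncated subtraction of naturals is exact since \<open>\<nu>\<close> is dominated. Summing over
  points gives the identity on unbounded sets as well, where subtracting infinite masses would
  not.\<close>

lemma dominated_complement_exists:
  assumes \<mu>: "\<mu> \<in> point_measures" and \<nu>: "\<nu> \<in> dominated \<mu>"
  obtains \<kappa> where "\<kappa> \<in> point_measures"
    "\<forall>B\<in>sets borel. emeasure \<mu> B = emeasure \<nu> B + emeasure \<kappa> B"
proof -
  have \<nu>_pm: "\<nu> \<in> point_measures" using \<nu> by (simp add: dominated_def)
  define n where "n x = multiplicity_at \<mu> x - multiplicity_at \<nu> x" for x
  define \<kappa> where "\<kappa> = sum_measures UNIV (\<lambda>x. sum_measures {..<n x} (\<lambda>_. return borel x))"
  have le: "multiplicity_at \<nu> x \<le> multiplicity_at \<mu> x" for x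
  proof -
    have "emeasure \<nu> {x} \<le> emeasure \<mu> {x}" using \<nu> by (simp add: dominated_def)
    then show ?thesis
      by (simp add: multiplicity_at(1)[OF \<mu>] multiplicity_at(1)[OF \<nu>_pm] ennreal_of_nat_eq_real_of_nat)
  qed
  have eq: "emeasure \<mu> B = emeasure \<nu> B + emeasure \<kappa> B" if B: "B \<in> sets borel" for B
  proof -
    have "emeasure \<nu> B + emeasure \<kappa> B = (\<integral>\<^sup>+x. emeasure \<nu> {x} * indicator B x + of_nat (n x) * indicator B x
        \<partial>count_space UNIV)"
      unfolding emeasure_point_measure[OF \<nu>_pm B] \<kappa>_def emeasure_sum_return(2)[OF B]
      by (subst nn_integral_add) auto
    also have "\<dots> = (\<integral>\<^sup>+x. emeasure \<mu> {x} * indicator B x \<partial>count_space UNIV)"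
    proof (intro nn_integral_cong)
      fix x
      have "multiplicity_at \<mu> x = multiplicity_at \<nu> x + n x" using le[of x] by (simp add: n_def)
      then show "emeasure \<nu> {x} * indicator B x + of_nat (n x) * indicator B x =
          emeasure \<mu> {x} * indicator B x"
        by (simp add: multiplicity_at(1)[OF \<mu>] multiplicity_at(1)[OF \<nu>_pm] distrib_right)
    qed
    also have "\<dots> = emeasure \<mu> B" by (rule emeasure_point_measure[OF \<mu> B, symmetric])
    finally show ?thesis ..
  qed
  have "\<kappa> \<in> point_measures"
    unfolding \<kappa>_def
  proof (rule sum_measures_point_measures)
    fix B :: "'a set" assume B: "B \<in> sets borel" "bounded B"
    have "(\<integral>\<^sup>+x. emeasure (sum_measures {..<n x} (\<lambda>_. return borel x)) B \<partial>count_space UNIV) = emeasure \<kappa> B"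
      unfolding \<kappa>_def using B by (subst emeasure_sum_measures) (auto simp: sets_sum_measures)
    also have "\<dots> \<le> emeasure \<mu> B" by (simp add: eq[OF B(1)])
    also have "\<dots> < \<infinity>" by (rule point_measures_finite[OF \<mu> B])
    finally show "(\<integral>\<^sup>+x. emeasure (sum_measures {..<n x} (\<lambda>_. return borel x)) B \<partial>count_space UNIV) < \<infinity>" .
  qed (rule sum_return_point_measures)
  with eq show ?thesis by (intro that) auto
qed

text \<open>Two candidates agree at every singleton, because the mass of \<open>\<nu>\<close> there
  is finite and cancels; this uniqueness gives the definite description in
  \<open>point_measure_diff\<close> its meaning.\<close>

lemma point_measure_diff_dominated:
  assumes \<mu>: "\<mu> \<in> point_measures" and \<nu>: "\<nu> \<in> dominated \<mu>"
  shows "point_measure_diff \<mu> \<nu> \<in> point_measures"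
    and "B \<in> sets borel \<Longrightarrow> emeasure \<mu> B = emeasure \<nu> B + emeasure (point_measure_diff \<mu> \<nu>) B"
proof -
  let ?D = "\<lambda>\<kappa>. \<kappa> \<in> point_measures \<and>
    (\<forall>B\<in>sets borel. emeasure \<mu> B = emeasure \<nu> B + emeasure \<kappa> B)"
  have \<nu>_pm: "\<nu> \<in> point_measures" using \<nu> by (simp add: dominated_def)
  obtain \<kappa> where \<kappa>: "?D \<kappa>" using dominated_complement_exists[OF assms] by metis
  have "\<kappa>' = \<kappa>" if "?D \<kappa>'" for \<kappa>'
  proof (rule point_measures_eqI)
    fix x
    have "emeasure \<nu> {x} + emeasure \<kappa>' {x} = emeasure \<nu> {x} + emeasure \<kappa> {x}"
      using that \<kappa> by (metis borel_closed closed_singleton)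
    then show "emeasure \<kappa>' {x} = emeasure \<kappa> {x}"
      using point_measures_finite[OF \<nu>_pm, of "{x}"] by (auto simp: less_top)
  qed (use that \<kappa> in auto)
  then have "?D (THE \<kappa>. ?D \<kappa>)"
    using \<kappa> by (intro theI[of ?D \<kappa>])
  moreover have "point_measure_diff \<mu> \<nu> = (THE \<kappa>. ?D \<kappa>)"
    unfolding point_measure_diff_def Let_def using \<kappa> by (subst if_P) auto
  ultimately show "point_measure_diff \<mu> \<nu> \<in> point_measures"
    and "B \<in> sets borel \<Longrightarrow> emeasure \<mu> B = emeasure \<nu> B + emeasure (point_measure_diff \<mu> \<nu>) B"
    by auto
qed

lemma point_measure_diff_not_dominated:
  assumes "\<nu> \<in> point_measures" "\<nu> \<notin> dominated \<mu>"
  shows "point_measure_diff \<mu> \<nu> = null_measure borel"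
  using assms unfolding point_measure_diff_def Let_def dominated_def
  by (subst if_not_P) (auto intro: le_iff_add[THEN iffD2])

text \<open>On a bounded set the mass of the difference is a subtraction of finite masses, and the
  default case is cut out by the measurable set \<open>dominated \<mu>\<close>.\<close>

lemma measurable_point_measure_diff:
  assumes \<mu>: "\<mu> \<in> point_measures"
  shows "point_measure_diff \<mu> \<in> measurable PM PM"
proof (rule measurable_PMI)
  fix \<nu> :: "'a measure" assume "\<nu> \<in> space PM"
  then show "point_measure_diff \<mu> \<nu> \<in> point_measures"
    using point_measure_diff_dominated[OF \<mu>] point_measure_diff_not_dominated[of \<nu> \<mu>]
      null_measure_point_measures by (cases "\<nu> \<in> dominated \<mu>") (auto simp: space_PM)
next
  fix B :: "'a set" assume B: "B \<in> sets borel" "bounded B"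
  have "emeasure (point_measure_diff \<mu> \<nu>) B =
      (if \<nu> \<in> dominated \<mu> then emeasure \<mu> B - emeasure \<nu> B else 0)" if "\<nu> \<in> space PM" for \<nu> :: "'a measure"
    using point_measure_diff_dominated(2)[OF \<mu> _ B(1), of \<nu>] point_measures_finite[OF _ B, of \<nu>]
      point_measure_diff_not_dominated[of \<nu> \<mu>] that by (auto simp: space_PM)
  moreover have "{\<nu> \<in> space PM. \<nu> \<in> dominated \<mu>} = dominated \<mu>"
    by (auto simp: dominated_def space_PM)
  then have "(\<lambda>\<nu>. if \<nu> \<in> dominated \<mu> then emeasure \<mu> B - emeasure \<nu> B else 0) \<in> borel_measurable PM"
    using dominated_sets[OF \<mu>] B
    by (intro measurable_If borel_measurable_minus_ennreal borel_measurable_PM_emeasure) auto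
  ultimately show "(\<lambda>\<nu>. emeasure (point_measure_diff \<mu> \<nu>) B) \<in> borel_measurable PM"
    by (subst measurable_cong)
qed

lemma integral_point_measure_diff:
  assumes \<mu>: "\<mu> \<in> point_measures" and \<nu>: "\<nu> \<in> dominated \<mu>" and h: "h \<in> bounded_support_functions"
  shows "(\<integral>x. h x \<partial>point_measure_diff \<mu> \<nu>) = (\<integral>x. h x \<partial>\<mu>) - (\<integral>x. h x \<partial>\<nu>)"
proof -
  let ?\<kappa> = "point_measure_diff \<mu> \<nu>"
  have pm: "\<nu> \<in> point_measures" "?\<kappa> \<in> point_measures"
    using \<nu> point_measure_diff_dominated(1)[OF \<mu> \<nu>] by (auto simp: dominated_def)
  have add: "emeasure \<mu> {x} = emeasure \<nu> {x} + emeasure ?\<kappa> {x}" for x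
    by (rule point_measure_diff_dominated(2)[OF \<mu> \<nu>]) simp
  define A where "A = atoms \<mu> \<inter> {x. h x \<noteq> 0}"
  have A: "finite A"
    unfolding A_def using h by (intro finite_atoms_bounded \<mu>) (simp add: bounded_support_functions_def)
  have sub: "atoms \<mu> \<inter> {x. h x \<noteq> 0} \<subseteq> A" "atoms \<nu> \<inter> {x. h x \<noteq> 0} \<subseteq> A"
      "atoms ?\<kappa> \<inter> {x. h x \<noteq> 0} \<subseteq> A"
    unfolding A_def zero_less_iff_neq_zero add by auto
  have "measure \<mu> {x} = measure \<nu> {x} + measure ?\<kappa> {x}" for x
    using add[of x] point_measures_finite[OF pm(1), of "{x}"] point_measures_finite[OF pm(2), of "{x}"]
    by (simp add: measure_def enn2real_plus)
  then show ?thesis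
    unfolding integral_point_measure[OF h \<mu> A sub(1)] integral_point_measure[OF h pm(1) A sub(2)]
      integral_point_measure[OF h pm(2) A sub(3)]
    by (simp add: algebra_simps sum.distrib)
qed

text \<open>\<open>exp (- mixture q f g)\<close> is the Laplace functional of the splitting of a single point.\<close>

definition mixture :: "real \<Rightarrow> ('a \<Rightarrow> real) \<Rightarrow> ('a \<Rightarrow> real) \<Rightarrow> 'a \<Rightarrow> real" where
  "mixture q f g x = - ln (q * exp (- f x) + (1 - q) * exp (- g x))"

lemma mixture_pos:
  fixes a b q :: real
  assumes "0 \<le> q" "q \<le> 1" "0 < a" "0 < b"
  shows "0 < q * a + (1 - q) * b"
  using assms by (cases "q = 0") (auto intro!: add_pos_nonneg)

lemma exp_mixture:
  assumes "0 \<le> q" "q \<le> 1"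
  shows "exp (- mixture q f g x) = q * exp (- f x) + (1 - q) * exp (- g x)"
  using mixture_pos[OF assms, of "exp (- f x)" "exp (- g x)"] by (simp add: mixture_def)

text \<open>The convex combination of \<open>exp (- f x)\<close> and \<open>exp (- g x)\<close> lies
  between \<open>exp (- (c + d))\<close> and \<open>exp (c + d)\<close>, and it equals 1 where both
  functions vanish.\<close>

lemma mixture_bounded_support:
  assumes f: "f \<in> bounded_support_functions" and g: "g \<in> bounded_support_functions"
    and q: "0 \<le> q" "q \<le> 1"
  shows "mixture q f g \<in> bounded_support_functions"
proof -
  obtain c where c: "0 \<le> c" "\<forall>x. \<bar>f x\<bar> \<le> c" by (rule bounded_support_bound[OF f])
  obtain d where d: "0 \<le> d" "\<forall>x. \<bar>g x\<bar> \<le> d" by (rule bounded_support_bound[OF g])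
  have [measurable]: "f \<in> borel_measurable borel" "g \<in> borel_measurable borel"
    using f g by (auto simp: bounded_support_functions_def)
  show ?thesis
  proof (rule bounded_support_functionsI[where c="c + d" and S="{x. f x \<noteq> 0} \<union> {x. g x \<noteq> 0}"])
    show "mixture q f g \<in> borel_measurable borel" unfolding mixture_def by measurable
    show "bounded ({x. f x \<noteq> 0} \<union> {x. g x \<noteq> 0})"
      using f g by (auto simp: bounded_support_functions_def)
    show "mixture q f g x = 0" if "x \<notin> {x. f x \<noteq> 0} \<union> {x. g x \<noteq> 0}" for x
      using that by (simp add: mixture_def)
    fix x
    have fg: "\<bar>f x\<bar> \<le> c + d" "\<bar>g x\<bar> \<le> c + d"
      using c d by (auto intro: order_trans[of _ c] order_trans[of _ d])
    have "q * exp (- f x) + (1 - q) * exp (- g x) \<le> q * exp (c + d) + (1 - q) * exp (c + d)"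
      using fg q by (intro add_mono mult_left_mono) auto
    then have "exp (- mixture q f g x) \<le> exp (c + d)"
      by (simp add: exp_mixture[OF q] algebra_simps)
    moreover have "q * exp (- (c + d)) + (1 - q) * exp (- (c + d)) \<le> q * exp (- f x) + (1 - q) * exp (- g x)"
      using fg q by (intro add_mono mult_left_mono) auto
    then have "exp (- (c + d)) \<le> exp (- mixture q f g x)"
      by (simp add: exp_mixture[OF q] algebra_simps)
    ultimately show "\<bar>mixture q f g x\<bar> \<le> c + d" by (simp only: exp_le_cancel_iff)
  qed
qed

lemma bounded_support_diff:
  assumes f: "f \<in> bounded_support_functions" and g: "g \<in> bounded_support_functions"
  shows "(\<lambda>x. f x - g x) \<in> bounded_support_functions"
proof -
  obtain c where c: "0 \<le> c" "\<forall>x. \<bar>f x\<bar> \<le> c" by (rule bounded_support_bound[OF f])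
  obtain d where d: "0 \<le> d" "\<forall>x. \<bar>g x\<bar> \<le> d" by (rule bounded_support_bound[OF g])
  show ?thesis
  proof (rule bounded_support_functionsI[where c="c + d" and S="{x. f x \<noteq> 0} \<union> {x. g x \<noteq> 0}"])
    show "\<bar>f x - g x\<bar> \<le> c + d" for x
      using c(2)[rule_format, of x] d(2)[rule_format, of x] by linarith
  qed (use f g in \<open>auto simp: bounded_support_functions_def\<close>)
qed

text \<open>Almost surely the second component integrates \<open>g\<close> to the difference of its
  integrals against \<open>\<mu>\<close> and \<open>\<nu>\<close>. This splits off a factor
  depending on \<open>\<mu>\<close> only and leaves the Laplace functional of the thinning at the
  signed function \<open>f - g\<close>; atom by atom, \<open>exp (- g x)\<close> times the thinned
  factor is \<open>exp (- mixture q f g x)\<close>.\<close>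

lemma laplace_splitting_kernel:
  assumes \<mu>: "\<mu> \<in> point_measures" and f: "f \<in> bounded_support_functions"
    and g: "g \<in> bounded_support_functions" and q: "0 \<le> q" "q \<le> 1"
  shows "(\<integral>\<^sup>+\<nu>. ennreal (exp (- ((\<integral>x. f x \<partial>\<nu>) + (\<integral>x. g x \<partial>point_measure_diff \<mu> \<nu>)))) \<partial>thinning_kernel q \<mu>)
    = ennreal (exp (- (\<integral>x. mixture q f g x \<partial>\<mu>)))"
proof -
  let ?h = "\<lambda>x. f x - g x"
  let ?m = "multiplicity_at \<mu>"
  have \<mu>_lf: "\<nu> \<in> locally_finite_measures" if "\<nu> \<in> point_measures" for \<nu> :: "'a measure"
    using that by (simp add: point_measures_def)
  have h: "?h \<in> bounded_support_functions" by (rule bounded_support_diff[OF f g])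
  define A where "A = atoms \<mu> \<inter> ({x. f x \<noteq> 0} \<union> {x. g x \<noteq> 0})"
  have A: "finite A"
    unfolding A_def using f g by (intro finite_atoms_bounded \<mu>) (auto simp: bounded_support_functions_def)
  have mix: "mixture q f g x = 0" if "f x = 0" "g x = 0" for x
    using that by (simp add: mixture_def)
  have "(\<integral>\<^sup>+\<nu>. ennreal (exp (- ((\<integral>x. f x \<partial>\<nu>) + (\<integral>x. g x \<partial>point_measure_diff \<mu> \<nu>)))) \<partial>thinning_kernel q \<mu>)
    = (\<integral>\<^sup>+\<nu>. ennreal (exp (- (\<integral>x. g x \<partial>\<mu>))) * ennreal (exp (- (\<integral>x. ?h x \<partial>\<nu>))) \<partial>thinning_kernel q \<mu>)"
  proof (rule nn_integral_cong_AE)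
    show "AE \<nu> in thinning_kernel q \<mu>.
        ennreal (exp (- ((\<integral>x. f x \<partial>\<nu>) + (\<integral>x. g x \<partial>point_measure_diff \<mu> \<nu>)))) =
        ennreal (exp (- (\<integral>x. g x \<partial>\<mu>))) * ennreal (exp (- (\<integral>x. ?h x \<partial>\<nu>)))"
      using AE_thinning_kernel[OF \<mu>]
    proof eventually_elim
      fix \<nu> assume \<nu>: "\<nu> \<in> dominated \<mu>"
      then have lf: "\<nu> \<in> locally_finite_measures" using \<mu>_lf by (simp add: dominated_def)
      have "(\<integral>x. ?h x \<partial>\<nu>) = (\<integral>x. f x \<partial>\<nu>) - (\<integral>x. g x \<partial>\<nu>)"
        using f g lf by (intro Bochner_Integration.integral_diff bounded_support_integrable)
      then show "ennreal (exp (- ((\<integral>x. f x \<partial>\<nu>) + (\<integral>x. g x \<partial>point_measure_diff \<mu> \<nu>)))) =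
        ennreal (exp (- (\<integral>x. g x \<partial>\<mu>))) * ennreal (exp (- (\<integral>x. ?h x \<partial>\<nu>)))"
        by (simp add: integral_point_measure_diff[OF \<mu> \<nu> g] algebra_simps
            flip: ennreal_mult exp_add)
    qed
  qed
  also have "\<dots> = ennreal (exp (- (\<integral>x. g x \<partial>\<mu>))) *
      (\<integral>\<^sup>+\<nu>. ennreal (exp (- (\<integral>x. ?h x \<partial>\<nu>))) \<partial>thinning_kernel q \<mu>)"
  proof (rule nn_integral_cmult)
    show "(\<lambda>\<nu>. ennreal (exp (- (\<integral>x. ?h x \<partial>\<nu>)))) \<in> borel_measurable (thinning_kernel q \<mu>)"
      using borel_measurable_PM_laplace[OF h]
      by (simp only: measurable_cong_sets[OF sets_thinning_kernel refl])
  qed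
  also have "\<dots> = ennreal (exp (- (\<Sum>x\<in>A. measure \<mu> {x} * g x))) *
      ennreal (\<Prod>x\<in>A. (q * exp (- ?h x) + (1 - q)) ^ ?m x)"
  proof -
    have "(\<integral>x. g x \<partial>\<mu>) = (\<Sum>x\<in>A. measure \<mu> {x} * g x)"
      by (rule integral_point_measure[OF g \<mu> A]) (auto simp: A_def)
    moreover have "(\<integral>\<^sup>+\<nu>. ennreal (exp (- (\<integral>x. ?h x \<partial>\<nu>))) \<partial>thinning_kernel q \<mu>) =
        ennreal (\<Prod>x\<in>A. (q * exp (- ?h x) + (1 - q)) ^ ?m x)"
      by (rule laplace_thinning_kernel[OF \<mu> h q A]) (auto simp: A_def)
    ultimately show ?thesis by (simp only:)
  qed
  also have "\<dots> = ennreal (\<Prod>x\<in>A. exp (- g x) ^ ?m x * (q * exp (- ?h x) + (1 - q)) ^ ?m x)"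
    using A q
    by (subst ennreal_mult[symmetric])
       (auto simp: prod.distrib exp_sum multiplicity_at(2)[OF \<mu>] exp_of_nat_mult[symmetric]
          intro!: prod_nonneg simp flip: sum_negf)
  also have "(\<Prod>x\<in>A. exp (- g x) ^ ?m x * (q * exp (- ?h x) + (1 - q)) ^ ?m x) =
      (\<Prod>x\<in>A. exp (- mixture q f g x) ^ ?m x)"
  proof (rule prod.cong)
    fix x
    have "exp (- g x) * (q * exp (- ?h x) + (1 - q)) = exp (- mixture q f g x)"
      unfolding exp_mixture[OF q] by (simp add: exp_diff exp_minus field_simps)
    then show "exp (- g x) ^ ?m x * (q * exp (- ?h x) + (1 - q)) ^ ?m x = exp (- mixture q f g x) ^ ?m x"
      by (simp flip: power_mult_distrib)
  qed simp
  also have "\<dots> = exp (- (\<Sum>x\<in>A. measure \<mu> {x} * mixture q f g x))"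
    using A by (simp add: exp_sum multiplicity_at(2)[OF \<mu>] exp_of_nat_mult[symmetric] flip: sum_negf)
  also have "(\<Sum>x\<in>A. measure \<mu> {x} * mixture q f g x) = (\<integral>x. mixture q f g x \<partial>\<mu>)"
    using mix by (intro integral_point_measure[symmetric] mixture_bounded_support f g q \<mu> A)
      (auto simp: A_def)
  finally show ?thesis .
qed

section \<open>Laplace functionals of pairs of point measures\<close>

text \<open>The indicator of \<open>F i = k\<close> is the limit of \<open>exp (n k) * exp (- n F i)\<close> once the
  contribution of the values below \<open>k\<close> is subtracted.\<close>

lemma bounded_limit_class_indicator:
  fixes H E :: "('b \<Rightarrow> real) set" and F :: "'i \<Rightarrow> 'b \<Rightarrow> nat"
  assumes lin: "\<And>a b u v. u \<in> H \<Longrightarrow> v \<in> H \<Longrightarrow> (\<lambda>x. a * u x + b * v x) \<in> H"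
    and lim: "\<And>U v. (\<And>n. U n \<in> H) \<Longrightarrow> (\<And>n x. \<bar>U n x\<bar> \<le> 1) \<Longrightarrow>
      (\<And>x. (\<lambda>n::nat. U n x) \<longlonglongrightarrow> v x) \<Longrightarrow> v \<in> H"
    and E_exp: "\<And>\<phi>. \<phi> \<in> E \<Longrightarrow> (\<lambda>x. exp (- \<phi> x)) \<in> H"
    and E_nonneg: "\<And>\<phi> x. \<phi> \<in> E \<Longrightarrow> 0 \<le> \<phi> x"
    and E_add: "\<And>\<phi> i n. \<phi> \<in> E \<Longrightarrow> i \<in> I \<Longrightarrow> (\<lambda>x. \<phi> x + real n * real (F i x)) \<in> E"
    and J: "finite J" "J \<subseteq> I \<times> UNIV" and \<phi>: "\<phi> \<in> E"
  shows "(\<lambda>x. of_bool (\<forall>(i, k)\<in>J. F i x = k) * exp (- \<phi> x)) \<in> H"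
  using J \<phi>
\<comment> \<open>\<open>\<phi>\<close> stays free because the step applies the hypothesis to
  \<open>\<phi>\<close> plus a multiple of the new count.\<close>
proof (induction J arbitrary: \<phi> rule: finite_induct)
  case empty
  then show ?case using E_exp by simp
next
  case (insert p J)
  obtain i m where p: "p = (i, m)" by (cases p)
  have i: "i \<in> I" using insert.prems p by auto
  define Y :: "'b \<Rightarrow> real" where "Y x = of_bool (\<forall>(i, k)\<in>J. F i x = k)" for x
  have Y: "0 \<le> Y x" "Y x \<le> 1" for x by (auto simp: Y_def)
  have IH: "(\<lambda>x. Y x * exp (- \<psi> x)) \<in> H" if "\<psi> \<in> E" for \<psi>
    using insert.IH[OF _ that] insert.prems unfolding Y_def by auto
  have zero: "(\<lambda>x. 0) \<in> H" using lin[OF E_exp[OF \<open>\<phi> \<in> E\<close>] E_exp[OF \<open>\<phi> \<in> E\<close>], of 0 0] by simp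
  have sum: "(\<lambda>x. \<Sum>j\<in>S. c j * u j x) \<in> H" if "finite S" "\<And>j. j \<in> S \<Longrightarrow> u j \<in> H"
    for S :: "nat set" and c u
    using that
  proof (induction S rule: finite_induct)
    case (insert j S)
    then show ?case using lin[of "u j" "\<lambda>x. \<Sum>j\<in>S. c j * u j x" "c j" 1] by simp
  qed (simp add: zero)
  have "(\<lambda>x. of_bool (F i x = m) * Y x * exp (- \<phi> x)) \<in> H"
    using \<open>\<phi> \<in> E\<close>
  proof (induction m arbitrary: \<phi> rule: less_induct)
    case (less m)
    \<comment> \<open>The pieces combined into \<open>U n\<close> grow with \<open>n\<close>, which
      linearity tolerates. The bound 1 demanded by \<open>lim\<close> holds for \<open>U n\<close>
      itself, where the values below \<open>m\<close> have been removed; they are available by the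
      induction on \<open>m\<close>.\<close>
    define U where "U n x = (if m \<le> F i x then exp (- (real n * real (F i x - m))) else 0) *
      (Y x * exp (- \<phi> x))" for n :: nat and x
    show ?case
    proof (rule lim[of U])
      fix n
      have "(\<lambda>x. exp (real n * real m) * (Y x * exp (- (\<phi> x + real n * real (F i x)))) +
         - 1 * (\<Sum>j\<in>{..<m}. exp (real n * real (m - j)) * (of_bool (F i x = j) * Y x * exp (- \<phi> x)))) \<in> H"
        using less by (intro lin IH sum E_add i) auto
      also have "(\<lambda>x. exp (real n * real m) * (Y x * exp (- (\<phi> x + real n * real (F i x)))) +
         - 1 * (\<Sum>j\<in>{..<m}. exp (real n * real (m - j)) * (of_bool (F i x = j) * Y x * exp (- \<phi> x)))) = U n"
      proof
        fix x
        have s: "(\<Sum>j\<in>{..<m}. exp (real n * real (m - j)) * (of_bool (F i x = j) * Y x * exp (- \<phi> x))) =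
          (if F i x < m then exp (real n * real (m - F i x)) * (Y x * exp (- \<phi> x)) else 0)"
        proof -
          have "(\<Sum>j\<in>{..<m}. exp (real n * real (m - j)) * (of_bool (F i x = j) * Y x * exp (- \<phi> x))) =
            (\<Sum>j\<in>{..<m}. if j = F i x then exp (real n * real (m - j)) * (Y x * exp (- \<phi> x)) else 0)"
            by (intro sum.cong) auto
          then show ?thesis by simp
        qed
        have e: "exp (real n * real m) * (Y x * exp (- (\<phi> x + real n * real (F i x)))) =
            exp (real n * (real m - real (F i x))) * (Y x * exp (- \<phi> x))"
          by (simp add: exp_diff exp_minus exp_add field_simps)
        show "exp (real n * real m) * (Y x * exp (- (\<phi> x + real n * real (F i x)))) +
          - 1 * (\<Sum>j\<in>{..<m}. exp (real n * real (m - j)) * (of_bool (F i x = j) * Y x * exp (- \<phi> x))) = U n x"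
          unfolding s e U_def by (auto simp: of_nat_diff algebra_simps not_less)
      qed
      finally show "U n \<in> H" .
    next
      fix n x
      have "exp (- \<phi> x) \<le> 1" using E_nonneg[OF less.prems] by simp
      then have "Y x * exp (- \<phi> x) \<le> 1" "0 \<le> Y x * exp (- \<phi> x)"
        using Y[of x] by (auto intro: mult_le_one)
      moreover have "\<bar>U n x\<bar> = (if m \<le> F i x then exp (- (real n * real (F i x - m))) else 0) *
          (Y x * exp (- \<phi> x))"
        using Y[of x] by (simp add: U_def abs_mult)
      ultimately show "\<bar>U n x\<bar> \<le> 1"
        using mult_le_one[of "exp (- (real n * real (F i x - m)))" "Y x * exp (- \<phi> x)"]
        by (cases "m \<le> F i x") simp_all
    next
      fix x
      consider "F i x < m" | "F i x = m" | "m < F i x" by linarith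
      then show "(\<lambda>n. U n x) \<longlonglongrightarrow> of_bool (F i x = m) * Y x * exp (- \<phi> x)"
      proof cases
        case 3
        define r where "r = exp (- real (F i x - m))"
        have r: "0 \<le> r" "r < 1" using 3 by (auto simp: r_def)
        have "U n x = r ^ n * (Y x * exp (- \<phi> x))" for n
          using 3 by (simp add: U_def r_def of_nat_diff flip: exp_of_nat_mult)
            (simp add: algebra_simps)
        moreover have "(\<lambda>n. r ^ n * (Y x * exp (- \<phi> x))) \<longlonglongrightarrow> 0 * (Y x * exp (- \<phi> x))"
          using r by (intro tendsto_mult LIMSEQ_power_zero tendsto_const) auto
        ultimately show ?thesis using 3 by simp
      qed (simp_all add: U_def)
    qed
  qed
  moreover have "of_bool (\<forall>(i, k)\<in>insert p J. F i x = k) = of_bool (F i x = m) * Y x" for x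
    by (auto simp: p Y_def)
  ultimately show ?case by simp
qed

section \<open>Count cylinders and Laplace functionals on pairs of point measures\<close>

definition nonneg_tests :: "('a::polish_space \<Rightarrow> real) set" where
  "nonneg_tests = {f \<in> bounded_support_functions. \<forall>x. 0 \<le> f x}"

definition pair_laplace ::
    "('a::polish_space \<Rightarrow> real) \<Rightarrow> ('a \<Rightarrow> real) \<Rightarrow> 'a measure \<times> 'a measure \<Rightarrow> real" where
  "pair_laplace f g p = exp (- ((\<integral>x. f x \<partial>fst p) + (\<integral>x. g x \<partial>snd p)))"

text \<open>The Boolean selects the component. On pairs of point measures and bounded Borel sets the
  rounding loses nothing; it supplies the natural number that the limit argument for indicators
  works with.\<close>

definition pair_count :: "bool \<times> 'a::polish_space set \<Rightarrow> 'a measure \<times> 'a measure \<Rightarrow> nat" where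
  "pair_count i p = nat \<lfloor>measure (if fst i then fst p else snd p) (snd i)\<rfloor>"

definition count_index :: "(bool \<times> 'a::polish_space set) set" where
  "count_index = UNIV \<times> {B. B \<in> sets borel \<and> bounded B}"

definition count_cylinder ::
    "((bool \<times> 'a::polish_space set) \<times> nat) set \<Rightarrow> ('a measure \<times> 'a measure) set" where
  "count_cylinder J = {p \<in> point_measures \<times> point_measures. \<forall>(i, k)\<in>J. pair_count i p = k}"

definition count_cylinders :: "('a::polish_space measure \<times> 'a measure) set set" where
  "count_cylinders = count_cylinder ` {J. finite J \<and> J \<subseteq> count_index \<times> UNIV}"

lemma space_PM_pair: "space (PM \<Otimes>\<^sub>M PM) = point_measures \<times> point_measures"
  by (simp add: space_pair_measure space_PM)

text \<open>Adding a multiple of a count to the exponent of a Laplace functional amounts to changing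
  its test function, which gives the closure of exponents demanded by
  \<open>bounded_limit_class_indicator\<close>.\<close>

lemma nonneg_tests_add_indicator:
  assumes f: "f \<in> nonneg_tests" and B: "B \<in> sets borel" "bounded B" and c: "0 \<le> c"
  shows "(\<lambda>x. f x + c * indicator B x) \<in> nonneg_tests"
    and "\<mu> \<in> point_measures \<Longrightarrow>
      (\<integral>x. f x + c * indicator B x \<partial>\<mu>) = (\<integral>x. f x \<partial>\<mu>) + c * measure \<mu> B"
proof -
  have fbs: "f \<in> bounded_support_functions" using f by (simp add: nonneg_tests_def)
  obtain d where d: "0 \<le> d" "\<forall>x. \<bar>f x\<bar> \<le> d" by (rule bounded_support_bound[OF fbs])
  have "(\<lambda>x. f x + c * indicator B x) \<in> bounded_support_functions"
  proof (rule bounded_support_functionsI[where c="d + c" and S="{x. f x \<noteq> 0} \<union> B"])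
    show "\<bar>f x + c * indicator B x\<bar> \<le> d + c" for x
      using d(2)[rule_format, of x] c by (auto split: split_indicator)
    show "(\<lambda>x. f x + c * indicator B x) \<in> borel_measurable borel"
      using B fbs by (auto simp: bounded_support_functions_def)
  qed (use fbs B in \<open>auto simp: bounded_support_functions_def\<close>)
  then show "(\<lambda>x. f x + c * indicator B x) \<in> nonneg_tests"
    using f c by (simp add: nonneg_tests_def)
  assume \<mu>: "\<mu> \<in> point_measures"
  have "integrable \<mu> (indicator B :: 'a \<Rightarrow> real)"
    using B point_measures_finite[OF \<mu> B]
    by (intro integrable_real_indicator) (auto simp: point_measures_sets[OF \<mu>])
  moreover have "integrable \<mu> f"
    using \<mu> by (intro bounded_support_integrable fbs) (simp add: point_measures_def)
  ultimately show "(\<integral>x. f x + c * indicator B x \<partial>\<mu>) = (\<integral>x. f x \<partial>\<mu>) + c * measure \<mu> B"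
    by (simp add: point_measures_space[OF \<mu>])
qed

text \<open>A functional monotone class argument that starts from Laplace functionals. It is applied
  with \<open>H\<close> expressing equality of two integrals, and with \<open>H\<close> expressing
  measurability of an integral in a parameter. The hypothesis \<open>cong\<close> absorbs the fact
  that counts and integrals are tied together only on point measures.\<close>

lemma pair_class_cylinder:
  fixes H :: "('a::polish_space measure \<times> 'a measure \<Rightarrow> real) set"
  assumes lin: "\<And>a b u v. u \<in> H \<Longrightarrow> v \<in> H \<Longrightarrow> (\<lambda>x. a * u x + b * v x) \<in> H"
    and lim: "\<And>U v. (\<And>n. U n \<in> H) \<Longrightarrow> (\<And>n x. \<bar>U n x\<bar> \<le> 1) \<Longrightarrow>
      (\<And>x. (\<lambda>n::nat. U n x) \<longlonglongrightarrow> v x) \<Longrightarrow> v \<in> H"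
    and cong: "\<And>u v. u \<in> H \<Longrightarrow> (\<And>p. p \<in> space (PM \<Otimes>\<^sub>M PM) \<Longrightarrow> u p = v p) \<Longrightarrow>
      (\<And>p. \<bar>v p\<bar> \<le> 1) \<Longrightarrow> v \<in> H"
    and laplace: "\<And>f g. f \<in> nonneg_tests \<Longrightarrow> g \<in> nonneg_tests \<Longrightarrow> pair_laplace f g \<in> H"
    and X: "X \<in> count_cylinders"
  shows "indicator X \<in> H"
proof -
  obtain J where J: "finite J" "J \<subseteq> count_index \<times> UNIV" and X_eq: "X = count_cylinder J"
    using X by (auto simp: count_cylinders_def)
  \<comment> \<open>Exponents are tied to test functions only on pairs of point measures, but are
    nonnegative everywhere, because the limit argument bounds \<open>exp (- \<phi> p)\<close> at
    every \<open>p\<close>.\<close>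
  define E where "E = {\<phi>. (\<forall>p. 0 \<le> \<phi> p) \<and> (\<exists>f\<in>nonneg_tests. \<exists>g\<in>nonneg_tests.
    \<forall>p\<in>space (PM \<Otimes>\<^sub>M PM :: ('a measure \<times> 'a measure) measure).
      \<phi> p = (\<integral>x. f x \<partial>fst p) + (\<integral>x. g x \<partial>snd p))}"
  have zero: "(\<lambda>_. 0) \<in> nonneg_tests"
    by (simp add: nonneg_tests_def bounded_support_functions_def)
  have "(\<lambda>p. of_bool (\<forall>(i, k)\<in>J. pair_count i p = k) * exp (- 0)) \<in> H"
  proof (rule bounded_limit_class_indicator[where E=E and I=count_index, OF lin lim _ _ _ J])
    fix \<phi> assume "\<phi> \<in> E"
    then obtain f g where fg: "f \<in> nonneg_tests" "g \<in> nonneg_tests"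
      and \<phi>: "\<And>p. 0 \<le> \<phi> p" "\<And>p. p \<in> space (PM \<Otimes>\<^sub>M PM) \<Longrightarrow> \<phi> p = (\<integral>x. f x \<partial>fst p) + (\<integral>x. g x \<partial>snd p)"
      by (auto simp: E_def)
    show "(\<lambda>x. exp (- \<phi> x)) \<in> H"
      using laplace[OF fg] by (rule cong) (auto simp: pair_laplace_def \<phi>)
    show "0 \<le> \<phi> x" for x by (rule \<phi>(1))
    fix i :: "bool \<times> 'a set" and n :: nat assume i: "i \<in> count_index"
    obtain b B where bB: "i = (b, B)" "B \<in> sets borel" "bounded B"
      using i by (auto simp: count_index_def)
    define f' where "f' x = f x + (if b then real n else 0) * indicator B x" for x
    define g' where "g' x = g x + (if b then 0 else real n) * indicator B x" for x
    have "f' \<in> nonneg_tests" "g' \<in> nonneg_tests"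
      unfolding f'_def g'_def using bB by (auto intro!: nonneg_tests_add_indicator fg)
    moreover have "\<phi> p + real n * real (pair_count i p) = (\<integral>x. f' x \<partial>fst p) + (\<integral>x. g' x \<partial>snd p)"
      if p: "p \<in> space (PM \<Otimes>\<^sub>M PM)" for p
    proof -
      have pm: "fst p \<in> point_measures" "snd p \<in> point_measures"
        using p by (auto simp: space_PM_pair)
      have "(\<integral>x. f' x \<partial>fst p) = (\<integral>x. f x \<partial>fst p) + (if b then real n else 0) * measure (fst p) B"
        unfolding f'_def using bB pm by (intro nonneg_tests_add_indicator fg) auto
      moreover have "(\<integral>x. g' x \<partial>snd p) = (\<integral>x. g x \<partial>snd p) + (if b then 0 else real n) * measure (snd p) B"
        unfolding g'_def using bB pm by (intro nonneg_tests_add_indicator fg) auto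
      ultimately show ?thesis
        using \<phi>(2)[OF p] emeasure_count(2)[OF pm(1) bB(2,3)] emeasure_count(2)[OF pm(2) bB(2,3)]
        by (simp add: pair_count_def bB(1))
    qed
    ultimately show "(\<lambda>x. \<phi> x + real n * real (pair_count i x)) \<in> E"
      unfolding E_def using \<phi>(1) by fastforce
  next
    \<comment> \<open>The zero exponent removes the exponential factor and leaves the bare
      indicator.\<close>
    show "(\<lambda>p. 0) \<in> E" using zero by (auto simp: E_def intro!: bexI[of _ "\<lambda>_. 0"])
  qed
  then show ?thesis
    by (rule cong) (auto simp: X_eq count_cylinder_def space_PM_pair indicator_def)
qed

lemma count_cylinders_subset: "count_cylinders \<subseteq> Pow (point_measures \<times> point_measures)"
  unfolding count_cylinders_def count_cylinder_def by blast

lemma Int_stable_count_cylinders: "Int_stable count_cylinders"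
proof (rule Int_stableI)
  fix X Y :: "('a measure \<times> 'a measure) set"
  assume "X \<in> count_cylinders" "Y \<in> count_cylinders"
  then obtain J K where "finite J" "J \<subseteq> count_index \<times> UNIV" "finite K" "K \<subseteq> count_index \<times> UNIV"
    "X = count_cylinder J" "Y = count_cylinder K"
    by (auto simp: count_cylinders_def)
  moreover have "count_cylinder J \<inter> count_cylinder K = count_cylinder (J \<union> K)"
    by (rule set_eqI) (simp add: count_cylinder_def ball_Un conj_ac)
  ultimately show "X \<inter> Y \<in> count_cylinders"
    unfolding count_cylinders_def by (intro image_eqI[of _ _ "J \<union> K"]) auto
qed

lemma space_count_cylinder: "point_measures \<times> point_measures \<in> count_cylinders"
  unfolding count_cylinders_def by (intro image_eqI[of _ _ "{}"]) (auto simp: count_cylinder_def)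

lemma pair_count_eq_iff:
  assumes "p \<in> point_measures \<times> point_measures" "B \<in> sets borel" "bounded B"
  shows "pair_count (b, B) p = k \<longleftrightarrow> emeasure (if b then fst p else snd p) B = of_nat k"
proof -
  have "(if b then fst p else snd p) \<in> point_measures" using assms(1) by auto
  from emeasure_count(1)[OF this assms(2,3)]
  have "emeasure (if b then fst p else snd p) B = of_nat (pair_count (b, B) p)"
    by (simp only: pair_count_def fst_conv snd_conv)
  then show ?thesis by (simp only: of_nat_eq_iff)
qed

text \<open>One inclusion is the measurability of counts. For the other, both projections are
  measurable from the sigma-algebra of the cylinders into \<open>PM\<close>, since
  \<open>measurable_PMI\<close> asks for counts only; hence so is the identity map into the
  product.\<close>

lemma sets_PM_pair:
  "sets (PM \<Otimes>\<^sub>M PM :: ('a::polish_space measure \<times> 'a measure) measure) =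
    sigma_sets (point_measures \<times> point_measures) count_cylinders"
proof
  let ?P = "PM \<Otimes>\<^sub>M PM :: ('a measure \<times> 'a measure) measure"
  let ?\<Omega> = "point_measures \<times> point_measures :: ('a measure \<times> 'a measure) set"
  let ?G = "count_cylinders :: ('a measure \<times> 'a measure) set set"
  note sub = count_cylinders_subset[where 'a='a]
  have meas: "(\<lambda>p. emeasure (if b then fst p else snd p) B) \<in> borel_measurable ?P"
    if "B \<in> sets borel" for b B
  proof (cases b)
    case True
    from measurable_compose[OF measurable_fst borel_measurable_PM_emeasure[OF that]] True
    show ?thesis by (simp only: if_True)
  next
    case False
    from measurable_compose[OF measurable_snd borel_measurable_PM_emeasure[OF that]] False
    show ?thesis by (simp only: if_False)
  qed
  have "X \<in> sets ?P" if mem: "X \<in> ?G" for X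
  proof -
    obtain J where J: "finite J" "J \<subseteq> count_index \<times> UNIV" and X: "X = count_cylinder J"
      using mem unfolding count_cylinders_def by blast
    have "{p \<in> space ?P. \<forall>j\<in>J. pair_count (fst j) p = snd j} \<in> sets ?P"
    proof (rule sets.sets_Collect_finite_All[OF _ J(1)])
      fix j assume j: "j \<in> J"
      obtain b B where bB: "fst j = (b, B)" "B \<in> sets borel" "bounded B"
        using subsetD[OF J(2) j] unfolding count_index_def by (metis mem_Collect_eq mem_Sigma_iff prod.collapse)
      have "{p \<in> space ?P. pair_count (fst j) p = snd j} =
          (\<lambda>p. emeasure (if b then fst p else snd p) B) -` {of_nat (snd j)} \<inter> space ?P"
        unfolding space_PM_pair bB(1) using pair_count_eq_iff[OF _ bB(2,3), of _ b "snd j"] by blast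
      also have "\<dots> \<in> sets ?P" by (rule measurable_sets[OF meas[OF bB(2)]]) simp
      finally show "{p \<in> space ?P. pair_count (fst j) p = snd j} \<in> sets ?P" .
    qed
    also have "{p \<in> space ?P. \<forall>j\<in>J. pair_count (fst j) p = snd j} = X"
      by (auto simp: X count_cylinder_def space_PM_pair)
    finally show ?thesis .
  qed
  then show "sigma_sets ?\<Omega> ?G \<subseteq> sets ?P"
    using sets.sigma_sets_subset[of ?G ?P] by (simp add: space_PM_pair subset_eq)
  let ?S = "sigma ?\<Omega> ?G"
  have S: "space ?S = ?\<Omega>" "sets ?S = sigma_sets ?\<Omega> ?G"
    using sub by (auto simp: space_measure_of)
  have comp: "(\<lambda>p. if b then fst p else snd p) \<in> measurable ?S PM" for b
  proof (rule measurable_PMI)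
    fix B :: "'a set" assume B: "B \<in> sets borel" "bounded B"
    have "pair_count (b, B) \<in> measurable ?S (count_space UNIV)"
    proof (rule measurableI)
      fix K :: "nat set"
      have "pair_count (b, B) -` {k} \<inter> space ?S \<in> sets ?S" for k
      proof -
        have "count_cylinder {((b, B), k)} \<in> ?G"
          using B by (auto simp: count_cylinders_def count_index_def)
        moreover have "pair_count (b, B) -` {k} \<inter> space ?S = count_cylinder {((b, B), k)}"
          by (auto simp: count_cylinder_def S(1))
        ultimately show ?thesis by (auto simp: S(2))
      qed
      then have "(\<Union>k\<in>K. pair_count (b, B) -` {k} \<inter> space ?S) \<in> sets ?S"
        by (intro sets.countable_UN') auto
      also have "(\<Union>k\<in>K. pair_count (b, B) -` {k} \<inter> space ?S) = pair_count (b, B) -` K \<inter> space ?S"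
        by auto
      finally show "pair_count (b, B) -` K \<inter> space ?S \<in> sets ?S" .
    qed auto
    then have "(\<lambda>p. of_nat (pair_count (b, B) p) :: ennreal) \<in> borel_measurable ?S"
      by (rule measurable_compose) auto
    then show "(\<lambda>p. emeasure (if b then fst p else snd p) B) \<in> borel_measurable ?S"
    proof (subst measurable_cong)
      fix p assume "p \<in> space ?S"
      then have "p \<in> ?\<Omega>" by (simp add: S(1))
      from pair_count_eq_iff[OF this B, of b]
      show "emeasure (if b then fst p else snd p) B = of_nat (pair_count (b, B) p)" by blast
    qed
  qed (auto simp: S(1))
  have "(\<lambda>p. p) \<in> measurable ?S ?P"
    using measurable_Pair[OF comp[of True] comp[of False]] by simp
  then have "A \<inter> ?\<Omega> \<in> sigma_sets ?\<Omega> ?G" if "A \<in> sets ?P" for A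
    using measurable_sets[OF _ that, of "\<lambda>p. p" ?S] by (simp add: S)
  moreover have "A \<inter> ?\<Omega> = A" if "A \<in> sets ?P" for A
    using sets.sets_into_space[OF that] by (auto simp: space_PM_pair)
  ultimately show "sets ?P \<subseteq> sigma_sets ?\<Omega> ?G" by auto
qed

lemma pair_laplace_measurable:
  assumes "f \<in> bounded_support_functions" "g \<in> bounded_support_functions"
  shows "pair_laplace f g \<in> borel_measurable (PM \<Otimes>\<^sub>M PM)"
proof -
  note [measurable] = borel_measurable_PM_integral[OF assms(1)] borel_measurable_PM_integral[OF assms(2)]
  show ?thesis unfolding pair_laplace_def by measurable
qed

lemma pair_laplace_le_1:
  assumes "f \<in> nonneg_tests" "g \<in> nonneg_tests"
  shows "pair_laplace f g p \<le> 1"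
proof -
  have "0 \<le> (\<integral>x. f x \<partial>fst p)" "0 \<le> (\<integral>x. g x \<partial>snd p)"
    using assms by (auto simp: nonneg_tests_def intro!: integral_nonneg)
  then show ?thesis by (simp add: pair_laplace_def)
qed

definition bounded_pair_functions :: "('a::polish_space measure \<times> 'a measure \<Rightarrow> real) set" where
  "bounded_pair_functions = {u \<in> borel_measurable (PM \<Otimes>\<^sub>M PM). \<exists>c. \<forall>p. \<bar>u p\<bar> \<le> c}"

lemma bounded_pair_integrable:
  assumes u: "u \<in> bounded_pair_functions" and M: "prob_space M" "sets M = sets (PM \<Otimes>\<^sub>M PM)"
  shows "integrable M u"
proof -
  interpret prob_space M by fact
  obtain c where "\<forall>p. \<bar>u p\<bar> \<le> c" using u by (auto simp: bounded_pair_functions_def)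
  moreover have "u \<in> borel_measurable M"
    using u by (simp add: bounded_pair_functions_def measurable_cong_sets[OF M(2) refl])
  ultimately show ?thesis by (intro integrable_const_bound[of _ c]) auto
qed

text \<open>These are the closure properties asked of \<open>H\<close> in
  \<open>pair_class_cylinder\<close>, apart from the condition on integrals that each application
  adds.\<close>

lemma bounded_pair_closure:
  shows "u \<in> bounded_pair_functions \<Longrightarrow> v \<in> bounded_pair_functions \<Longrightarrow>
      (\<lambda>p. a * u p + b * v p) \<in> bounded_pair_functions"
    and "(\<And>n::nat. U n \<in> bounded_pair_functions) \<Longrightarrow> (\<And>n p. \<bar>U n p\<bar> \<le> 1) \<Longrightarrow>
      (\<And>p. (\<lambda>n. U n p) \<longlonglongrightarrow> v p) \<Longrightarrow> v \<in> bounded_pair_functions"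
    and "u \<in> bounded_pair_functions \<Longrightarrow> (\<And>p. p \<in> space (PM \<Otimes>\<^sub>M PM) \<Longrightarrow> u p = v p) \<Longrightarrow>
      (\<And>p. \<bar>v p\<bar> \<le> 1) \<Longrightarrow> v \<in> bounded_pair_functions"
    and "f \<in> nonneg_tests \<Longrightarrow> g \<in> nonneg_tests \<Longrightarrow> pair_laplace f g \<in> bounded_pair_functions"
proof -
  assume "u \<in> bounded_pair_functions" "v \<in> bounded_pair_functions"
  then obtain c d where u: "u \<in> borel_measurable (PM \<Otimes>\<^sub>M PM)" "\<And>p. \<bar>u p\<bar> \<le> c"
    and v: "v \<in> borel_measurable (PM \<Otimes>\<^sub>M PM)" "\<And>p. \<bar>v p\<bar> \<le> d"
    by (auto simp: bounded_pair_functions_def)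
  have "\<bar>a * u p + b * v p\<bar> \<le> \<bar>a\<bar> * c + \<bar>b\<bar> * d" for p
  proof -
    have "\<bar>a * u p + b * v p\<bar> \<le> \<bar>a\<bar> * \<bar>u p\<bar> + \<bar>b\<bar> * \<bar>v p\<bar>"
      by (metis abs_mult abs_triangle_ineq)
    also have "\<dots> \<le> \<bar>a\<bar> * c + \<bar>b\<bar> * d"
      using u(2)[of p] v(2)[of p] by (intro add_mono mult_left_mono) auto
    finally show ?thesis .
  qed
  then show "(\<lambda>p. a * u p + b * v p) \<in> bounded_pair_functions"
    using u(1) v(1) by (auto simp: bounded_pair_functions_def)
next
  assume U: "\<And>n::nat. U n \<in> bounded_pair_functions" "\<And>n p. \<bar>U n p\<bar> \<le> 1" "\<And>p. (\<lambda>n. U n p) \<longlonglongrightarrow> v p"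
  have "v \<in> borel_measurable (PM \<Otimes>\<^sub>M PM)"
  proof (rule borel_measurable_LIMSEQ_real)
    show "U n \<in> borel_measurable (PM \<Otimes>\<^sub>M PM)" for n
      using U(1)[of n] by (simp add: bounded_pair_functions_def)
  qed (rule U(3))
  moreover have "\<bar>v p\<bar> \<le> 1" for p
    by (rule LIMSEQ_le_const2[OF tendsto_rabs[OF U(3)]]) (use U(2) in auto)
  ultimately show "v \<in> bounded_pair_functions" by (auto simp: bounded_pair_functions_def)
next
  assume "u \<in> bounded_pair_functions" "\<And>p. p \<in> space (PM \<Otimes>\<^sub>M PM) \<Longrightarrow> u p = v p" "\<And>p. \<bar>v p\<bar> \<le> 1"
  then show "v \<in> bounded_pair_functions"
    using measurable_cong[of "PM \<Otimes>\<^sub>M PM" u v borel] by (auto simp: bounded_pair_functions_def)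
next
  assume "f \<in> nonneg_tests" "g \<in> nonneg_tests"
  then show "pair_laplace f g \<in> bounded_pair_functions"
    using pair_laplace_measurable[of f g] pair_laplace_le_1[of f g]
    by (auto simp: bounded_pair_functions_def nonneg_tests_def pair_laplace_def intro!: exI[of _ 1])
qed

text \<open>With \<open>H\<close> the bounded functions that have equal integrals, the two laws
  agree on the count cylinders, an intersection-stable generator containing the whole space.\<close>

lemma pair_measure_eqI_laplace:
  fixes M N :: "('a::polish_space measure \<times> 'a measure) measure"
  assumes M: "prob_space M" "sets M = sets (PM \<Otimes>\<^sub>M PM)"
    and N: "prob_space N" "sets N = sets (PM \<Otimes>\<^sub>M PM)"
    and eq: "\<And>f g. f \<in> nonneg_tests \<Longrightarrow> g \<in> nonneg_tests \<Longrightarrow>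
      (\<integral>\<^sup>+p. ennreal (pair_laplace f g p) \<partial>M) = (\<integral>\<^sup>+p. ennreal (pair_laplace f g p) \<partial>N)"
  shows "M = N"
proof -
  interpret M: prob_space M by fact
  interpret N: prob_space N by fact
  note meas = measurable_cong_sets[OF M(2) refl] measurable_cong_sets[OF N(2) refl]
  define H where "H = {u \<in> bounded_pair_functions. (\<integral>p. u p \<partial>M) = (\<integral>p. u p \<partial>N)}"
  have H: "indicator X \<in> H" if "X \<in> count_cylinders" for X
  proof (rule pair_class_cylinder[OF _ _ _ _ that])
    fix a b u v assume "u \<in> H" "v \<in> H"
    then show "(\<lambda>p. a * u p + b * v p) \<in> H"
      using bounded_pair_integrable[OF _ M] bounded_pair_integrable[OF _ N]
      by (simp add: H_def bounded_pair_closure(1))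
  next
    fix U v assume U: "\<And>n::nat. U n \<in> H" "\<And>n p. \<bar>U n p\<bar> \<le> 1" "\<And>p. (\<lambda>n. U n p) \<longlonglongrightarrow> v p"
    have v: "v \<in> bounded_pair_functions"
      by (rule bounded_pair_closure(2)[OF _ U(2,3)]) (use U(1) in \<open>simp add: H_def\<close>)
    have bm: "U n \<in> borel_measurable (PM \<Otimes>\<^sub>M PM)" "v \<in> borel_measurable (PM \<Otimes>\<^sub>M PM)" for n
      using U(1)[of n] v by (auto simp: H_def bounded_pair_functions_def)
    have "(\<lambda>n. \<integral>p. U n p \<partial>M) \<longlonglongrightarrow> (\<integral>p. v p \<partial>M)"
      by (rule integral_dominated_convergence[where w="\<lambda>_. 1"]) (auto simp: bm meas U)
    moreover have "(\<lambda>n. \<integral>p. U n p \<partial>N) \<longlonglongrightarrow> (\<integral>p. v p \<partial>N)"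
      by (rule integral_dominated_convergence[where w="\<lambda>_. 1"]) (auto simp: bm meas U)
    moreover have "(\<integral>p. U n p \<partial>M) = (\<integral>p. U n p \<partial>N)" for n using U(1) by (simp add: H_def)
    ultimately show "v \<in> H" using v LIMSEQ_unique by (auto simp: H_def)
  next
    fix u v assume u: "u \<in> H" "\<And>p. p \<in> space (PM \<Otimes>\<^sub>M PM) \<Longrightarrow> u p = v p" "\<And>p. \<bar>v p\<bar> \<le> 1"
    have "(\<integral>p. u p \<partial>M) = (\<integral>p. v p \<partial>M)" "(\<integral>p. u p \<partial>N) = (\<integral>p. v p \<partial>N)"
      using u(2) sets_eq_imp_space_eq[OF M(2)] sets_eq_imp_space_eq[OF N(2)]
      by (auto intro!: Bochner_Integration.integral_cong)
    then show "v \<in> H" using u bounded_pair_closure(3)[of u v] by (simp add: H_def)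
  next
    fix f g :: "'a \<Rightarrow> real" assume fg: "f \<in> nonneg_tests" "g \<in> nonneg_tests"
    then have "pair_laplace f g \<in> bounded_pair_functions" by (rule bounded_pair_closure(4))
    then show "pair_laplace f g \<in> H"
      using eq[OF fg] by (auto simp: H_def bounded_pair_functions_def meas pair_laplace_def integral_eq_nn_integral)
  qed
  show ?thesis
  proof (rule measure_eqI_generator_eq[where E=count_cylinders and \<Omega>="point_measures \<times> point_measures"
        and A="\<lambda>_. point_measures \<times> point_measures"])
    fix X :: "('a measure \<times> 'a measure) set" assume X: "X \<in> count_cylinders"
    then have "X \<in> sets (PM \<Otimes>\<^sub>M PM)" by (auto simp: sets_PM_pair)
    then have "X \<in> sets M" "X \<in> sets N" using M N by auto
    moreover have "(\<integral>p. indicator X p \<partial>M) = (\<integral>p. (indicator X p :: real) \<partial>N)"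
      using H[OF X] by (simp add: H_def)
    ultimately show "emeasure M X = emeasure N X"
      by (simp add: M.emeasure_eq_measure N.emeasure_eq_measure)
  qed (use M N count_cylinders_subset in \<open>simp_all add: sets_PM_pair Int_stable_count_cylinders
        space_count_cylinder image_subset_iff M.emeasure_eq_measure\<close>)
qed

text \<open>The same closure argument, with \<open>H\<close> the bounded functions whose integral
  against \<open>K a\<close> is measurable in \<open>a\<close>. Kernel measurability thus follows
  from Laplace functionals alone, whatever the construction of \<open>K a\<close>.\<close>

lemma pair_kernel_measurable:
  fixes K :: "'b \<Rightarrow> ('a::polish_space measure \<times> 'a measure) measure"
  assumes K: "\<And>a. a \<in> space L \<Longrightarrow> prob_space (K a)"
      "\<And>a. a \<in> space L \<Longrightarrow> sets (K a) = sets (PM \<Otimes>\<^sub>M PM)"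
    and meas: "\<And>f g. f \<in> nonneg_tests \<Longrightarrow> g \<in> nonneg_tests \<Longrightarrow>
      (\<lambda>a. \<integral>\<^sup>+p. ennreal (pair_laplace f g p) \<partial>K a) \<in> borel_measurable L"
  shows "K \<in> measurable L (subprob_algebra (PM \<Otimes>\<^sub>M PM))"
proof -
  define H where "H = {u \<in> bounded_pair_functions. (\<lambda>a. \<integral>p. u p \<partial>K a) \<in> borel_measurable L}"
  have H: "indicator X \<in> H" if "X \<in> count_cylinders" for X
  proof (rule pair_class_cylinder[OF _ _ _ _ that])
    fix a b u v assume uv: "u \<in> H" "v \<in> H"
    have "(\<integral>p. a * u p + b * v p \<partial>K x) = a * (\<integral>p. u p \<partial>K x) + b * (\<integral>p. v p \<partial>K x)"
      if "x \<in> space L" for x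
      using uv bounded_pair_integrable[OF _ K(1)[OF that] K(2)[OF that]] by (simp add: H_def)
    then have "(\<lambda>x. \<integral>p. a * u p + b * v p \<partial>K x) \<in> borel_measurable L \<longleftrightarrow>
        (\<lambda>x. a * (\<integral>p. u p \<partial>K x) + b * (\<integral>p. v p \<partial>K x)) \<in> borel_measurable L"
      by (rule measurable_cong)
    then show "(\<lambda>p. a * u p + b * v p) \<in> H"
      using uv by (auto simp: H_def bounded_pair_closure(1))
  next
    fix U v assume U: "\<And>n::nat. U n \<in> H" "\<And>n p. \<bar>U n p\<bar> \<le> 1" "\<And>p. (\<lambda>n. U n p) \<longlonglongrightarrow> v p"
    have v: "v \<in> bounded_pair_functions"
      by (rule bounded_pair_closure(2)[OF _ U(2,3)]) (use U(1) in \<open>simp add: H_def\<close>)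
    have bm: "U n \<in> borel_measurable (PM \<Otimes>\<^sub>M PM)" "v \<in> borel_measurable (PM \<Otimes>\<^sub>M PM)" for n
      using U(1)[of n] v by (auto simp: H_def bounded_pair_functions_def)
    have "(\<lambda>a. \<integral>p. v p \<partial>K a) \<in> borel_measurable L"
    proof (rule borel_measurable_LIMSEQ_real)
      fix a assume a: "a \<in> space L"
      interpret prob_space "K a" by (rule K(1)[OF a])
      show "(\<lambda>n. \<integral>p. U n p \<partial>K a) \<longlonglongrightarrow> (\<integral>p. v p \<partial>K a)"
        by (rule integral_dominated_convergence[where w="\<lambda>_. 1"])
           (auto simp: bm measurable_cong_sets[OF K(2)[OF a] refl] U)
    qed (use U(1) in \<open>simp add: H_def\<close>)
    with v show "v \<in> H" by (simp add: H_def)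
  next
    fix u v assume u: "u \<in> H" "\<And>p. p \<in> space (PM \<Otimes>\<^sub>M PM) \<Longrightarrow> u p = v p" "\<And>p. \<bar>v p\<bar> \<le> 1"
    have "(\<integral>p. u p \<partial>K a) = (\<integral>p. v p \<partial>K a)" if "a \<in> space L" for a
      using u(2) sets_eq_imp_space_eq[OF K(2)[OF that]]
      by (auto intro!: Bochner_Integration.integral_cong)
    then have "(\<lambda>a. \<integral>p. u p \<partial>K a) \<in> borel_measurable L \<longleftrightarrow> (\<lambda>a. \<integral>p. v p \<partial>K a) \<in> borel_measurable L"
      by (rule measurable_cong)
    then show "v \<in> H" using u bounded_pair_closure(3)[of u v] by (simp add: H_def)
  next
    fix f g :: "'a \<Rightarrow> real" assume fg: "f \<in> nonneg_tests" "g \<in> nonneg_tests"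
    then have l: "pair_laplace f g \<in> bounded_pair_functions" by (rule bounded_pair_closure(4))
    have "(\<integral>p. pair_laplace f g p \<partial>K a) = enn2real (\<integral>\<^sup>+p. ennreal (pair_laplace f g p) \<partial>K a)"
      if "a \<in> space L" for a
    proof (rule integral_eq_nn_integral)
      show "pair_laplace f g \<in> borel_measurable (K a)"
        using l by (simp add: bounded_pair_functions_def measurable_cong_sets[OF K(2)[OF that] refl])
    qed (simp add: pair_laplace_def)
    then have "(\<lambda>a. \<integral>p. pair_laplace f g p \<partial>K a) \<in> borel_measurable L \<longleftrightarrow>
        (\<lambda>a. enn2real (\<integral>\<^sup>+p. ennreal (pair_laplace f g p) \<partial>K a)) \<in> borel_measurable L"
      by (rule measurable_cong)
    then show "pair_laplace f g \<in> H"
      using meas[OF fg] l by (auto simp: H_def)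
  qed
  have G: "(\<lambda>a. emeasure (K a) X) \<in> borel_measurable L" if X: "X \<in> count_cylinders" for X
  proof -
    have X': "X \<in> sets (PM \<Otimes>\<^sub>M PM)" using X by (auto simp: sets_PM_pair)
    have "emeasure (K a) X = ennreal (\<integral>p. indicator X p \<partial>K a)" if "a \<in> space L" for a
    proof -
      interpret prob_space "K a" by (rule K(1)[OF that])
      show ?thesis using X' K(2)[OF that] by (simp add: emeasure_eq_measure)
    qed
    then have "(\<lambda>a. emeasure (K a) X) \<in> borel_measurable L \<longleftrightarrow>
        (\<lambda>a. ennreal (\<integral>p. indicator X p \<partial>K a)) \<in> borel_measurable L"
      by (rule measurable_cong)
    then show ?thesis using H[OF X] by (simp add: H_def)
  qed
  show ?thesis
  proof (rule measurable_subprob_algebra_generated[OF sets_PM_pair Int_stable_count_cylinders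
        count_cylinders_subset _ K(2) G])
    show "subprob_space (K a)" if "a \<in> space L" for a
      by (rule prob_space_imp_subprob_space[OF K(1)[OF that]])
  qed (auto intro: G space_count_cylinder)
qed

section \<open>The splitting law of a point process\<close>

lemma mixture_nonneg_tests:
  assumes "f \<in> nonneg_tests" "g \<in> nonneg_tests" "0 \<le> q" "q \<le> 1"
  shows "mixture q f g \<in> nonneg_tests"
proof -
  have "0 \<le> mixture q f g x" for x
  proof -
    have "q * exp (- f x) + (1 - q) * exp (- g x) \<le> q * 1 + (1 - q) * 1"
      using assms by (intro add_mono mult_left_mono) (auto simp: nonneg_tests_def)
    then have "exp (- mixture q f g x) \<le> 1" unfolding exp_mixture[OF assms(3,4)] by simp
    then show ?thesis by simp
  qed
  then show ?thesis
    using assms mixture_bounded_support[of f g q] by (simp add: nonneg_tests_def)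
qed

lemma zero_nonneg_tests: "(\<lambda>_. 0) \<in> nonneg_tests"
  by (simp add: nonneg_tests_def bounded_support_functions_def)

definition splitting_kernel ::
    "real \<Rightarrow> 'a::polish_space measure \<Rightarrow> ('a measure \<times> 'a measure) measure" where
  "splitting_kernel q \<mu> = distr (thinning_kernel q \<mu>) (PM \<Otimes>\<^sub>M PM) (\<lambda>\<nu>. (\<nu>, point_measure_diff \<mu> \<nu>))"

lemma sets_splitting_kernel: "sets (splitting_kernel q \<mu>) = sets (PM \<Otimes>\<^sub>M PM)"
  by (simp add: splitting_kernel_def)

lemma measurable_split:
  assumes "\<mu> \<in> point_measures"
  shows "(\<lambda>\<nu>. (\<nu>, point_measure_diff \<mu> \<nu>)) \<in> measurable (thinning_kernel q \<mu>) (PM \<Otimes>\<^sub>M PM)"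
  unfolding measurable_cong_sets[OF sets_thinning_kernel refl]
  by (intro measurable_Pair measurable_ident_sets refl measurable_point_measure_diff assms)

lemma prob_space_splitting_kernel:
  assumes "\<mu> \<in> point_measures"
  shows "prob_space (splitting_kernel q \<mu>)"
  unfolding splitting_kernel_def
  by (intro prob_space.prob_space_distr prob_space_thinning_kernel measurable_split assms)

lemma nn_integral_splitting_kernel:
  assumes \<mu>: "\<mu> \<in> point_measures" and fg: "f \<in> bounded_support_functions" "g \<in> bounded_support_functions"
    and q: "0 \<le> q" "q \<le> 1"
  shows "(\<integral>\<^sup>+p. ennreal (pair_laplace f g p) \<partial>splitting_kernel q \<mu>) =
    ennreal (exp (- (\<integral>x. mixture q f g x \<partial>\<mu>)))"
proof -
  have "(\<integral>\<^sup>+p. ennreal (pair_laplace f g p) \<partial>splitting_kernel q \<mu>) =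
    (\<integral>\<^sup>+\<nu>. ennreal (pair_laplace f g (\<nu>, point_measure_diff \<mu> \<nu>)) \<partial>thinning_kernel q \<mu>)"
    unfolding splitting_kernel_def
    by (intro nn_integral_distr measurable_split \<mu>)
      (simp only: measurable_distr_eq1 measurable_compose[OF pair_laplace_measurable[OF fg] measurable_ennreal])
  then show ?thesis
    using laplace_splitting_kernel[OF \<mu> fg q] by (simp add: pair_laplace_def)
qed

text \<open>The index set of the product behind the kernel varies with \<open>\<mu>\<close>, which
  hides the measurability; its Laplace functionals, however, are the explicit measurable functions
  \<open>exp (- (\<integral>x. mixture q f g x \<partial>\<mu>))\<close> of
  \<open>\<mu>\<close>.\<close>

lemma splitting_kernel_measurable:
  assumes q: "0 \<le> q" "q \<le> 1"
  shows "splitting_kernel q \<in> measurable PM (subprob_algebra (PM \<Otimes>\<^sub>M PM))"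
proof (rule pair_kernel_measurable)
  fix f g :: "'a \<Rightarrow> real" assume "f \<in> nonneg_tests" "g \<in> nonneg_tests"
  then have fg: "f \<in> bounded_support_functions" "g \<in> bounded_support_functions"
    by (auto simp: nonneg_tests_def)
  have "(\<lambda>\<mu>. \<integral>\<^sup>+p. ennreal (pair_laplace f g p) \<partial>splitting_kernel q \<mu>) \<in> borel_measurable PM \<longleftrightarrow>
    (\<lambda>\<mu>. ennreal (exp (- (\<integral>x. mixture q f g x \<partial>\<mu>)))) \<in> borel_measurable PM"
    by (rule measurable_cong) (simp add: nn_integral_splitting_kernel[OF _ fg q] space_PM)
  then show "(\<lambda>\<mu>. \<integral>\<^sup>+p. ennreal (pair_laplace f g p) \<partial>splitting_kernel q \<mu>) \<in> borel_measurable PM"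
    using borel_measurable_PM_laplace[OF mixture_bounded_support[OF fg q]] by simp
qed (simp_all add: prob_space_splitting_kernel sets_splitting_kernel space_PM)

text \<open>Lets the thinning kernel inherit measurability from the splitting kernel.\<close>

lemma thinning_kernel_marginal:
  assumes "\<mu> \<in> point_measures"
  shows "thinning_kernel q \<mu> = distr (splitting_kernel q \<mu>) PM fst"
proof -
  have "distr (splitting_kernel q \<mu>) PM fst = distr (thinning_kernel q \<mu>) PM (\<lambda>\<nu>. \<nu>)"
    unfolding splitting_kernel_def
    by (subst distr_distr[OF measurable_fst measurable_split[OF assms]]) (simp add: comp_def)
  also have "\<dots> = thinning_kernel q \<mu>"
    by (rule distr_id2[OF sets_thinning_kernel[symmetric]])
  finally show ?thesis ..
qed

lemma thinning_kernel_measurable: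
  assumes q: "0 \<le> q" "q \<le> 1"
  shows "thinning_kernel q \<in> measurable PM (subprob_algebra PM)"
proof (subst measurable_cong[where g="\<lambda>\<mu>. distr (splitting_kernel q \<mu>) PM fst"])
  show "(\<lambda>\<mu>. distr (splitting_kernel q \<mu>) PM fst) \<in> measurable PM (subprob_algebra PM)"
    by (rule measurable_compose[OF splitting_kernel_measurable[OF q] measurable_distr[OF measurable_fst]])
qed (simp add: thinning_kernel_marginal space_PM)

lemma nn_integral_thinning_kernel:
  assumes \<mu>: "\<mu> \<in> point_measures" and f: "f \<in> bounded_support_functions" and q: "0 \<le> q" "q \<le> 1"
  shows "(\<integral>\<^sup>+\<nu>. ennreal (exp (- (\<integral>x. f x \<partial>\<nu>))) \<partial>thinning_kernel q \<mu>) =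
    ennreal (exp (- (\<integral>x. mixture q f (\<lambda>_. 0) x \<partial>\<mu>)))"
  using laplace_splitting_kernel[OF \<mu> f _ q, of "\<lambda>_. 0"] zero_nonneg_tests
  by (simp add: nonneg_tests_def)

definition laplace :: "'a::polish_space measure measure \<Rightarrow> ('a \<Rightarrow> real) \<Rightarrow> real" where
  "laplace P f = (\<integral>\<mu>. exp (- (\<integral>x. f x \<partial>\<mu>)) \<partial>P)"

section \<open>Factorization of the splitting law as an equation for the Laplace functional\<close>

locale point_process_law =
  fixes P :: "'a::polish_space measure measure"
  assumes point_process: "point_process P"
begin

sublocale prob_space P
  using point_process by (simp add: point_process_def)

lemma sets_P: "sets P = sets PM"
  using point_process by (simp add: point_process_def)

lemma space_P: "space P = point_measures"
  using sets_eq_imp_space_eq[OF sets_P] by (simp add: space_PM)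

lemma measurable_P: "f \<in> measurable PM N \<Longrightarrow> f \<in> measurable P N"
  by (simp only: measurable_cong_sets[OF sets_P refl])

lemma laplace_integrable:
  assumes "f \<in> nonneg_tests"
  shows "integrable P (\<lambda>\<mu>. exp (- (\<integral>x. f x \<partial>\<mu>)))"
proof (rule integrable_const_bound[where B=1])
  have "f \<in> bounded_support_functions" using assms by (simp add: nonneg_tests_def)
  note [measurable] = measurable_P[OF borel_measurable_PM_integral[OF this]]
  show "(\<lambda>\<mu>. exp (- (\<integral>x. f x \<partial>\<mu>))) \<in> borel_measurable P" by measurable
  show "AE \<mu> in P. norm (exp (- (\<integral>x. f x \<partial>\<mu>))) \<le> 1"
    using assms by (intro AE_I2) (simp add: nonneg_tests_def Bochner_Integration.integral_nonneg)
qed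

lemma laplace_nonneg: "0 \<le> laplace P f"
  unfolding laplace_def by (intro Bochner_Integration.integral_nonneg) simp

lemma laplace_pos:
  assumes f: "f \<in> nonneg_tests"
  shows "0 < laplace P f"
proof -
  have "laplace P f \<noteq> 0"
  proof
    assume "laplace P f = 0"
    then have "AE \<mu> in P. exp (- (\<integral>x. f x \<partial>\<mu>)) = 0"
      using integral_nonneg_eq_0_iff_AE[OF laplace_integrable[OF f]] by (simp add: laplace_def)
    then have "AE \<mu> in P. False" by eventually_elim simp
    then show False by simp
  qed
  with laplace_nonneg[of f] show ?thesis by simp
qed

lemma nn_integral_laplace:
  assumes "f \<in> nonneg_tests"
  shows "(\<integral>\<^sup>+\<mu>. ennreal (exp (- (\<integral>x. f x \<partial>\<mu>))) \<partial>P) = ennreal (laplace P f)"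
  unfolding laplace_def by (rule nn_integral_eq_integral[OF laplace_integrable[OF assms]]) simp

lemma splitting_law_eq: "splitting_law q P = P \<bind> splitting_kernel q"
  by (simp add: splitting_law_def splitting_kernel_def[abs_def])

context
  fixes q :: real
  assumes q: "0 \<le> q" "q \<le> 1"
begin

lemma sets_splitting_law: "sets (splitting_law q P) = sets (PM \<Otimes>\<^sub>M PM)"
  unfolding splitting_law_eq by (rule sets_bind) (auto simp: sets_splitting_kernel not_empty)

lemma prob_space_splitting_law: "prob_space (splitting_law q P)"
  unfolding splitting_law_eq
  by (intro prob_space_bind[OF _ measurable_P[OF splitting_kernel_measurable[OF q]]])
    (auto simp: space_P prob_space_splitting_kernel)

lemma sets_thinning: "sets (thinning q P) = sets PM"
  unfolding thinning_def by (rule sets_bind) (auto simp: sets_thinning_kernel not_empty)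

lemma prob_space_thinning: "prob_space (thinning q P)"
  unfolding thinning_def
  by (intro prob_space_bind[OF _ measurable_P[OF thinning_kernel_measurable[OF q]]])
    (auto simp: space_P prob_space_thinning_kernel)

lemma laplace_splitting_law:
  assumes fg: "f \<in> nonneg_tests" "g \<in> nonneg_tests"
  shows "(\<integral>\<^sup>+p. ennreal (pair_laplace f g p) \<partial>splitting_law q P) = ennreal (laplace P (mixture q f g))"
proof -
  have bs: "f \<in> bounded_support_functions" "g \<in> bounded_support_functions"
    using fg by (auto simp: nonneg_tests_def)
  have "(\<integral>\<^sup>+p. ennreal (pair_laplace f g p) \<partial>splitting_law q P) =
      (\<integral>\<^sup>+\<mu>. \<integral>\<^sup>+p. ennreal (pair_laplace f g p) \<partial>splitting_kernel q \<mu> \<partial>P)"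
    unfolding splitting_law_eq
    by (rule nn_integral_bind[OF measurable_compose[OF pair_laplace_measurable[OF bs] measurable_ennreal]
          measurable_P[OF splitting_kernel_measurable[OF q]]])
  also have "\<dots> = (\<integral>\<^sup>+\<mu>. ennreal (exp (- (\<integral>x. mixture q f g x \<partial>\<mu>))) \<partial>P)"
    by (intro nn_integral_cong nn_integral_splitting_kernel bs q) (simp add: space_P)
  finally show ?thesis by (simp add: nn_integral_laplace mixture_nonneg_tests fg q)
qed

lemma laplace_thinning:
  assumes f: "f \<in> nonneg_tests"
  shows "(\<integral>\<^sup>+\<nu>. ennreal (exp (- (\<integral>x. f x \<partial>\<nu>))) \<partial>thinning q P) =
    ennreal (laplace P (mixture q f (\<lambda>_. 0)))"
proof -
  have bs: "f \<in> bounded_support_functions" using f by (auto simp: nonneg_tests_def)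
  have "(\<integral>\<^sup>+\<nu>. ennreal (exp (- (\<integral>x. f x \<partial>\<nu>))) \<partial>thinning q P) =
      (\<integral>\<^sup>+\<mu>. \<integral>\<^sup>+\<nu>. ennreal (exp (- (\<integral>x. f x \<partial>\<nu>))) \<partial>thinning_kernel q \<mu> \<partial>P)"
    unfolding thinning_def
    by (rule nn_integral_bind[OF borel_measurable_PM_laplace[OF bs]
          measurable_P[OF thinning_kernel_measurable[OF q]]])
  also have "\<dots> = (\<integral>\<^sup>+\<mu>. ennreal (exp (- (\<integral>x. mixture q f (\<lambda>_. 0) x \<partial>\<mu>))) \<partial>P)"
    by (intro nn_integral_cong nn_integral_thinning_kernel bs q) (simp add: space_P)
  finally show ?thesis by (simp add: nn_integral_laplace mixture_nonneg_tests zero_nonneg_tests f q)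
qed

end

lemma laplace_thinning_pair:
  assumes fg: "f \<in> nonneg_tests" "g \<in> nonneg_tests" and q: "0 \<le> q" "q \<le> 1"
  shows "(\<integral>\<^sup>+p. ennreal (pair_laplace f g p) \<partial>(thinning q P \<Otimes>\<^sub>M thinning (1 - q) P)) =
    ennreal (laplace P (mixture q f (\<lambda>_. 0)) * laplace P (mixture (1 - q) g (\<lambda>_. 0)))"
proof -
  have q': "0 \<le> 1 - q" "1 - q \<le> 1" using q by auto
  interpret B: prob_space "thinning (1 - q) P" by (rule prob_space_thinning[OF q'])
  have bs: "f \<in> bounded_support_functions" "g \<in> bounded_support_functions"
    using fg by (auto simp: nonneg_tests_def)
  have sets: "sets (thinning q P \<Otimes>\<^sub>M thinning (1 - q) P) = sets (PM \<Otimes>\<^sub>M PM)"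
    by (intro sets_pair_measure_cong sets_thinning q q')
  have g_meas: "(\<lambda>\<nu>. ennreal (exp (- (\<integral>x. g x \<partial>\<nu>)))) \<in> borel_measurable (thinning (1 - q) P)"
    using borel_measurable_PM_laplace[OF bs(2)]
    by (simp only: measurable_cong_sets[OF sets_thinning[OF q'] refl])
  have f_meas: "(\<lambda>\<nu>. ennreal (exp (- (\<integral>x. f x \<partial>\<nu>)))) \<in> borel_measurable (thinning q P)"
    using borel_measurable_PM_laplace[OF bs(1)]
    by (simp only: measurable_cong_sets[OF sets_thinning[OF q] refl])
  have "(\<integral>\<^sup>+p. ennreal (pair_laplace f g p) \<partial>(thinning q P \<Otimes>\<^sub>M thinning (1 - q) P)) =
      (\<integral>\<^sup>+\<nu>. \<integral>\<^sup>+\<kappa>. ennreal (pair_laplace f g (\<nu>, \<kappa>)) \<partial>thinning (1 - q) P \<partial>thinning q P)"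
  proof (rule B.nn_integral_fst[symmetric])
    show "(\<lambda>p. ennreal (pair_laplace f g p)) \<in> borel_measurable (thinning q P \<Otimes>\<^sub>M thinning (1 - q) P)"
      using measurable_compose[OF pair_laplace_measurable[OF bs] measurable_ennreal]
      by (simp only: measurable_cong_sets[OF sets refl])
  qed
  also have "\<dots> = (\<integral>\<^sup>+\<nu>. \<integral>\<^sup>+\<kappa>. ennreal (exp (- (\<integral>x. f x \<partial>\<nu>))) * ennreal (exp (- (\<integral>x. g x \<partial>\<kappa>)))
      \<partial>thinning (1 - q) P \<partial>thinning q P)"
    by (simp add: pair_laplace_def exp_add[symmetric] ennreal_mult[symmetric])
  also have "\<dots> = (\<integral>\<^sup>+\<nu>. ennreal (exp (- (\<integral>x. f x \<partial>\<nu>))) *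
      (\<integral>\<^sup>+\<kappa>. ennreal (exp (- (\<integral>x. g x \<partial>\<kappa>))) \<partial>thinning (1 - q) P) \<partial>thinning q P)"
    by (intro nn_integral_cong nn_integral_cmult g_meas)
  also have "\<dots> = (\<integral>\<^sup>+\<nu>. ennreal (exp (- (\<integral>x. f x \<partial>\<nu>))) \<partial>thinning q P) *
      (\<integral>\<^sup>+\<kappa>. ennreal (exp (- (\<integral>x. g x \<partial>\<kappa>))) \<partial>thinning (1 - q) P)"
    by (rule nn_integral_multc[OF f_meas])
  also have "\<dots> = ennreal (laplace P (mixture q f (\<lambda>_. 0)) * laplace P (mixture (1 - q) g (\<lambda>_. 0)))"
    by (simp add: laplace_thinning fg q q' laplace_nonneg ennreal_mult)
  finally show ?thesis .
qed

text \<open>Both sides are probability laws on the same sigma-algebra, so they coincide exactly when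
  their Laplace functionals do. Both directions of the theorem work with this functional
  equation.\<close>

lemma splitting_law_factorizes_iff:
  assumes q: "0 \<le> q" "q \<le> 1"
  shows "splitting_law q P = thinning q P \<Otimes>\<^sub>M thinning (1 - q) P \<longleftrightarrow>
    (\<forall>f\<in>nonneg_tests. \<forall>g\<in>nonneg_tests.
      laplace P (mixture q f g) = laplace P (mixture q f (\<lambda>_. 0)) * laplace P (mixture (1 - q) g (\<lambda>_. 0)))"
    (is "?L = ?R \<longleftrightarrow> ?eq")
proof
  assume eq: "?L = ?R"
  show ?eq
  proof (intro ballI)
    fix f g :: "'a \<Rightarrow> real" assume fg: "f \<in> nonneg_tests" "g \<in> nonneg_tests"
    have "ennreal (laplace P (mixture q f g)) =
        ennreal (laplace P (mixture q f (\<lambda>_. 0)) * laplace P (mixture (1 - q) g (\<lambda>_. 0)))"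
      unfolding laplace_splitting_law[OF q fg, symmetric] laplace_thinning_pair[OF fg q, symmetric] eq ..
    then show "laplace P (mixture q f g) =
        laplace P (mixture q f (\<lambda>_. 0)) * laplace P (mixture (1 - q) g (\<lambda>_. 0))"
      by (subst (asm) ennreal_inj) (auto intro: laplace_nonneg mult_nonneg_nonneg)
  qed
next
  assume eq: ?eq
  have q': "0 \<le> 1 - q" "1 - q \<le> 1" using q by auto
  show "?L = ?R"
  proof (rule pair_measure_eqI_laplace)
    show "prob_space ?L" by (rule prob_space_splitting_law[OF q])
    show "sets ?L = sets (PM \<Otimes>\<^sub>M PM)" by (rule sets_splitting_law[OF q])
    show "prob_space ?R"
      by (intro prob_space_pair prob_space_thinning q q')
    show "sets ?R = sets (PM \<Otimes>\<^sub>M PM)" by (intro sets_pair_measure_cong sets_thinning q q')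
  next
    fix f g :: "'a \<Rightarrow> real" assume fg: "f \<in> nonneg_tests" "g \<in> nonneg_tests"
    then show "(\<integral>\<^sup>+p. ennreal (pair_laplace f g p) \<partial>?L) = (\<integral>\<^sup>+p. ennreal (pair_laplace f g p) \<partial>?R)"
      using eq by (simp add: laplace_splitting_law[OF q fg] laplace_thinning_pair[OF fg q])
  qed
qed

end

text \<open>An error bound \<open>e * t\<close>, valid for small \<open>t\<close>, propagates to
  larger \<open>t\<close>: the errors at \<open>q * t\<close> and \<open>(1 - q) * t\<close> add up,
  and their bounds add up to \<open>e * t\<close> again. No loss accumulates, so the bound reaches
  \<open>t = 1\<close> for every positive \<open>e\<close>.\<close>

lemma additive_derivative_linear:
  fixes \<phi> :: "real \<Rightarrow> real"
  assumes q: "0 < q" "q < 1"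
    and add: "\<And>t. 0 \<le> t \<Longrightarrow> t \<le> 1 \<Longrightarrow> \<phi> t = \<phi> (q * t) + \<phi> ((1 - q) * t)"
    and deriv: "((\<lambda>s. \<phi> s / s) \<longlongrightarrow> l) (at 0 within {0<..1})"
  shows "\<phi> 1 = l"
proof -
  have "\<bar>\<phi> 1 - l\<bar> \<le> e" if e: "e > 0" for e
  proof -
    obtain d where d: "d > 0" "\<And>s. 0 < s \<Longrightarrow> s \<le> 1 \<Longrightarrow> s < d \<Longrightarrow> dist (\<phi> s / s) l < e"
      using tendstoD[OF deriv e] by (auto simp: eventually_at)
    have base: "\<bar>\<phi> s - l * s\<bar> \<le> e * s" if "0 < s" "s \<le> 1" "s < d" for s
    proof -
      have "\<bar>\<phi> s - l * s\<bar> = \<bar>\<phi> s / s - l\<bar> * s"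
        using that by (simp add: abs_mult_pos field_simps)
      also have "\<dots> \<le> e * s"
        using d(2)[OF that] that by (intro mult_right_mono) (auto simp: dist_real_def)
      finally show ?thesis .
    qed
    \<comment> \<open>After \<open>n\<close> splittings every argument is at most
      \<open>b ^ n * t\<close>, so finitely many splittings bring all of them into the range of the
      derivative estimate.\<close>
    define b where "b = max q (1 - q)"
    have b: "0 < b" "b < 1" "q \<le> b" "1 - q \<le> b" using q by (auto simp: b_def)
    have step: "\<bar>\<phi> t - l * t\<bar> \<le> e * t" if "0 < t" "t \<le> 1" "b ^ n * t < d" for n t
      using that
    proof (induction n arbitrary: t)
      case 0
      then show ?case using base by simp
    next
      case (Suc n)
      have *: "b ^ n * (r * t) < d" if "r \<le> b" for r
      proof -
        have "b ^ n * (r * t) \<le> b ^ n * (b * t)"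
          using that Suc.prems b by (intro mult_left_mono mult_right_mono) auto
        also have "\<dots> < d" using Suc.prems(3) by (simp add: mult_ac)
        finally show ?thesis .
      qed
      have "\<bar>\<phi> (q * t) - l * (q * t)\<bar> \<le> e * (q * t)"
        using Suc.prems q b by (intro Suc.IH *) (auto intro: mult_le_one)
      moreover have "\<bar>\<phi> ((1 - q) * t) - l * ((1 - q) * t)\<bar> \<le> e * ((1 - q) * t)"
        using Suc.prems q b by (intro Suc.IH *) (auto intro: mult_le_one)
      moreover have "\<phi> t - l * t = (\<phi> (q * t) - l * (q * t)) + (\<phi> ((1 - q) * t) - l * ((1 - q) * t))"
        using add[of t] Suc.prems by (simp add: algebra_simps)
      ultimately have "\<bar>\<phi> t - l * t\<bar> \<le> e * (q * t) + e * ((1 - q) * t)" by linarith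
      then show ?case by (simp add: algebra_simps)
    qed
    obtain n where "b ^ n < d" using real_arch_pow_inv[OF d(1) b(2)] by auto
    then show ?thesis using step[of 1 n] by simp
  qed
  then have "\<bar>\<phi> 1 - l\<bar> \<le> 0" by (rule field_le_epsilon) simp
  then show ?thesis by simp
qed

text \<open>The reciprocal form of \<open>1 + y \<le> exp y\<close>; it supplies the lower bound of
  the difference quotient of the Laplace functional at 0.\<close>

lemma one_minus_exp_ge:
  fixes y :: real
  assumes "0 \<le> y"
  shows "y / (1 + y) \<le> 1 - exp (- y)"
proof -
  have "exp (- y) \<le> 1 / (1 + y)"
    using exp_ge_add_one_self[of y] assms by (simp add: exp_minus field_simps)
  moreover have "1 - 1 / (1 + y) = y / (1 + y)" using assms by (simp add: field_simps)
  ultimately show ?thesis by linarith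
qed

text \<open>As \<open>exp (- log_test w t) = 1 - t w\<close>, thinning acts on these test functions by scaling \<open>t\<close>.\<close>

definition log_test :: "('a \<Rightarrow> real) \<Rightarrow> real \<Rightarrow> 'a \<Rightarrow> real" where
  "log_test w t x = - ln (1 - t * w x)"

section \<open>The first moment measure and Campbell's formula\<close>

lemma sets_first_moment_measure: "sets (first_moment_measure P) = sets borel"
  using sets.sets_measure_of_eq[of borel] by (simp add: first_moment_measure_def)

context point_process_law
begin

lemma emeasure_first_moment:
  assumes B: "B \<in> sets borel"
  shows "emeasure (first_moment_measure P) B = (\<integral>\<^sup>+\<mu>. emeasure \<mu> B \<partial>P)"
  unfolding first_moment_measure_def
proof (rule emeasure_measure_of_sigma)
  show "sigma_algebra UNIV (sets borel)"
    using sets.sigma_algebra_axioms[of borel] by simp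
  show "countably_additive (sets borel) (\<lambda>B. \<integral>\<^sup>+\<mu>. emeasure \<mu> B \<partial>P)"
  proof (rule countably_additiveI)
    fix A :: "nat \<Rightarrow> 'a set" assume A: "range A \<subseteq> sets borel" "disjoint_family A"
    then have [measurable]: "(\<lambda>\<mu>. emeasure \<mu> (A i)) \<in> borel_measurable P" for i
      by (intro measurable_P borel_measurable_PM_emeasure) auto
    have "(\<Sum>i. \<integral>\<^sup>+\<mu>. emeasure \<mu> (A i) \<partial>P) = (\<integral>\<^sup>+\<mu>. (\<Sum>i. emeasure \<mu> (A i)) \<partial>P)"
      by (rule nn_integral_suminf[symmetric]) measurable
    also have "\<dots> = (\<integral>\<^sup>+\<mu>. emeasure \<mu> (\<Union>i. A i) \<partial>P)"
      using A by (intro nn_integral_cong suminf_emeasure) (auto simp: space_P point_measures_sets)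
    finally show "(\<Sum>i. \<integral>\<^sup>+\<mu>. emeasure \<mu> (A i) \<partial>P) = (\<integral>\<^sup>+\<mu>. emeasure \<mu> (\<Union>i. A i) \<partial>P)" .
  qed
qed (auto simp: positive_def B)

text \<open>Campbell's formula, extended from indicators by linearity and monotone limits.\<close>

lemma nn_integral_first_moment:
  fixes u :: "'a \<Rightarrow> ennreal"
  assumes "u \<in> borel_measurable borel"
  shows "(\<integral>\<^sup>+x. u x \<partial>first_moment_measure P) = (\<integral>\<^sup>+\<mu>. \<integral>\<^sup>+x. u x \<partial>\<mu> \<partial>P)"
  using assms
proof (induction rule: borel_measurable_induct)
  case (cong f g)
  then have "f = g" by auto
  with cong show ?case by simp
next
  case (set A)
  have "(\<integral>\<^sup>+\<mu>. \<integral>\<^sup>+x. indicator A x \<partial>\<mu> \<partial>P) = (\<integral>\<^sup>+\<mu>. emeasure \<mu> A \<partial>P)"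
    using set by (intro nn_integral_cong nn_integral_indicator) (auto simp: space_P point_measures_sets)
  with set show ?case
    by (simp add: emeasure_first_moment sets_first_moment_measure)
next
  case (mult u c)
  have "(\<integral>\<^sup>+\<mu>. \<integral>\<^sup>+x. c * u x \<partial>\<mu> \<partial>P) = (\<integral>\<^sup>+\<mu>. c * (\<integral>\<^sup>+x. u x \<partial>\<mu>) \<partial>P)"
    using mult by (intro nn_integral_cong nn_integral_cmult) (auto simp: space_P intro: measurable_point_measure)
  also have "\<dots> = c * (\<integral>\<^sup>+\<mu>. \<integral>\<^sup>+x. u x \<partial>\<mu> \<partial>P)"
    using mult by (intro nn_integral_cmult measurable_P borel_measurable_PM_nn_integral)
  finally show ?case
    using mult by (simp add: nn_integral_cmult measurable_cong_sets[OF sets_first_moment_measure refl])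
next
  case (add u v)
  have "(\<integral>\<^sup>+\<mu>. \<integral>\<^sup>+x. v x + u x \<partial>\<mu> \<partial>P) = (\<integral>\<^sup>+\<mu>. (\<integral>\<^sup>+x. v x \<partial>\<mu>) + (\<integral>\<^sup>+x. u x \<partial>\<mu>) \<partial>P)"
    using add by (intro nn_integral_cong nn_integral_add) (auto simp: space_P intro: measurable_point_measure)
  also have "\<dots> = (\<integral>\<^sup>+\<mu>. \<integral>\<^sup>+x. v x \<partial>\<mu> \<partial>P) + (\<integral>\<^sup>+\<mu>. \<integral>\<^sup>+x. u x \<partial>\<mu> \<partial>P)"
    using add by (intro nn_integral_add measurable_P borel_measurable_PM_nn_integral)
  finally show ?case
    using add by (simp add: nn_integral_add measurable_cong_sets[OF sets_first_moment_measure refl])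
next
  case (seq U)
  have bm: "U i \<in> borel_measurable (first_moment_measure P)" for i
    using seq(1)[of i] by (simp add: measurable_cong_sets[OF sets_first_moment_measure refl])
  have mono: "mono (\<lambda>i. \<integral>\<^sup>+x. U i x \<partial>\<mu>)" for \<mu>
    using seq by (auto simp: incseq_def le_fun_def intro!: monoI nn_integral_mono)
  have "(\<integral>\<^sup>+\<mu>. \<integral>\<^sup>+x. (SUP i. U i x) \<partial>\<mu> \<partial>P) = (\<integral>\<^sup>+\<mu>. (SUP i. \<integral>\<^sup>+x. U i x \<partial>\<mu>) \<partial>P)"
    using seq by (intro nn_integral_cong nn_integral_monotone_convergence_SUP)
      (auto simp: space_P intro: measurable_point_measure)
  also have "\<dots> = (SUP i. \<integral>\<^sup>+\<mu>. \<integral>\<^sup>+x. U i x \<partial>\<mu> \<partial>P)"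
    using seq mono by (intro nn_integral_monotone_convergence_SUP measurable_P borel_measurable_PM_nn_integral)
      (auto simp: incseq_def le_fun_def mono_def)
  also have "\<dots> = (SUP i. \<integral>\<^sup>+x. U i x \<partial>first_moment_measure P)" by (simp add: seq)
  also have "\<dots> = (\<integral>\<^sup>+x. (SUP i. U i x) \<partial>first_moment_measure P)"
    using seq bm by (intro nn_integral_monotone_convergence_SUP[symmetric]) auto
  finally show ?case unfolding seq(4) SUP_apply ..
qed

text \<open>First order makes \<open>w\<close> integrable against the first moment measure; by
  Campbell's formula the random integral of \<open>w\<close> then has finite expectation, and it
  provides the majorant for the derivative at 0.\<close>

lemma integral_first_moment:
  assumes first_order: "first_order P" and w: "w \<in> nonneg_tests"
  shows "integrable P (\<lambda>\<mu>. \<integral>x. w x \<partial>\<mu>)"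
    and "(\<integral>x. w x \<partial>first_moment_measure P) = (\<integral>\<mu>. \<integral>x. w x \<partial>\<mu> \<partial>P)"
proof -
  have bs: "w \<in> bounded_support_functions" and nonneg: "\<And>x. 0 \<le> w x"
    using w by (auto simp: nonneg_tests_def)
  have [measurable]: "w \<in> borel_measurable borel" using bs by (simp add: bounded_support_functions_def)
  have lf: "\<mu> \<in> locally_finite_measures" if "\<mu> \<in> space P" for \<mu>
    using that by (simp add: space_P point_measures_def)
  have int: "integrable (first_moment_measure P) w"
    using first_order by (intro bounded_support_integrable bs) (simp add: first_order_def)
  have inner: "(\<integral>\<^sup>+x. ennreal (w x) \<partial>\<mu>) = ennreal (\<integral>x. w x \<partial>\<mu>)" if "\<mu> \<in> space P" for \<mu>
    using bounded_support_integrable[OF bs lf[OF that]] nonneg by (intro nn_integral_eq_integral) auto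
  have "(\<integral>\<^sup>+\<mu>. ennreal (\<integral>x. w x \<partial>\<mu>) \<partial>P) = (\<integral>\<^sup>+\<mu>. \<integral>\<^sup>+x. ennreal (w x) \<partial>\<mu> \<partial>P)"
    by (intro nn_integral_cong) (simp add: inner)
  also have "\<dots> = (\<integral>\<^sup>+x. ennreal (w x) \<partial>first_moment_measure P)"
    by (rule nn_integral_first_moment[symmetric]) measurable
  also have "\<dots> = ennreal (\<integral>x. w x \<partial>first_moment_measure P)"
    using int nonneg by (intro nn_integral_eq_integral) auto
  finally have eq: "(\<integral>\<^sup>+\<mu>. ennreal (\<integral>x. w x \<partial>\<mu>) \<partial>P) = ennreal (\<integral>x. w x \<partial>first_moment_measure P)" .
  have bm: "(\<lambda>\<mu>. \<integral>x. w x \<partial>\<mu>) \<in> borel_measurable P"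
    by (intro measurable_P borel_measurable_PM_integral bs)
  have pos: "0 \<le> (\<integral>x. w x \<partial>\<mu>)" for \<mu> using nonneg by (intro Bochner_Integration.integral_nonneg) auto
  show "integrable P (\<lambda>\<mu>. \<integral>x. w x \<partial>\<mu>)"
    using bm pos eq by (intro integrableI_nonneg) auto
  show "(\<integral>x. w x \<partial>first_moment_measure P) = (\<integral>\<mu>. \<integral>x. w x \<partial>\<mu> \<partial>P)"
    using integral_eq_nn_integral[OF bm] eq pos by simp
qed

section \<open>The Laplace functional along \<open>t * w\<close>, with \<open>w\<close> bounded away
  from 1\<close>

context
  fixes w :: "'a \<Rightarrow> real" and c :: real
  assumes w: "w \<in> nonneg_tests" and w_le: "\<And>x. w x \<le> c" and c: "c < 1"
begin

lemma scaled_bound: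
  assumes "0 \<le> t" "t \<le> 1"
  shows "0 \<le> t * w x" "t * w x \<le> t * c" "t * c < 1" "0 \<le> c"
proof -
  have w0: "0 \<le> w x" using w by (simp add: nonneg_tests_def)
  then show c0: "0 \<le> c" using w_le[of x] by simp
  show "0 \<le> t * w x" using w0 assms by simp
  show "t * w x \<le> t * c" using w_le[of x] assms by (intro mult_left_mono)
  have "t * c \<le> 1 * c" using assms c0 by (intro mult_right_mono) auto
  then show "t * c < 1" using c by simp
qed

lemma exp_log_test:
  assumes "0 \<le> t" "t \<le> 1"
  shows "exp (- log_test w t x) = 1 - t * w x"
  using scaled_bound(1,2)[OF assms, of x] scaled_bound(3)[OF assms] by (simp add: log_test_def)

text \<open>Both follow from \<open>ln y \<le> y - 1\<close>, taken at
  \<open>y = 1 - t * w x\<close> and at its reciprocal; the final denominator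
  \<open>1 - t * c\<close> no longer depends on \<open>x\<close>, so the bounds can be
  integrated.\<close>

lemma log_test_bounds:
  assumes "0 \<le> t" "t \<le> 1"
  shows "t * w x \<le> log_test w t x" "log_test w t x \<le> t * w x / (1 - t * c)"
proof -
  note b = scaled_bound(1,2)[OF assms, of x] scaled_bound(3,4)[OF assms]
  show "t * w x \<le> log_test w t x"
    using ln_le_minus_one[of "1 - t * w x"] b by (simp add: log_test_def)
  have "log_test w t x = ln (1 / (1 - t * w x))"
    using b by (simp add: log_test_def ln_div)
  also have "\<dots> \<le> 1 / (1 - t * w x) - 1"
    using b by (intro ln_le_minus_one) simp
  also have "\<dots> = t * w x / (1 - t * w x)" using b by (simp add: field_simps)
  also have "\<dots> \<le> t * w x / (1 - t * c)"
    using b by (intro divide_left_mono mult_pos_pos) auto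
  finally show "log_test w t x \<le> t * w x / (1 - t * c)" .
qed

lemma log_test_nonneg_tests:
  assumes t: "0 \<le> t" "t \<le> 1"
  shows "log_test w t \<in> nonneg_tests"
proof -
  have bs: "w \<in> bounded_support_functions" using w by (simp add: nonneg_tests_def)
  then have [measurable]: "w \<in> borel_measurable borel" by (simp add: bounded_support_functions_def)
  have nonneg: "0 \<le> log_test w t x" for x
    using log_test_bounds(1)[OF t, of x] scaled_bound(1)[OF t, of x] by linarith
  have "log_test w t \<in> bounded_support_functions"
  proof (rule bounded_support_functionsI)
    show "log_test w t \<in> borel_measurable borel" unfolding log_test_def by measurable
    show "\<bar>log_test w t x\<bar> \<le> t * c / (1 - t * c)" for x
    proof -
      have "t * w x / (1 - t * c) \<le> t * c / (1 - t * c)"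
        using scaled_bound(2)[OF t, of x] scaled_bound(3)[OF t] by (intro divide_right_mono) auto
      then show ?thesis using log_test_bounds(2)[OF t, of x] nonneg[of x] by linarith
    qed
    show "bounded {x. w x \<noteq> 0}" using bs by (simp add: bounded_support_functions_def)
    show "log_test w t x = 0" if "x \<notin> {x. w x \<noteq> 0}" for x using that by (simp add: log_test_def)
  qed
  with nonneg show ?thesis by (simp add: nonneg_tests_def)
qed

lemma mixture_log_test:
  assumes "0 \<le> t" "t \<le> 1" "0 \<le> q" "q \<le> 1"
  shows "mixture q (log_test w t) (log_test w t) = log_test w t"
    and "mixture q (log_test w t) (\<lambda>_. 0) = log_test w (q * t)"
proof -
  have "mixture q (log_test w t) (log_test w t) x = log_test w t x" for x
    unfolding mixture_def exp_log_test[OF assms(1,2)] by (simp add: log_test_def algebra_simps)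
  then show "mixture q (log_test w t) (log_test w t) = log_test w t" by (rule ext)
  have "mixture q (log_test w t) (\<lambda>_. 0) x = log_test w (q * t) x" for x
    unfolding mixture_def exp_log_test[OF assms(1,2)] by (simp add: log_test_def algebra_simps)
  then show "mixture q (log_test w t) (\<lambda>_. 0) = log_test w (q * t)" by (rule ext)
qed

lemma integral_log_test_bounds:
  assumes t: "0 \<le> t" "t \<le> 1" and \<mu>: "\<mu> \<in> point_measures"
  shows "t * (\<integral>x. w x \<partial>\<mu>) \<le> (\<integral>x. log_test w t x \<partial>\<mu>)"
    and "(\<integral>x. log_test w t x \<partial>\<mu>) \<le> t * (\<integral>x. w x \<partial>\<mu>) / (1 - t * c)"
proof -
  have lf: "\<mu> \<in> locally_finite_measures" using \<mu> by (simp add: point_measures_def)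
  have int: "integrable \<mu> w" "integrable \<mu> (log_test w t)"
    using w log_test_nonneg_tests[OF t]
    by (auto intro!: bounded_support_integrable[OF _ lf] simp: nonneg_tests_def)
  have "(\<integral>x. t * w x \<partial>\<mu>) \<le> (\<integral>x. log_test w t x \<partial>\<mu>)"
    using int log_test_bounds(1)[OF t] by (intro integral_mono) auto
  then show "t * (\<integral>x. w x \<partial>\<mu>) \<le> (\<integral>x. log_test w t x \<partial>\<mu>)" by simp
  have "(\<integral>x. log_test w t x \<partial>\<mu>) \<le> (\<integral>x. t * w x / (1 - t * c) \<partial>\<mu>)"
    using int log_test_bounds(2)[OF t] by (intro integral_mono) auto
  then show "(\<integral>x. log_test w t x \<partial>\<mu>) \<le> t * (\<integral>x. w x \<partial>\<mu>) / (1 - t * c)" by simp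
qed

text \<open>Both bounds tend to the integral of \<open>w\<close> against \<open>\<mu>\<close> as
  \<open>t\<close> tends to 0, which identifies the pointwise limit of the quotient.\<close>

lemma exp_log_test_quotient_bounds:
  assumes t: "0 < t" "t \<le> 1" and \<mu>: "\<mu> \<in> point_measures"
  shows "(\<integral>x. w x \<partial>\<mu>) / (1 + t * (\<integral>x. w x \<partial>\<mu>)) \<le> (1 - exp (- (\<integral>x. log_test w t x \<partial>\<mu>))) / t"
    and "(1 - exp (- (\<integral>x. log_test w t x \<partial>\<mu>))) / t \<le> (\<integral>x. w x \<partial>\<mu>) / (1 - t * c)"
proof -
  define m where "m = (\<integral>x. w x \<partial>\<mu>)"
  define a where "a = (\<integral>x. log_test w t x \<partial>\<mu>)"
  have m: "0 \<le> m"
    unfolding m_def using w by (intro Bochner_Integration.integral_nonneg) (simp add: nonneg_tests_def)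
  have a: "t * m \<le> a" "a \<le> t * m / (1 - t * c)"
    using integral_log_test_bounds[OF _ t(2) \<mu>] t by (auto simp: m_def a_def)
  have "t * m / (1 + t * m) \<le> 1 - exp (- (t * m))"
    using t m by (intro one_minus_exp_ge) simp
  also have "\<dots> \<le> 1 - exp (- a)" using a by simp
  finally have "t * m / (1 + t * m) / t \<le> (1 - exp (- a)) / t"
    using t by (intro divide_right_mono) auto
  then show "m / (1 + t * m) \<le> (1 - exp (- a)) / t" using t by simp
  have "1 - exp (- a) \<le> a" using exp_ge_add_one_self[of "- a"] by linarith
  also note a(2)
  finally have "(1 - exp (- a)) / t \<le> t * m / (1 - t * c) / t"
    using t by (intro divide_right_mono) auto
  then show "(1 - exp (- a)) / t \<le> m / (1 - t * c)" using t by simp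
qed

text \<open>For fixed \<open>\<mu>\<close> the quotient is squeezed to the integral of
  \<open>w\<close>; limit and expectation are exchanged with the majorant
  \<open>m \<mu> / (1 - c)\<close>, which is integrable by first order.\<close>

lemma laplace_log_test_derivative:
  assumes first_order: "first_order P"
  shows "((\<lambda>t. (1 - laplace P (log_test w t)) / t) \<longlongrightarrow> (\<integral>x. w x \<partial>first_moment_measure P))
    (at 0 within {0<..1})"
  unfolding tendsto_at_iff_sequentially
proof (intro allI impI)
  fix X :: "nat \<Rightarrow> real" assume "\<forall>i. X i \<in> {0<..1} - {0}" and X0: "X \<longlonglongrightarrow> 0"
  then have X: "0 < X i" "X i \<le> 1" for i by auto
  have bs: "log_test w (X i) \<in> nonneg_tests" for i
    using X[of i] by (intro log_test_nonneg_tests) auto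
  define m where "m \<mu> = (\<integral>x. w x \<partial>\<mu>)" for \<mu>
  have m: "0 \<le> m \<mu>" for \<mu>
    unfolding m_def using w by (intro Bochner_Integration.integral_nonneg) (simp add: nonneg_tests_def)
  have int_m: "integrable P m" "(\<integral>x. w x \<partial>first_moment_measure P) = (\<integral>\<mu>. m \<mu> \<partial>P)"
    unfolding m_def using integral_first_moment[OF first_order w] by auto
  have "(\<lambda>i. \<integral>\<mu>. (1 - exp (- (\<integral>x. log_test w (X i) x \<partial>\<mu>))) / X i \<partial>P) \<longlonglongrightarrow> (\<integral>\<mu>. m \<mu> \<partial>P)"
  proof (rule integral_dominated_convergence[where w="\<lambda>\<mu>. m \<mu> / (1 - c)"])
    show "m \<in> borel_measurable P" using int_m(1) by auto
    show "integrable P (\<lambda>\<mu>. m \<mu> / (1 - c))" using int_m(1) by auto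
    show "(\<lambda>\<mu>. (1 - exp (- (\<integral>x. log_test w (X i) x \<partial>\<mu>))) / X i) \<in> borel_measurable P" for i
      using borel_measurable_integrable[OF laplace_integrable[OF bs[of i]]] by measurable
    show "AE \<mu> in P. (\<lambda>i. (1 - exp (- (\<integral>x. log_test w (X i) x \<partial>\<mu>))) / X i) \<longlonglongrightarrow> m \<mu>"
    proof (rule AE_I2)
      fix \<mu> assume "\<mu> \<in> space P"
      then have \<mu>: "\<mu> \<in> point_measures" by (simp add: space_P)
      have "(\<lambda>i. m \<mu> / (1 + X i * m \<mu>)) \<longlonglongrightarrow> m \<mu> / (1 + 0 * m \<mu>)"
        by (intro tendsto_intros X0) simp
      then have lower: "(\<lambda>i. m \<mu> / (1 + X i * m \<mu>)) \<longlonglongrightarrow> m \<mu>" by simp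
      have "(\<lambda>i. m \<mu> / (1 - X i * c)) \<longlonglongrightarrow> m \<mu> / (1 - 0 * c)"
        by (intro tendsto_intros X0) simp
      then have upper: "(\<lambda>i. m \<mu> / (1 - X i * c)) \<longlonglongrightarrow> m \<mu>" by simp
      show "(\<lambda>i. (1 - exp (- (\<integral>x. log_test w (X i) x \<partial>\<mu>))) / X i) \<longlonglongrightarrow> m \<mu>"
        by (rule tendsto_sandwich[OF _ _ lower upper])
          (simp_all only: m_def exp_log_test_quotient_bounds[OF X \<mu>] eventually_True)
    qed
    show "AE \<mu> in P. norm ((1 - exp (- (\<integral>x. log_test w (X i) x \<partial>\<mu>))) / X i) \<le> m \<mu> / (1 - c)" for i
    proof (rule AE_I2)
      fix \<mu> assume "\<mu> \<in> space P"
      then have \<mu>: "\<mu> \<in> point_measures" by (simp add: space_P)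
      have c': "0 < 1 - c" "1 - c \<le> 1 - X i * c"
        using X[of i] c scaled_bound(4)[of 0] mult_right_mono[of "X i" 1 c] by auto
      have "0 \<le> m \<mu> / (1 + X i * m \<mu>)" using m[of \<mu>] X[of i] by simp
      moreover have "m \<mu> / (1 - X i * c) \<le> m \<mu> / (1 - c)"
        using c' m[of \<mu>] by (intro divide_left_mono mult_pos_pos) auto
      ultimately show "norm ((1 - exp (- (\<integral>x. log_test w (X i) x \<partial>\<mu>))) / X i) \<le> m \<mu> / (1 - c)"
        using exp_log_test_quotient_bounds[OF X[of i] \<mu>] unfolding m_def real_norm_def by linarith
    qed
  qed
  moreover have "(\<integral>\<mu>. (1 - exp (- (\<integral>x. log_test w (X i) x \<partial>\<mu>))) / X i \<partial>P) =
      (1 - laplace P (log_test w (X i))) / X i" for i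
    using laplace_integrable[OF bs[of i]] by (simp add: laplace_def prob_space)
  ultimately show "((\<lambda>t. (1 - laplace P (log_test w t)) / t) \<circ> X) \<longlonglongrightarrow>
      (\<integral>x. w x \<partial>first_moment_measure P)"
    by (simp only: int_m(2) comp_def)
qed

lemma laplace_le_1: "f \<in> nonneg_tests \<Longrightarrow> laplace P f \<le> 1"
  unfolding laplace_def
  by (intro integral_le_const laplace_integrable AE_I2)
    (auto simp: nonneg_tests_def intro!: Bochner_Integration.integral_nonneg)

text \<open>\<open>1 - L\<close> and \<open>- ln L\<close> have the same right derivative at 0,
  because \<open>L\<close> tends to 1 there. The derivative of the former comes from the first
  moment, while the latter is additive under splitting.\<close>

lemma laplace_factorizing:
  assumes first_order: "first_order P" and q: "0 < q" "q < 1"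
    and fact: "splitting_law q P = thinning q P \<Otimes>\<^sub>M thinning (1 - q) P"
  shows "laplace P (log_test w 1) = exp (- (\<integral>x. w x \<partial>first_moment_measure P))"
proof -
  let ?F = "at (0::real) within {0<..1}"
  define l where "l = (\<integral>x. w x \<partial>first_moment_measure P)"
  define L where "L t = laplace P (log_test w t)" for t
  have L: "0 < L t" "L t \<le> 1" if "0 \<le> t" "t \<le> 1" for t
    unfolding L_def using log_test_nonneg_tests[OF that] by (auto intro: laplace_pos laplace_le_1)
  have quot: "((\<lambda>t. (1 - L t) / t) \<longlongrightarrow> l) ?F"
    unfolding L_def l_def by (rule laplace_log_test_derivative[OF first_order])
  have ev: "\<forall>\<^sub>F t in ?F. 0 < t \<and> t \<le> 1"
    by (auto simp: eventually_at intro!: exI[of _ 1])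
  \<comment> \<open>\<open>1 - L t\<close> is \<open>t\<close> times a quotient with a finite limit,
    hence tends to 0.\<close>
  have "((\<lambda>t. 1 - t * ((1 - L t) / t)) \<longlongrightarrow> 1 - 0 * l) ?F"
    by (intro tendsto_intros quot)
  moreover have "\<forall>\<^sub>F t in ?F. 1 - t * ((1 - L t) / t) = L t"
    using ev by eventually_elim simp
  ultimately have L_lim: "(L \<longlongrightarrow> 1) ?F"
    by (simp add: filterlim_cong[OF refl refl])
  \<comment> \<open>Squeezed by \<open>1 - y \<le> - ln y \<le> (1 - y) / y\<close> at
    \<open>y = L t\<close>.\<close>
  have deriv: "((\<lambda>t. - ln (L t) / t) \<longlongrightarrow> l) ?F"
  proof (rule tendsto_sandwich[OF _ _ quot])
    show "\<forall>\<^sub>F t in ?F. (1 - L t) / t \<le> - ln (L t) / t"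
      using ev
    proof eventually_elim
      fix t :: real assume t: "0 < t \<and> t \<le> 1"
      then have "1 - L t \<le> - ln (L t)" using ln_le_minus_one[OF L(1)[of t]] by simp
      then show "(1 - L t) / t \<le> - ln (L t) / t" using t by (intro divide_right_mono) auto
    qed
    show "\<forall>\<^sub>F t in ?F. - ln (L t) / t \<le> (1 - L t) / t / L t"
      using ev
    proof eventually_elim
      fix t :: real assume t: "0 < t \<and> t \<le> 1"
      then have pos: "0 < L t" using L(1)[of t] by simp
      have "- ln (L t) = ln (1 / L t)" using pos by (simp add: ln_div)
      also have "\<dots> \<le> 1 / L t - 1" using pos by (intro ln_le_minus_one) simp
      also have "\<dots> = (1 - L t) / L t" using pos by (simp add: field_simps)
      finally have "- ln (L t) / t \<le> (1 - L t) / L t / t" using t by (intro divide_right_mono) auto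
      then show "- ln (L t) / t \<le> (1 - L t) / t / L t" by (simp add: mult.commute)
    qed
    have "((\<lambda>t. (1 - L t) / t / L t) \<longlongrightarrow> l / 1) ?F"
      by (intro tendsto_divide[OF quot L_lim]) simp
    then show "((\<lambda>t. (1 - L t) / t / L t) \<longlongrightarrow> l) ?F" by simp
  qed
  have "- ln (L 1) = l"
  proof (rule additive_derivative_linear[OF q _ deriv])
    fix t :: real assume t: "0 \<le> t" "t \<le> 1"
    have q': "0 \<le> q" "q \<le> 1" "0 \<le> 1 - q" "1 - q \<le> 1" using q by auto
    have "laplace P (mixture q (log_test w t) (log_test w t)) =
        laplace P (mixture q (log_test w t) (\<lambda>_. 0)) * laplace P (mixture (1 - q) (log_test w t) (\<lambda>_. 0))"
      using fact splitting_law_factorizes_iff[OF q'(1,2)] log_test_nonneg_tests[OF t] by blast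
    then have "L t = L (q * t) * L ((1 - q) * t)"
      unfolding L_def mixture_log_test[OF t q'(1,2)] mixture_log_test(2)[OF t q'(3,4)] .
    moreover have "0 < L (q * t)" "0 < L ((1 - q) * t)"
      using t q' by (auto intro!: L mult_le_one)
    ultimately show "- ln (L t) = - ln (L (q * t)) + - ln (L ((1 - q) * t))"
      by (simp add: ln_mult)
  qed
  then have "ln (L 1) = - l" by simp
  then have "L 1 = exp (- l)" using L(1)[of 1] by (metis exp_ln zero_le_one order_refl)
  then show ?thesis by (simp add: L_def l_def)
qed

end

section \<open>Poisson Laplace functionals and the factorization equation\<close>

lemma poisson_test_iff:
  "f \<in> nonneg_tests \<longleftrightarrow> f \<in> borel_measurable borel \<and> (\<forall>x. 0 \<le> f x) \<and> bounded (range f) \<and>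
    bounded {x. f x \<noteq> 0}"
  by (auto simp: nonneg_tests_def bounded_support_functions_def)

lemma poisson_with_intensity_iff:
  "poisson_with_intensity \<rho> P \<longleftrightarrow>
    (\<forall>f\<in>nonneg_tests. laplace P f = exp (- (\<integral>x. 1 - exp (- f x) \<partial>\<rho>)))"
  unfolding poisson_with_intensity_def laplace_def Ball_def poisson_test_iff
  using point_process by simp

text \<open>A bound \<open>b\<close> of \<open>f\<close> gives \<open>c = 1 - exp (- b)\<close>,
  strictly below 1, so that the derivative argument applies to \<open>1 - exp (- f x)\<close> for
  every test function \<open>f\<close>.\<close>

lemma one_minus_exp_tests:
  assumes f: "f \<in> nonneg_tests"
  obtains c where "(\<lambda>x. 1 - exp (- f x)) \<in> nonneg_tests" "\<And>x. 1 - exp (- f x) \<le> c" "c < 1"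
proof -
  have bs: "f \<in> bounded_support_functions" and nonneg: "\<And>x. 0 \<le> f x"
    using f by (auto simp: nonneg_tests_def)
  obtain b where b: "0 \<le> b" "\<forall>x. \<bar>f x\<bar> \<le> b" by (rule bounded_support_bound[OF bs])
  have le: "1 - exp (- f x) \<le> 1 - exp (- b)" for x
    using b(2)[rule_format, of x] by simp
  have "(\<lambda>x. 1 - exp (- f x)) \<in> bounded_support_functions"
  proof (rule bounded_support_functionsI)
    show "\<bar>1 - exp (- f x)\<bar> \<le> 1" for x using nonneg[of x] by simp
    show "bounded {x. f x \<noteq> 0}" using bs by (simp add: bounded_support_functions_def)
    have [measurable]: "f \<in> borel_measurable borel" using bs by (simp add: bounded_support_functions_def)
    show "(\<lambda>x. 1 - exp (- f x)) \<in> borel_measurable borel" by measurable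
  qed simp
  then have "(\<lambda>x. 1 - exp (- f x)) \<in> nonneg_tests" using nonneg by (simp add: nonneg_tests_def)
  then show ?thesis using le by (rule that) simp
qed

lemma factorizing_imp_poisson:
  assumes first_order: "first_order P" and q: "0 < q" "q < 1"
    and fact: "splitting_law q P = thinning q P \<Otimes>\<^sub>M thinning (1 - q) P"
  shows "poisson_with_intensity (first_moment_measure P) P"
  unfolding poisson_with_intensity_iff
proof
  fix f :: "'a \<Rightarrow> real" assume "f \<in> nonneg_tests"
  then obtain c where c: "(\<lambda>x. 1 - exp (- f x)) \<in> nonneg_tests" "\<And>x. 1 - exp (- f x) \<le> c" "c < 1"
    using one_minus_exp_tests by blast
  \<comment> \<open>At \<open>t = 1\<close> the logarithmic test function returns \<open>f\<close>,
    so the value found there is the Laplace functional at an arbitrary admissible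
    \<open>f\<close>.\<close>
  have "log_test (\<lambda>x. 1 - exp (- f x)) 1 = f" by (simp add: log_test_def fun_eq_iff)
  then show "laplace P f = exp (- (\<integral>x. 1 - exp (- f x) \<partial>first_moment_measure P))"
    using laplace_factorizing[OF c first_order q fact] by simp
qed

lemma poisson_imp_factorizing:
  assumes \<rho>: "\<rho> \<in> locally_finite_measures" and poisson: "poisson_with_intensity \<rho> P"
    and q: "0 \<le> q" "q \<le> 1"
  shows "splitting_law q P = thinning q P \<Otimes>\<^sub>M thinning (1 - q) P"
  unfolding splitting_law_factorizes_iff[OF q]
proof (intro ballI)
  have q': "0 \<le> 1 - q" "1 - q \<le> 1" using q by auto
  have lap: "laplace P h = exp (- (\<integral>x. 1 - exp (- h x) \<partial>\<rho>))" if "h \<in> nonneg_tests" for h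
    using poisson that by (simp add: poisson_with_intensity_iff)
  fix f g :: "'a \<Rightarrow> real" assume fg: "f \<in> nonneg_tests" "g \<in> nonneg_tests"
  have int: "integrable \<rho> (\<lambda>x. 1 - exp (- h x))" if h: "h \<in> nonneg_tests" for h
  proof -
    obtain c where "(\<lambda>x. 1 - exp (- h x)) \<in> nonneg_tests" "\<And>x. 1 - exp (- h x) \<le> c" "c < 1"
      using one_minus_exp_tests[OF h] by blast
    then show ?thesis by (intro bounded_support_integrable \<rho>) (simp add: nonneg_tests_def)
  qed
  \<comment> \<open>\<open>1 - exp (- u)\<close> mixes linearly, so the Poisson exponent is a sum of
    one term for each component; a zero second function leaves the term of the marginal.\<close>
  have mix: "1 - exp (- mixture r u v x) = r * (1 - exp (- u x)) + (1 - r) * (1 - exp (- v x))"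
    if "0 \<le> r" "r \<le> 1" for r u v and x :: 'a
    unfolding exp_mixture[OF that] by (simp add: algebra_simps)
  have "(\<integral>x. 1 - exp (- mixture q f g x) \<partial>\<rho>) =
      q * (\<integral>x. 1 - exp (- f x) \<partial>\<rho>) + (1 - q) * (\<integral>x. 1 - exp (- g x) \<partial>\<rho>)"
    unfolding mix[OF q] using int[OF fg(1)] int[OF fg(2)] by simp
  moreover have "(\<integral>x. 1 - exp (- mixture q f (\<lambda>_. 0) x) \<partial>\<rho>) = q * (\<integral>x. 1 - exp (- f x) \<partial>\<rho>)"
    unfolding mix[OF q] by simp
  moreover have "(\<integral>x. 1 - exp (- mixture (1 - q) g (\<lambda>_. 0) x) \<partial>\<rho>) = (1 - q) * (\<integral>x. 1 - exp (- g x) \<partial>\<rho>)"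
    unfolding mix[OF q'] by simp
  ultimately show "laplace P (mixture q f g) =
      laplace P (mixture q f (\<lambda>_. 0)) * laplace P (mixture (1 - q) g (\<lambda>_. 0))"
    by (simp add: lap mixture_nonneg_tests zero_nonneg_tests fg q q' exp_add[symmetric])
qed

end

theorem theorem1:
  fixes P :: "'a::polish_space measure measure"
  assumes "point_process P" and "first_order P"
  shows "poisson_process P \<longleftrightarrow>
    (\<exists>q::real. 0 < q \<and> q < 1 \<and>
       splitting_law q P = thinning q P \<Otimes>\<^sub>M thinning (1 - q) P)"
proof -
  interpret point_process_law P
    by (rule point_process_law.intro) fact
  show ?thesis
  proof
    assume "poisson_process P"
    then obtain \<rho> where "\<rho> \<in> locally_finite_measures" "poisson_with_intensity \<rho> P"
      by (auto simp: poisson_process_def)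
    \<comment> \<open>The factorization holds for every \<open>q\<close> in the unit interval;
      \<open>1/2\<close> is just a convenient witness.\<close>
    then have "splitting_law (1/2) P = thinning (1/2) P \<Otimes>\<^sub>M thinning (1 - 1/2) P"
      by (rule poisson_imp_factorizing) auto
    then show "\<exists>q::real. 0 < q \<and> q < 1 \<and>
        splitting_law q P = thinning q P \<Otimes>\<^sub>M thinning (1 - q) P"
      by (intro exI[of _ "1/2"]) simp
  next
    assume "\<exists>q::real. 0 < q \<and> q < 1 \<and>
        splitting_law q P = thinning q P \<Otimes>\<^sub>M thinning (1 - q) P"
    \<comment> \<open>The intensity obtained is the first moment measure, and first order says
      exactly that it is locally finite.\<close>
    then have "poisson_with_intensity (first_moment_measure P) P"
      using factorizing_imp_poisson[OF assms(2)] by auto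
    then show "poisson_process P"
      using assms(2) by (auto simp: poisson_process_def first_order_def)
  qed
qed

end
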